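(* There exist numerical constants $c_1,c_2>0$ such that the following holds. Let $\mathbf{D}=\mathbf{L}+\mathbf{C}\in\mathbb{R}^{N_1\times N_2}$ follow Data Model 1 (see context), with $\operatorname{rank}(\mathbf{L})=r$, $K\ge1$ non-zero columns (outliers) in $\mathbf{C}$, $N_2'=N_2-K$ inlier columns; let $\mu_v'$ be the row-space incoherency parameter of $\mathbf{L}'$ and $\eta_u$ the column-space incoherency parameter of $\mathbf{L}$. Suppose the non-zero elements of $\mathbf{C}$ (the entries of its $K$ non-zero columns) are sampled independently from a zero-mean normal distribution. Fix $c>1$ and $0<\delta<1/6$. Let $$\alpha=\max\Big\{20\,\mu_v' r\log\frac{4r}{\delta},\; 3c^2\frac{K}{N_2'}\log\frac{2}{\delta}\Big\},$$ and suppose $$m_1\ge \beta\alpha\frac{N_2}{N_2'},\qquad \beta\ge 2+\frac{3}{\alpha}\log\frac{2}{\delta},\qquad q=\alpha\Big(\frac{\beta K}{N_2'}+\frac1c\Big),$$ $$m_2\ge\max\Bigg[r\eta_u^2\max\Big(c_1\log r,\,c_2\log\frac3\delta\Big),\ r+q+2\log\frac2\delta+\sqrt{8q\log\frac2\delta},\ r+1+2\log\frac{2K}\delta+\sqrt{8\log\frac{2K}{\delta}}\Bigg].$$ Suppose $m_1$ columns of $\mathbf{D}$ are sampled uniformly at random with replacement and any repeated columns are removed, and $m_2$ rows are sampled uniformly at random without replacement. Then, with probability at least $1-6\delta$, Algorithm 1 with row sampling (described in the context) yields the exact subspace, i.e. its output $\mathbf{T}$ is a basis for the column space of $\mathbf{L}$,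 and the non-zero columns of the matrix $\mathbf{H}$ (defined in the context) are located exactly at the indices of the non-zero columns of $\mathbf{C}$.
   Context: **Data Model 1.** $\mathbf{D}=\mathbf{L}+\mathbf{C}\in\mathbb{R}^{N_1\times N_2}$ with $\operatorname{rank}(\mathbf{L})=r$. $\mathbf{C}$ has exactly $K$ non-zero columns, with index set $\mathcal{I}$; if $\mathbf{U}\in\mathbb{R}^{N_1\times r}$ is an orthonormal basis for the column space of $\mathbf{L}$, then $(\mathbf{I}-\mathbf{U}\mathbf{U}^T)\mathbf{C}_i\ne 0$ for $i\in\mathcal{I}$, where $\mathbf{C}_i$ is the $i$th column. Moreover $\mathbf{L}_i=\mathbf{0}$ for $i\in\mathcal{I}$. Columns of $\mathbf{D}$ with index in $\mathcal{I}$ are outliers, the others are inliers. $\mathbf{L}'\in\mathbb{R}^{N_1\times N_2'}$ is the matrix of the non-zero columns of $\mathbf{L}$ (the inlier columns), with $N_2=K+N_2'$. **Randomness.** $\mathbf{L}$ and $\mathcal{I}$ are fixed; all entries of the columns of $\mathbf{C}$ indexed by $\mathcal{I}$ are i.i.d. $\mathcal{N}(0,\sigma^2)$ for some $\sigma>0$; the column sampling, row sampling and $\mathbf{C}$ are mutually independent. **Incoherency.** If $\mathbf{V}'\in\mathbb{R}^{N_2'\times r}$ is an orthonormal basis for the row space of $\mathbf{L}'$, then $\mu_v'$ satisfies $\max_i\|\mathbf{e}_i^T\mathbf{V}'\|_2^2\le r\mu_v'/N_2'$. Also $\eta_u=\sqrt{N_1}\max_{i,j}|\mathbf{U}(i,j)|$,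 with $\mathbf{U}$ an orthonormal basis for the column space of $\mathbf{L}$. **Algorithm 1 with row sampling (RRD).** 1. Sample columns: $\mathbf{D}_s=\mathbf{D}\mathbf{S}$, where the columns of $\mathbf{S}$ are standard basis vectors selecting the sampled columns. 2. Compress: $\mathbf{D}_s^\phi=\mathbf{\Phi}\mathbf{D}_s$, where the rows of $\mathbf{\Phi}\in\mathbb{R}^{m_2\times N_1}$ are standard basis vectors selecting the $m_2$ sampled rows. 3. For each $i$, let $\mathbf{d}^i_{\phi s}$ be the $i$th column of $\mathbf{D}_s^\phi$ and $\mathbf{Q}_i^\phi$ be $\mathbf{D}_s^\phi$ with its $i$th column removed; declare column $i$ an inlier if $\min_{\mathbf{z}}\|\mathbf{d}^i_{\phi s}-\mathbf{Q}_i^\phi\mathbf{z}\|_2=0$ and an outlier otherwise. 4. Output $\mathbf{T}$: the columns of $\mathbf{D}_s$ corresponding to a linearly independent set of declared-inlier columns of $\mathbf{D}_s^\phi$ that spans the span of all declared-inlier columns of $\mathbf{D}_s^\phi$. **Outlier identification.** Let $\hat{\mathbf{U}}^\phi$ be an orthonormal basis for the span of the declared-inlier columns of $\mathbf{D}_s^\phi$ (the learned estimate of the column space of $\mathbf{\Phi}\mathbf{L}$). Define $\mathbf{H}=(\mathbf{I}-\hat{\mathbf{U}}^\phi(\hat{\mathbf{U}}^\phi)^T)\,\mathbf{\Phi}\mathbf{D}$.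
   Formalization: Two conditions are added, as the claim fails without them: the expected number m_1K/N_2 of outlier draws, or K itself, is at most q (m_1 is only bounded from below), and every inlier column lies in the span of the other inlier columns (repeated draws are removed). *)

theory Defs
  imports
    "HOL-Probability.Probability"
    "Jordan_Normal_Form.DL_Rank"
    "Jordan_Normal_Form.DL_Submatrix"
begin

(* The dimensions of all matrices are quantified inside the statement (after the numerical
   constants), so matrices are those of Jordan_Normal_Form; rows and columns are numbered from 0. *)

unbundle no vec_syntax
unbundle no inner_syntax

abbreviation vspan :: "nat \<Rightarrow> real vec set \<Rightarrow> real vec set" where
  "vspan n \<equiv> LinearCombinations.module.span class_ring (module_vec TYPE(real) n)"

abbreviation vindpt :: "nat \<Rightarrow> real vec set \<Rightarrow> bool" where
  "vindpt n S \<equiv> \<not> LinearCombinations.module.lin_dep class_ring (module_vec TYPE(real) n) S"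

abbreviation mat_rank :: "real mat \<Rightarrow> nat" where
  "mat_rank A \<equiv> vec_space.rank (dim_row A) A"

definition colspace :: "real mat \<Rightarrow> real vec set" where
  "colspace A = vspan (dim_row A) (set (cols A))"

definition rowspace :: "real mat \<Rightarrow> real vec set" where
  "rowspace A = vspan (dim_col A) (set (rows A))"

definition l2norm :: "real vec \<Rightarrow> real" where
  "l2norm v = sqrt (v \<bullet> v)"

definition nonzero_cols :: "real mat \<Rightarrow> nat set" where
  "nonzero_cols A = {j. j < dim_col A \<and> col A j \<noteq> 0\<^sub>v (dim_row A)}"

definition select_cols :: "real mat \<Rightarrow> nat set \<Rightarrow> real mat" where
  "select_cols A J = submatrix A UNIV J"

definition is_col_basis :: "real mat \<Rightarrow> real vec set \<Rightarrow> bool" where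
  "is_col_basis B W \<longleftrightarrow>
     distinct (cols B) \<and> vindpt (dim_row B) (set (cols B)) \<and> colspace B = W"

definition is_orthonormal_basis :: "real mat \<Rightarrow> real vec set \<Rightarrow> bool" where
  "is_orthonormal_basis U W \<longleftrightarrow> U\<^sup>T * U = 1\<^sub>m (dim_col U) \<and> colspace U = W"

definition complement_proj :: "real mat \<Rightarrow> real mat" where
  "complement_proj U = 1\<^sub>m (dim_row U) - U * U\<^sup>T"

definition data_model1 ::
  "nat \<Rightarrow> nat \<Rightarrow> nat \<Rightarrow> nat \<Rightarrow> real mat \<Rightarrow> real mat \<Rightarrow> nat set \<Rightarrow> bool" where
  "data_model1 N1 N2 r K L C I \<longleftrightarrow>
     L \<in> carrier_mat N1 N2 \<and> C \<in> carrier_mat N1 N2 \<and> mat_rank L = r \<and>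
     nonzero_cols C = I \<and> card I = K \<and>
     (\<forall>U \<in> carrier_mat N1 r. is_orthonormal_basis U (colspace L) \<longrightarrow>
        (\<forall>i\<in>I. complement_proj U *\<^sub>v col C i \<noteq> 0\<^sub>v N1)) \<and>
     (\<forall>i\<in>I. col L i = 0\<^sub>v N1) \<and> nonzero_cols L = {..<N2} - I"

definition inlier_mat :: "real mat \<Rightarrow> real mat" where
  "inlier_mat L = select_cols L (nonzero_cols L)"

definition row_incoherent :: "real mat \<Rightarrow> real \<Rightarrow> bool" where
  "row_incoherent V \<mu> \<longleftrightarrow>
     Max ((\<lambda>i. (l2norm (row V i))\<^sup>2) ` {..<dim_row V}) \<le> real (dim_col V) * \<mu> / real (dim_row V)"

definition eta_param :: "real mat \<Rightarrow> real" where
  "eta_param U = sqrt (real (dim_row U)) *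
     Max ((\<lambda>(i, j). \<bar>U $$ (i, j)\<bar>) ` ({..<dim_row U} \<times> {..<dim_col U}))"

definition outlier_mat :: "nat \<Rightarrow> nat \<Rightarrow> nat set \<Rightarrow> (nat \<times> nat \<Rightarrow> real) \<Rightarrow> real mat" where
  "outlier_mat N1 N2 I g = mat N1 N2 (\<lambda>(i, j). if j \<in> I then g (i, j) else 0)"

definition noise_law :: "nat \<Rightarrow> nat set \<Rightarrow> real \<Rightarrow> (nat \<times> nat \<Rightarrow> real) measure" where
  "noise_law N1 I \<sigma> = (\<Pi>\<^sub>M p \<in> {..<N1} \<times> I. density lborel (\<lambda>x. ennreal (normal_density 0 \<sigma> x)))"

definition col_draws :: "nat \<Rightarrow> nat \<Rightarrow> nat list pmf" where
  "col_draws N2 m1 = replicate_pmf m1 (pmf_of_set {..<N2})"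

definition row_draws :: "nat \<Rightarrow> nat \<Rightarrow> nat list pmf" where
  "row_draws N1 m2 = pmf_of_set {ys. length ys = m2 \<and> distinct ys \<and> set ys \<subseteq> {..<N1}}"

definition rrd_law :: "nat \<Rightarrow> nat \<Rightarrow> nat \<Rightarrow> nat \<Rightarrow> nat set \<Rightarrow> real \<Rightarrow>
    (nat list \<times> nat list \<times> (nat \<times> nat \<Rightarrow> real)) measure" where
  "rrd_law N1 N2 m1 m2 I \<sigma> =
     measure_pmf (col_draws N2 m1) \<Otimes>\<^sub>M (measure_pmf (row_draws N1 m2) \<Otimes>\<^sub>M noise_law N1 I \<sigma>)"

(* "Repeated columns" are repeated draws of the same index. *)
definition col_sampling_mat :: "nat \<Rightarrow> nat list \<Rightarrow> real mat" where
  "col_sampling_mat N2 xs = mat_of_cols N2 (map (unit_vec N2) (remdups xs))"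

definition row_sampling_mat :: "nat \<Rightarrow> nat list \<Rightarrow> real mat" where
  "row_sampling_mat N1 ys = mat_of_rows N1 (map (unit_vec N1) ys)"

(* "The minimum over z of the residual norm is 0": some minimiser z has residual norm 0. *)
definition declared_inlier :: "real mat \<Rightarrow> nat \<Rightarrow> bool" where
  "declared_inlier A i \<longleftrightarrow>
     (let Q = select_cols A (- {i}); res = (\<lambda>z. l2norm (col A i - Q *\<^sub>v z))
      in \<exists>z. is_arg_min res (\<lambda>z. z \<in> carrier_vec (dim_col Q)) z \<and> res z = 0)"

definition declared_inliers :: "real mat \<Rightarrow> nat set" where
  "declared_inliers A = {i. i < dim_col A \<and> declared_inlier A i}"

definition learned_space :: "real mat \<Rightarrow> real vec set" where
  "learned_space A = vspan (dim_row A) (col A ` declared_inliers A)"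

(* The algorithm leaves the choice of the independent spanning columns open:
   this is the set of all outputs it may return. *)
definition rrd_outputs :: "real mat \<Rightarrow> real mat \<Rightarrow> real mat set" where
  "rrd_outputs \<Phi> Ds = {select_cols Ds J | J. J \<subseteq> declared_inliers (\<Phi> * Ds) \<and>
     is_col_basis (select_cols (\<Phi> * Ds) J) (learned_space (\<Phi> * Ds))}"

definition exact_subspace :: "real mat \<Rightarrow> real mat \<Rightarrow> real mat \<Rightarrow> bool" where
  "exact_subspace L \<Phi> Ds \<longleftrightarrow>
     rrd_outputs \<Phi> Ds \<noteq> {} \<and> (\<forall>T \<in> rrd_outputs \<Phi> Ds. is_col_basis T (colspace L))"

definition outliers_located :: "real mat \<Rightarrow> real mat \<Rightarrow> real mat \<Rightarrow> real mat \<Rightarrow> bool" where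
  "outliers_located C D \<Phi> Ds \<longleftrightarrow>
     (\<forall>k. \<forall>U \<in> carrier_mat (dim_row \<Phi>) k. is_orthonormal_basis U (learned_space (\<Phi> * Ds)) \<longrightarrow>
        nonzero_cols (complement_proj U * (\<Phi> * D)) = nonzero_cols C)"

definition rrd_success :: "real mat \<Rightarrow> real mat \<Rightarrow> nat list \<Rightarrow> nat list \<Rightarrow> bool" where
  "rrd_success L C xs ys \<longleftrightarrow>
     (let D = L + C;
          \<Phi> = row_sampling_mat (dim_row D) ys;
          Ds = D * col_sampling_mat (dim_col D) xs
      in exact_subspace L \<Phi> Ds \<and> outliers_located C D \<Phi> Ds)"

(* Two side conditions of the theorem make explicit what its quantitative hypotheses leave open.

   Every inlier column lies in the span of the other inlier columns.  Since repeated draws are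
   removed, an inlier violating this is never in the span of the other sampled inliers, and the
   algorithm cannot recover it however many columns are drawn (e.g. r = N2' = 1, \<mu>' = 1).

   The expected number of outlier draws, or the number K of all outliers, is at most q.
   As m1 is only bounded from below, nothing else makes q a bound for the sampled outliers: for
   fixed \<beta>, K = N2' large and m1 tending to infinity, all K outliers get sampled while m2
   may be as small as O(log K), and then they are all declared inliers.
   The smallest m1 with m1 >= \<beta> \<alpha> N2 / N2' satisfies the condition. *)

end

theory Submission
  imports Defs "Jordan_Normal_Form.Gram_Schmidt"
begin

text \<open>Matrix concentration is avoided.  If \<open>P\<close> projects onto the orthogonal complement of the vectors
  sampled so far from a Parseval frame \<open>v\<close> with \<open>\<parallel>v j\<parallel>\<^sup>2 \<le> B\<close>, then \<open>tr P = (\<Sum>j. \<parallel>P v j\<parallel>\<^sup>2)\<close>, so at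
  least \<open>tr P / B\<close> of the vectors lie outside the current span, and sampling one of them lowers
  \<open>tr P\<close> by exactly one.  Hence the expected deficiency decays geometrically, and by Markov's
  inequality the samples span.  Applied to the rows of \<open>U\<close> this makes \<open>\<Phi>\<close> injective on the column
  space of \<open>L\<close>; applied to the rows of \<open>V'\<close> it shows that the sampled inliers span it even after
  omitting any one of them.  A Chernoff bound leaves more rows than \<open>r\<close> plus the number of sampled
  outliers, and then almost surely no compressed Gaussian outlier lies in the span of the
  compressed inliers and the other sampled outliers.  Success depends only on which columns
  lie in which spans, which makes it a measurable event.\<close>

section \<open>Projections onto orthogonal complements\<close>

text \<open>Rows are drawn without replacement and columns with replacement, so the potential has to
  contract on average under both schemes. The trace does: vectors already drawn lie in the span,
  hence are never among those that still help. Its integrality supplies the threshold 1 in Markov's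
  inequality, so \<open>r\<close> times a power of the contraction factor bounds the failure
  probability; this is where the logarithms of \<open>r\<close> and 1/\<delta> in the sample sizes
  come from.

  Spanning alone is not enough for the columns, since a sampled inlier is declared one only if the
  other sampled columns span it. An omission costs a factor 2 in the count of useful vectors, and
  the union over the omitted members costs a further factor \<open>r\<close>; the constant 20 in
  \<alpha>, doubled by \<beta> \<ge> 2, pays for both.

  The random choices are treated in a fixed order. Good column lists and good row lists fail with
  probability at most 2\<delta> and \<delta>, and for every fixed good pair the Gaussian entries
  fail with probability zero. The success predicate quantifies over minimisers, output matrices and
  orthonormal bases; these uncountable quantifiers have to be removed before it can be an
  event.\<close>

definition mv :: "nat \<Rightarrow> (nat \<Rightarrow> nat \<Rightarrow> real) \<Rightarrow> (nat \<Rightarrow> real) \<Rightarrow> nat \<Rightarrow> real" where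
  "mv n P x a = (\<Sum>b<n. P a b * x b)"

definition ip :: "nat \<Rightarrow> (nat \<Rightarrow> real) \<Rightarrow> (nat \<Rightarrow> real) \<Rightarrow> real" where
  "ip n x y = (\<Sum>a<n. x a * y a)"

definition tr :: "nat \<Rightarrow> (nat \<Rightarrow> nat \<Rightarrow> real) \<Rightarrow> real" where
  "tr n P = (\<Sum>a<n. P a a)"

text \<open>Since \<open>x / 0 = 0\<close>, a vector already in the span leaves the projection unchanged; this also makes
  the entries Borel functions of the vectors.\<close>

primrec perp :: "nat \<Rightarrow> (nat \<Rightarrow> real) list \<Rightarrow> nat \<Rightarrow> nat \<Rightarrow> real" where
  "perp n [] = (\<lambda>a b. if a = b \<and> a < n then 1 else 0)"
| "perp n (v # vs) = (\<lambda>a b. perp n vs a b -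
     mv n (perp n vs) v a * mv n (perp n vs) v b / ip n (mv n (perp n vs) v) (mv n (perp n vs) v))"

text \<open>Vanishing outside the index range makes equality of functions agree with equality of
  matrices, so being killed by a projection is one equation between functions.\<close>

definition is_proj :: "nat \<Rightarrow> (nat \<Rightarrow> nat \<Rightarrow> real) \<Rightarrow> bool" where
  "is_proj n P \<longleftrightarrow> (\<forall>a b. P a b = P b a) \<and> (\<forall>a b. a \<ge> n \<longrightarrow> P a b = 0) \<and>
     (\<forall>a b. (\<Sum>c<n. P a c * P c b) = P a b)"

lemma is_proj_sym: "is_proj n P \<Longrightarrow> P a b = P b a"
  and is_proj_outside: "is_proj n P \<Longrightarrow> a \<ge> n \<Longrightarrow> P a b = 0"
  and is_proj_idem: "is_proj n P \<Longrightarrow> (\<Sum>c<n. P a c * P c b) = P a b"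
  unfolding is_proj_def by blast+

lemma mv_outside: "is_proj n P \<Longrightarrow> a \<ge> n \<Longrightarrow> mv n P x a = 0"
  by (simp add: mv_def is_proj_outside)

lemma mv_cong: "(\<And>b. b < n \<Longrightarrow> x b = y b) \<Longrightarrow> mv n P x = mv n P y"
  unfolding mv_def fun_eq_iff by simp

lemma mv_scale: "mv n P (\<lambda>a. k * x a) = (\<lambda>a. k * mv n P x a)"
  by (simp add: mv_def fun_eq_iff sum_distrib_left algebra_simps)

lemma mv_zero [simp]: "mv n P (\<lambda>a. 0) = (\<lambda>a. 0)"
  by (simp add: mv_def fun_eq_iff)

lemma mv_idem:
  assumes "is_proj n P" shows "mv n P (mv n P x) = mv n P x"
proof
  fix a
  have "mv n P (mv n P x) a = (\<Sum>b<n. \<Sum>c<n. P a b * P b c * x c)"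
    by (simp add: mv_def sum_distrib_left mult.assoc)
  also have "\<dots> = (\<Sum>c<n. (\<Sum>b<n. P a b * P b c) * x c)"
    by (subst sum.swap) (simp add: sum_distrib_right)
  finally show "mv n P (mv n P x) a = mv n P x a"
    by (simp add: is_proj_idem[OF assms] mv_def)
qed

lemma ip_mv_left:
  assumes "is_proj n P" shows "ip n (mv n P x) y = ip n x (mv n P y)"
proof -
  have "ip n (mv n P x) y = (\<Sum>a<n. \<Sum>b<n. P a b * x b * y a)"
    by (simp add: ip_def mv_def sum_distrib_right)
  also have "\<dots> = (\<Sum>b<n. \<Sum>a<n. P b a * x b * y a)"
    by (subst sum.swap) (simp add: is_proj_sym[OF assms])
  finally show ?thesis by (simp add: ip_def mv_def sum_distrib_left algebra_simps)
qed

lemma ip_commute: "ip n x y = ip n y x"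
  by (simp add: ip_def mult.commute)

lemma ip_self_mv:
  assumes "is_proj n P" shows "ip n (mv n P x) (mv n P x) = ip n x (mv n P x)"
  by (simp add: ip_mv_left[OF assms] mv_idem[OF assms])

lemma ip_nonneg: "0 \<le> ip n x x"
  by (simp add: ip_def sum_nonneg)

lemma ip_self_eq_0: "ip n x x = 0 \<longleftrightarrow> (\<forall>a<n. x a = 0)"
  by (auto simp add: ip_def sum_nonneg_eq_0_iff)

lemma mv_eq_0_iff:
  assumes "is_proj n P"
  shows "ip n (mv n P v) (mv n P v) = 0 \<longleftrightarrow> mv n P v = (\<lambda>a. 0)"
  using mv_outside[OF assms] unfolding ip_self_eq_0 fun_eq_iff by (metis not_le_imp_less)

text \<open>The vector \<open>w\<close> lies in the range of \<open>P\<close>, so subtracting the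
  rank-one projection onto \<open>w\<close> leaves the projection onto the part of that range
  orthogonal to \<open>w\<close>. If \<open>w\<close> is zero, division by zero gives zero and
  nothing changes.\<close>

lemma is_proj_step:
  assumes P: "is_proj n P" and w: "w = mv n P v"
  shows "is_proj n (\<lambda>a b. P a b - w a * w b / ip n w w)"
proof (cases "ip n w w = 0")
  case True
  then show ?thesis using P by simp
next
  case False
  have Pw: "(\<Sum>c<n. P a c * w c) = w a" for a
    using fun_cong[OF mv_idem[OF P, of v], of a] by (simp add: w mv_def)
  have wP: "(\<Sum>c<n. w c * P c b) = w b" for b
    using Pw[of b] by (simp add: is_proj_sym[OF P, of _ b] mult.commute)
  have ww: "(\<Sum>c<n. w c * w c) = ip n w w" by (simp add: ip_def)
  have "(\<Sum>c<n. (P a c - w a * w c / ip n w w) * (P c b - w c * w b / ip n w w)) =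
      (\<Sum>c<n. P a c * P c b) - (\<Sum>c<n. P a c * w c) * w b / ip n w w
      - w a * (\<Sum>c<n. w c * P c b) / ip n w w
      + w a * (\<Sum>c<n. w c * w c) * w b / (ip n w w * ip n w w)" for a b
    by (simp add: sum_subtractf sum.distrib sum_distrib_left sum_distrib_right sum_divide_distrib
        algebra_simps)
  then have "(\<Sum>c<n. (P a c - w a * w c / ip n w w) * (P c b - w c * w b / ip n w w)) =
      P a b - w a * w b / ip n w w" for a b
    using False by (simp add: is_proj_idem[OF P] Pw wP ww)
  moreover have "w a = 0" if "a \<ge> n" for a using mv_outside[OF P that] w by simp
  ultimately show ?thesis
    unfolding is_proj_def using is_proj_sym[OF P] is_proj_outside[OF P]
    by (simp add: mult.commute)
qed

lemma is_proj_perp: "is_proj n (perp n vs)"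
proof (induction vs)
  case Nil
  have "(\<Sum>c<n. (if a = c \<and> a < n then 1 else 0) * (if c = b \<and> c < n then 1 else 0)) =
      (if a = b \<and> a < n then 1 else (0::real))" for a b
  proof -
    have "(\<Sum>c<n. (if a = c \<and> a < n then 1 else 0) * (if c = b \<and> c < n then 1 else 0)) =
      (\<Sum>c<n. if c = a then (if a = b then 1 else (0::real)) else 0)"
      by (rule sum.cong) auto
    then show ?thesis by (simp add: sum.delta)
  qed
  then show ?case by (auto simp: is_proj_def)
next
  case (Cons v vs)
  then show ?case using is_proj_step[OF Cons refl, of v] by simp
qed

lemma mv_perp_Cons:
  "mv n (perp n (v # vs)) x = (\<lambda>a. mv n (perp n vs) x a -
     mv n (perp n vs) v a * (ip n (mv n (perp n vs) v) x / ip n (mv n (perp n vs) v) (mv n (perp n vs) v)))"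
  by (simp add: mv_def[of n "\<lambda>a b. _ a b"] fun_eq_iff left_diff_distrib sum_subtractf ip_def[of n _ x]
      sum_distrib_left sum_divide_distrib algebra_simps)

text \<open>Entries of a vector beyond its dimension are unspecified, so families obtained through
  \<open>vec_index\<close> can be compared only below \<open>n\<close>.\<close>

lemma perp_cong:
  assumes "list_all2 (\<lambda>u v. \<forall>b<n. u b = v b) us vs"
  shows "perp n us = perp n vs"
  using assms
proof (induction rule: list_all2_induct)
  case (Cons u us v vs)
  have "mv n (perp n vs) u = mv n (perp n vs) v" by (rule mv_cong) (use Cons(1) in simp)
  then show ?case unfolding perp.simps Cons(3) by (simp only:)
qed simp

text \<open>A vector killed earlier is orthogonal to every later direction, because that direction
  lies in the range of the symmetric \<open>P\<close>. For the newest vector the correction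
  subtracts exactly its own projection.\<close>

lemma mv_perp_kills: "v \<in> set vs \<Longrightarrow> mv n (perp n vs) v = (\<lambda>a. 0)"
proof (induction vs)
  case (Cons u vs)
  define P where "P = perp n vs"
  have P: "is_proj n P" by (simp add: P_def is_proj_perp)
  show ?case
  proof (cases "v \<in> set vs")
    case True
    then have 0: "mv n P v = (\<lambda>a. 0)" using Cons by (simp add: P_def)
    then show ?thesis
      unfolding mv_perp_Cons P_def[symmetric] ip_mv_left[OF P] by (simp add: ip_def)
  next
    case False
    then have v: "v = u" using Cons.prems by simp
    show ?thesis unfolding v mv_perp_Cons P_def[symmetric]
      using ip_self_mv[OF P, of u] mv_eq_0_iff[OF P, of u] ip_commute[of n u]
      by (cases "mv n P u = (\<lambda>a. 0)") (auto simp: fun_eq_iff)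
  qed
qed simp

text \<open>The difference between \<open>x\<close> and its projection is a combination of the
  processed vectors. An arbitrary predicate \<open>W\<close> closed under linear combinations
  replaces the span, so that kernels, orthogonality relations and preimages of spans can be plugged
  in directly.\<close>

lemma mv_perp_range:
  assumes add: "\<And>f g. W f \<Longrightarrow> W g \<Longrightarrow> W (\<lambda>a. f a + g a)"
    and scale: "\<And>k f. W f \<Longrightarrow> W (\<lambda>a. k * f a)"
    and zero: "W (\<lambda>a. 0)"
    and cong: "\<And>f g. W f \<Longrightarrow> (\<And>a. a < n \<Longrightarrow> f a = g a) \<Longrightarrow> W g"
  shows "(\<And>v. v \<in> set vs \<Longrightarrow> W v) \<Longrightarrow> W (\<lambda>a. x a - mv n (perp n vs) x a)"
proof (induction vs arbitrary: x)
  case Nil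
  have "mv n (perp n []) x a = x a" if "a < n" for a
  proof -
    have "mv n (perp n []) x a = (\<Sum>b<n. if b = a then x b else 0)"
      unfolding mv_def perp.simps by (rule sum.cong) (use that in auto)
    then show ?thesis using that by simp
  qed
  then show ?case by (intro cong[OF zero]) simp
next
  case (Cons v vs)
  define P where "P = perp n vs"
  define k where "k = ip n (mv n P v) x / ip n (mv n P v) (mv n P v)"
  have IH: "W (\<lambda>a. y a - mv n P y a)" for y using Cons by (simp add: P_def)
  have "W v" using Cons.prems by simp
  from add[OF this scale[OF IH[of v], of "-1"]]
  have Wv: "W (\<lambda>a. v a + (- 1) * (v a - mv n P v a))" .
  have "W (\<lambda>a. (x a - mv n P x a) + k * (v a + (- 1) * (v a - mv n P v a)))"
    by (rule add[OF IH[of x] scale[OF Wv]])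
  then show ?case
    unfolding mv_perp_Cons P_def[symmetric] k_def[symmetric] by (rule cong) (simp add: algebra_simps)
qed

lemma tr_perp_Nil: "tr n (perp n []) = n"
  by (simp add: tr_def)

text \<open>The trace of the subtracted term is \<open>ip n w w / ip n w w\<close>, which is 1 for a
  new direction and, by the convention for division by zero, 0 otherwise.\<close>

lemma tr_perp_Cons:
  "tr n (perp n (v # vs)) = tr n (perp n vs) - (if mv n (perp n vs) v = (\<lambda>a. 0) then 0 else 1)"
proof -
  let ?w = "mv n (perp n vs) v"
  have "tr n (perp n (v # vs)) = tr n (perp n vs) - ip n ?w ?w / ip n ?w ?w"

    by (simp add: tr_def sum_subtractf sum_divide_distrib[symmetric]) (simp add: ip_def)
  then show ?thesis using mv_eq_0_iff[OF is_proj_perp, of n vs v] by auto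
qed

lemma tr_eq_sum_squares:
  assumes "is_proj n P" shows "tr n P = (\<Sum>a<n. \<Sum>c<n. (P a c)\<^sup>2)"
  unfolding tr_def power2_eq_square
  by (rule sum.cong, simp) (metis (mono_tags, lifting) assms is_proj_idem is_proj_sym sum.cong)

lemma tr_nonneg: "is_proj n P \<Longrightarrow> 0 \<le> tr n P"
  by (simp add: tr_eq_sum_squares sum_nonneg)

lemma tr_eq_0:
  assumes "is_proj n P" "tr n P = 0" shows "P = (\<lambda>a b. 0)"
proof -
  have "\<forall>a<n. \<forall>c<n. P a c = 0"
    using assms by (auto simp: tr_eq_sum_squares sum_nonneg_eq_0_iff sum_nonneg)
  moreover have "P a c = 0" if "a \<ge> n \<or> c \<ge> n" for a c
    using that is_proj_outside[OF assms(1)] is_proj_sym[OF assms(1)] by metis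
  ultimately show ?thesis by (meson ext not_le)
qed

text \<open>Integrality separates the two cases of interest: a trace that is not zero is at least
  one. The induction runs over the integers because nonnegativity is known only from the sum of
  squares.\<close>

lemma tr_perp_nat: "\<exists>k::nat. tr n (perp n vs) = real k"
proof -
  have "\<exists>k::int. tr n (perp n vs) = of_int k"
  proof (induction vs)
    case Nil
    then show ?case by (metis of_int_of_nat_eq tr_perp_Nil)
  next
    case (Cons v vs)
    then obtain k :: int where "tr n (perp n vs) = of_int k" by blast
    then show ?case unfolding tr_perp_Cons
      by (intro exI[of _ "k - (if mv n (perp n vs) v = (\<lambda>a. 0) then 0 else 1)"]) simp
  qed
  then obtain k :: int where k: "tr n (perp n vs) = of_int k" by blast
  then have "k \<ge> 0" using tr_nonneg[OF is_proj_perp, of n vs] by simp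
  then show ?thesis using k by (intro exI[of _ "nat k"]) simp
qed

lemma tr_perp_ge: "tr n (perp n vs) \<ge> real n - real (length vs)"
proof (induction vs)
  case (Cons v vs)
  then show ?case unfolding tr_perp_Cons by (simp split: if_splits)
qed (use tr_perp_Nil[of n] in simp)

text \<open>The greedily chosen basis among the listed vectors, read from the last entry to the
  first as in the recursion of \<open>perp\<close>.\<close>

primrec pivots :: "nat \<Rightarrow> ('i \<Rightarrow> nat \<Rightarrow> real) \<Rightarrow> 'i list \<Rightarrow> 'i list" where
  "pivots n v [] = []"
| "pivots n v (x # xs) =
     (if mv n (perp n (map v xs)) (v x) = (\<lambda>a. 0) then pivots n v xs else x # pivots n v xs)"

lemma set_pivots: "set (pivots n v xs) \<subseteq> set xs"
  by (induction xs) auto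

lemma perp_pivots: "perp n (map v (pivots n v xs)) = perp n (map v xs)"
proof (induction xs)
  case (Cons x xs)
  then show ?case
    by (cases "mv n (perp n (map v xs)) (v x) = (\<lambda>a. 0)") simp_all
qed simp

lemma length_pivots: "tr n (perp n (map v xs)) = real n - real (length (pivots n v xs))"
proof (induction xs)
  case (Cons x xs)
  then show ?case by (simp only: list.map tr_perp_Cons pivots.simps split: if_split) auto
qed (use tr_perp_Nil[of n] in simp)

section \<open>Sampling from Parseval frames\<close>

text \<open>A zero complement means that every \<open>x\<close> is a combination of
  \<open>vs\<close>, and the projection for the larger family kills all of \<open>vs\<close>; hence
  it kills everything.\<close>

lemma perp_eq_0_mono:
  assumes 0: "perp n vs = (\<lambda>a b. 0)" and sub: "set vs \<subseteq> set us"
  shows "perp n us = (\<lambda>a b. 0)"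
proof -
  define P where "P = perp n us"
  have P: "is_proj n P" by (simp add: P_def is_proj_perp)
  have "mv n P (\<lambda>a. x a - mv n (perp n vs) x a) = (\<lambda>a. 0)" for x
  proof (rule mv_perp_range[of "\<lambda>f. mv n P f = (\<lambda>a. 0)"])
    fix f g assume "mv n P f = (\<lambda>a. 0)" "mv n P g = (\<lambda>a. 0)"
    then show "mv n P (\<lambda>a. f a + g a) = (\<lambda>a. 0)"
      by (simp add: mv_def fun_eq_iff distrib_left sum.distrib)
  next
    fix f g assume "mv n P f = (\<lambda>a. 0)" and *: "\<And>a. a < n \<Longrightarrow> f a = g a"
    moreover have "mv n P f = mv n P g" unfolding mv_def fun_eq_iff using * by simp
    ultimately show "mv n P g = (\<lambda>a. 0)" by simp
  next
    fix v assume "v \<in> set vs"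
    then show "mv n P v = (\<lambda>a. 0)" using sub mv_perp_kills[of v us n] by (auto simp: P_def)
  qed (simp_all add: mv_scale)
  then have "mv n P x = (\<lambda>a. 0)" for x unfolding 0 by (simp add: mv_def[of n "\<lambda>a b. 0"])
  \<comment> \<open>Applied to its own columns, \<open>P\<close> reproduces them by idempotence, so
    its diagonal vanishes.\<close>
  then have "mv n P (\<lambda>c. P c a) a = 0" for a by simp
  then have "tr n P = 0" unfolding mv_def is_proj_idem[OF P] by (simp add: tr_def)
  then show ?thesis using tr_eq_0[OF P] by (simp add: P_def)
qed

lemma mv_norm_le:
  assumes P: "is_proj n P" shows "ip n (mv n P x) (mv n P x) \<le> ip n x x"
proof -
  have "0 \<le> ip n (\<lambda>a. x a - mv n P x a) (\<lambda>a. x a - mv n P x a)" by (rule ip_nonneg)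
  also have "\<dots> = ip n x x - 2 * ip n x (mv n P x) + ip n (mv n P x) (mv n P x)"
    by (simp add: ip_def sum_subtractf sum.distrib sum_distrib_left algebra_simps)
  finally show ?thesis using ip_self_mv[OF P, of x] by simp
qed

text \<open>The outer products of the vectors sum to the identity, which is what the rows of a
  matrix with orthonormal columns satisfy.\<close>

definition parseval_frame :: "nat \<Rightarrow> 'i set \<Rightarrow> ('i \<Rightarrow> nat \<Rightarrow> real) \<Rightarrow> bool" where
  "parseval_frame n A v \<longleftrightarrow>
     (\<forall>a<n. \<forall>b<n. (\<Sum>j\<in>A. v j a * v j b) = (if a = b then 1 else 0))"

lemma parseval_frame_tr:
  assumes v: "parseval_frame n A v" and P: "is_proj n P"
  shows "(\<Sum>j\<in>A. ip n (mv n P (v j)) (mv n P (v j))) = tr n P"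
proof -
  have "(\<Sum>j\<in>A. ip n (mv n P (v j)) (mv n P (v j))) =
      (\<Sum>j\<in>A. \<Sum>a<n. \<Sum>b<n. P a b * (v j a * v j b))"
    unfolding ip_self_mv[OF P] unfolding ip_def mv_def
    by (simp add: sum_distrib_left algebra_simps)
  also have "\<dots> = (\<Sum>a<n. \<Sum>b<n. P a b * (\<Sum>j\<in>A. v j a * v j b))"
    by (subst sum.swap, rule sum.cong, simp, subst sum.swap) (simp add: sum_distrib_left)
  also have "\<dots> = (\<Sum>a<n. \<Sum>b<n. if b = a then P a a else 0)"
    using v by (intro sum.cong) (auto simp: parseval_frame_def)
  also have "\<dots> = tr n P" by (simp add: tr_def)
  finally show ?thesis .
qed

text \<open>The trace is the sum of the squared lengths of the projected frame vectors. Killed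
  vectors contribute nothing and the others at most \<open>B\<close> each, since projections do not
  increase length.\<close>

lemma parseval_frame_card:
  fixes B :: real
  assumes v: "parseval_frame n A v" and P: "is_proj n P" and A: "finite A"
    and B: "\<And>j. j \<in> A \<Longrightarrow> ip n (v j) (v j) \<le> B"
  shows "tr n P \<le> B * card {j\<in>A. mv n P (v j) \<noteq> (\<lambda>a. 0)}"
proof -
  have "tr n P = (\<Sum>j\<in>A. ip n (mv n P (v j)) (mv n P (v j)))"
    by (rule parseval_frame_tr[OF v P, symmetric])
  also have "\<dots> = (\<Sum>j\<in>{j\<in>A. mv n P (v j) \<noteq> (\<lambda>a. 0)}. ip n (mv n P (v j)) (mv n P (v j)))"
    using A mv_eq_0_iff[OF P] by (intro sum.mono_neutral_right) fastforce+
  also have "\<dots> \<le> (\<Sum>j\<in>{j\<in>A. mv n P (v j) \<noteq> (\<lambda>a. 0)}. B)"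
    by (intro sum_mono order_trans[OF mv_norm_le[OF P] B]) auto
  finally show ?thesis by (simp add: mult.commute)
qed

text \<open>The one-step contraction is iterated. Since \<open>replicate_pmf\<close> draws the head
  first, the two binds are commuted to make the head the newest draw, in accordance with the
  recursion of \<open>perp\<close>.\<close>

lemma nn_integral_replicate_pmf_le:
  fixes f :: "'a list \<Rightarrow> ennreal"
  assumes step: "\<And>xs. (\<integral>\<^sup>+x. f (x # xs) \<partial>measure_pmf p) \<le> \<rho> * f xs"
  shows "(\<integral>\<^sup>+xs. f xs \<partial>measure_pmf (replicate_pmf n p)) \<le> \<rho> ^ n * f []"
proof (induction n)
  case (Suc n)
  have "replicate_pmf (Suc n) p =
      bind_pmf (replicate_pmf n p) (\<lambda>xs. bind_pmf p (\<lambda>x. return_pmf (x # xs)))"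
    by (simp, subst bind_commute_pmf) simp
  then have "(\<integral>\<^sup>+xs. f xs \<partial>measure_pmf (replicate_pmf (Suc n) p)) =
      (\<integral>\<^sup>+xs. (\<integral>\<^sup>+x. f (x # xs) \<partial>measure_pmf p) \<partial>measure_pmf (replicate_pmf n p))"
    by (simp del: replicate_pmf.simps)
  also have "\<dots> \<le> (\<integral>\<^sup>+xs. \<rho> * f xs \<partial>measure_pmf (replicate_pmf n p))"
    by (intro nn_integral_mono step)
  also have "\<dots> = \<rho> * (\<integral>\<^sup>+xs. f xs \<partial>measure_pmf (replicate_pmf n p))"
    by (simp add: nn_integral_cmult)
  also have "\<dots> \<le> \<rho> * (\<rho> ^ n * f [])" by (intro mult_left_mono Suc.IH) simp
  finally show ?case by (simp add: mult.assoc)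
qed simp

text \<open>Markov's inequality for a quantity controlled on average at each draw. It serves twice:
  with a contracting \<rho> for the trace, and with \<rho> at least 1 for exponential
  moments.\<close>

lemma prob_replicate_pmf_le:
  fixes f :: "'a list \<Rightarrow> real" and \<rho> t :: real
  assumes A: "finite A" "A \<noteq> {}" and f: "\<And>xs. 0 \<le> f xs" and \<rho>: "0 \<le> \<rho>" and t: "0 < t"
    and step: "\<And>xs. (\<Sum>x\<in>A. f (x # xs)) \<le> card A * \<rho> * f xs"
  shows "measure_pmf.prob (replicate_pmf n (pmf_of_set A)) {xs. t \<le> f xs} \<le> \<rho> ^ n * f [] / t"
proof -
  let ?M = "measure_pmf (replicate_pmf n (pmf_of_set A))"
  have cA: "0 < real (card A)" using A by (simp add: card_gt_0_iff)
  have "(\<integral>\<^sup>+x. ennreal (f (x # xs)) \<partial>measure_pmf (pmf_of_set A)) \<le> ennreal \<rho> * ennreal (f xs)" for xs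
  proof -
    have "(\<integral>\<^sup>+x. ennreal (f (x # xs)) \<partial>measure_pmf (pmf_of_set A)) =
        ennreal ((\<Sum>x\<in>A. f (x # xs)) / card A)"
      using A cA by (simp add: nn_integral_pmf_of_set sum_ennreal f divide_ennreal sum_nonneg
          ennreal_of_nat_eq_real_of_nat)
    also have "\<dots> \<le> ennreal (\<rho> * f xs)"
      using step[of xs] cA by (intro ennreal_leI) (simp add: field_simps)
    finally show ?thesis by (simp add: ennreal_mult \<rho> f)
  qed
  from nn_integral_replicate_pmf_le[OF this, of n]
  have le: "(\<integral>\<^sup>+xs. f xs \<partial>?M) \<le> ennreal (\<rho> ^ n * f [])"
    by (simp add: ennreal_mult \<rho> f ennreal_power)
  have "ennreal t * emeasure ?M {xs. t \<le> f xs} = (\<integral>\<^sup>+xs. ennreal t * indicator {xs. t \<le> f xs} xs \<partial>?M)"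
    by (simp add: nn_integral_cmult)
  also have "\<dots> \<le> (\<integral>\<^sup>+xs. f xs \<partial>?M)"
    by (intro nn_integral_mono) (auto simp: indicator_def intro: ennreal_leI)
  finally have "ennreal (t * measure ?M {xs. t \<le> f xs}) \<le> ennreal (\<rho> ^ n * f [])"
    using le t by (simp add: measure_pmf.emeasure_eq_measure ennreal_mult)
  then have "t * measure ?M {xs. t \<le> f xs} \<le> \<rho> ^ n * f []"
    using f \<rho> by (subst (asm) ennreal_le_iff) auto
  then show ?thesis using t by (simp add: field_simps)
qed

section \<open>Sampling without replacement\<close>

definition distinct_lists :: "'a set \<Rightarrow> nat \<Rightarrow> 'a list set" where
  "distinct_lists A n = {xs. length xs = n \<and> distinct xs \<and> set xs \<subseteq> A}"

lemma finite_distinct_lists: "finite A \<Longrightarrow> finite (distinct_lists A n)"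
  by (rule finite_subset[OF _ finite_lists_length_eq[of A n]]) (auto simp: distinct_lists_def)

lemma sum_distinct_lists_Suc:
  fixes f :: "'a list \<Rightarrow> real"
  assumes "finite A"
  shows "sum f (distinct_lists A (Suc n)) = (\<Sum>xs\<in>distinct_lists A n. \<Sum>x\<in>A - set xs. f (x # xs))"
proof -
  have eq: "distinct_lists A (Suc n) =
      (\<lambda>(xs, x). x # xs) ` (SIGMA xs:distinct_lists A n. A - set xs)"
    by (auto simp: distinct_lists_def image_iff length_Suc_conv)
  have "inj_on (\<lambda>(xs, x). x # xs) (SIGMA xs:distinct_lists A n. A - set xs)"
    by (auto simp: inj_on_def)
  then have "sum f (distinct_lists A (Suc n)) =
      (\<Sum>(xs, x)\<in>(SIGMA xs:distinct_lists A n. A - set xs). f (x # xs))"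
    unfolding eq by (subst sum.reindex) (simp_all add: case_prod_unfold)
  then show ?thesis
    using assms by (simp add: sum.Sigma finite_distinct_lists)
qed

text \<open>Unnormalised sums are bounded by counting: a list of length k has
  \<open>card A - k\<close> extensions, which is both the growth factor of the number of lists and
  the factor in \<open>step\<close>.\<close>

lemma prob_distinct_lists_le:
  fixes f :: "'a list \<Rightarrow> real" and \<rho> t :: real
  assumes A: "finite A" and n: "n \<le> card A" and f: "\<And>xs. 0 \<le> f xs" and \<rho>: "0 \<le> \<rho>" and t: "0 < t"
    and step: "\<And>xs. distinct xs \<Longrightarrow> set xs \<subseteq> A \<Longrightarrow> length xs < card A \<Longrightarrow>
      (\<Sum>x\<in>A - set xs. f (x # xs)) \<le> real (card A - length xs) * \<rho> * f xs"
  shows "measure_pmf.prob (pmf_of_set (distinct_lists A n)) {xs. t \<le> f xs} \<le> \<rho> ^ n * f [] / t"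
proof -
  have card_Suc: "real (card (distinct_lists A (Suc k))) = card (distinct_lists A k) * real (card A - k)" for k
  proof -
    have "real (card (distinct_lists A (Suc k))) = (\<Sum>xs\<in>distinct_lists A k. real (card (A - set xs)))"
      using sum_distinct_lists_Suc[OF A, of "\<lambda>_. 1" k] by simp
    also have "\<dots> = (\<Sum>xs\<in>distinct_lists A k. real (card A - k))"
      by (intro sum.cong refl arg_cong[of _ _ real])
        (auto simp: distinct_lists_def card_Diff_subset distinct_card)
    finally show ?thesis by simp
  qed
  have le: "sum f (distinct_lists A k) \<le> card (distinct_lists A k) * \<rho> ^ k * f []" if "k \<le> card A" for k
    using that
  proof (induction k)
    case 0
    have "distinct_lists A 0 = {[]}" by (auto simp: distinct_lists_def)
    then show ?case by simp
  next
    case (Suc k)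
    have "sum f (distinct_lists A (Suc k)) \<le>
        (\<Sum>xs\<in>distinct_lists A k. real (card A - k) * \<rho> * f xs)"
      unfolding sum_distinct_lists_Suc[OF A]
      by (intro sum_mono order_trans[OF step]) (use Suc.prems in \<open>auto simp: distinct_lists_def\<close>)
    also have "\<dots> = real (card A - k) * \<rho> * sum f (distinct_lists A k)"
      by (simp add: sum_distrib_left)
    also have "\<dots> \<le> real (card A - k) * \<rho> * (card (distinct_lists A k) * \<rho> ^ k * f [])"
      using Suc \<rho> by (intro mult_left_mono) auto
    finally show ?case by (simp add: card_Suc algebra_simps)
  qed
  have fin: "finite (distinct_lists A n)" by (rule finite_distinct_lists[OF A])
  have "card (distinct_lists A k) > 0" if "k \<le> card A" for k
    using that
  proof (induction k)
    case 0
    have "distinct_lists A 0 = {[]}" by (auto simp: distinct_lists_def)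
    then show ?case by simp
  next
    case (Suc k)
    then show ?case using card_Suc[of k] by (metis Suc_leD Suc_le_eq mult_pos_pos of_nat_0_less_iff zero_less_diff)
  qed
  from this[OF n] have pos: "0 < card (distinct_lists A n)" .
  then have ne: "distinct_lists A n \<noteq> {}" by auto
  have "t * card (distinct_lists A n \<inter> {xs. t \<le> f xs}) = (\<Sum>xs\<in>distinct_lists A n \<inter> {xs. t \<le> f xs}. t)"
    by simp
  also have "\<dots> \<le> (\<Sum>xs\<in>distinct_lists A n \<inter> {xs. t \<le> f xs}. f xs)"
    by (rule sum_mono) auto
  also have "\<dots> \<le> sum f (distinct_lists A n)" by (rule sum_mono2[OF fin]) (auto simp: f)
  also have "\<dots> \<le> card (distinct_lists A n) * \<rho> ^ n * f []" by (rule le[OF n])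
  finally show ?thesis
    using pos t by (simp add: measure_pmf_of_set[OF ne fin] field_simps)
qed

lemma distinct_lists_nonempty:
  assumes "finite A" "n \<le> card A" shows "distinct_lists A n \<noteq> {}"
proof -
  obtain B where "B \<subseteq> A" "card B = n" "finite B" using assms by (meson obtain_subset_with_card_n)
  then obtain xs where "set xs = B" "distinct xs" using finite_distinct_list by blast
  then have "xs \<in> distinct_lists A n"
    using \<open>B \<subseteq> A\<close> \<open>card B = n\<close> by (auto simp: distinct_lists_def distinct_card)
  then show ?thesis by blast
qed

lemma tr_perp_ge_1:
  assumes "perp n vs \<noteq> (\<lambda>a b. 0)" shows "1 \<le> tr n (perp n vs)"
  using tr_perp_nat[of n vs] tr_eq_0[OF is_proj_perp, of n vs] assms by force

lemma sum_tr_perp_Cons: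
  assumes "finite A"
  shows "(\<Sum>x\<in>A. tr n (perp n (map v (x # xs)))) = card A * tr n (perp n (map v xs)) -
     card {x\<in>A. mv n (perp n (map v xs)) (v x) \<noteq> (\<lambda>a. 0)}"
proof -
  have "(\<Sum>x\<in>A. tr n (perp n (map v (x # xs)))) = (\<Sum>x\<in>A. tr n (perp n (map v xs)) -
      (if mv n (perp n (map v xs)) (v x) \<noteq> (\<lambda>a. 0) then 1 else 0))"
    unfolding list.map tr_perp_Cons by (intro sum.cong) auto
  also have "\<dots> = card A * tr n (perp n (map v xs)) -
      (\<Sum>x\<in>A. if mv n (perp n (map v xs)) (v x) \<noteq> (\<lambda>a. 0) then 1 else 0)"
    by (simp add: sum_subtractf)
  also have "(\<Sum>x\<in>A. if mv n (perp n (map v xs)) (v x) \<noteq> (\<lambda>a. 0) then 1 else (0::real)) =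
      card {x\<in>A. mv n (perp n (map v xs)) (v x) \<noteq> (\<lambda>a. 0)}"
    using assms by (simp add: sum.inter_filter[symmetric])
  finally show ?thesis .
qed

text \<open>The count of helpful vectors is a hypothesis with a free rate \<kappa>, so that the
  lemma also covers a frame with one vector zeroed, which need not be a Parseval frame any
  more.\<close>

lemma prob_not_spanning_replicate:
  fixes \<kappa> :: real
  assumes A: "finite A" "A \<noteq> {}" and \<kappa>: "\<kappa> \<le> card A"
    and count: "\<And>us. \<kappa> * tr n (perp n us) \<le> card {j\<in>A. mv n (perp n us) (v j) \<noteq> (\<lambda>a. 0)}"
  shows "measure_pmf.prob (replicate_pmf k (pmf_of_set A)) {xs. perp n (map v xs) \<noteq> (\<lambda>a b. 0)}
    \<le> n * (1 - \<kappa> / card A) ^ k"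
proof -
  have cA: "0 < real (card A)" using A by (simp add: card_gt_0_iff)
  have "measure_pmf.prob (replicate_pmf k (pmf_of_set A)) {xs. perp n (map v xs) \<noteq> (\<lambda>a b. 0)}
    \<le> measure_pmf.prob (replicate_pmf k (pmf_of_set A)) {xs. 1 \<le> tr n (perp n (map v xs))}"
    by (intro measure_pmf.finite_measure_mono) (auto intro: tr_perp_ge_1)
  also have "\<dots> \<le> (1 - \<kappa> / card A) ^ k * tr n (perp n (map v [])) / 1"
  proof (rule prob_replicate_pmf_le[OF A])
    show "(\<Sum>x\<in>A. tr n (perp n (map v (x # xs)))) \<le>
        card A * (1 - \<kappa> / card A) * tr n (perp n (map v xs))" for xs
      unfolding sum_tr_perp_Cons[OF A(1)] using count[of "map v xs"] cA by (simp add: field_simps)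
  qed (use \<kappa> cA in \<open>auto simp: tr_nonneg is_proj_perp\<close>)
  finally show ?thesis using tr_perp_Nil[of n] by (simp add: mult.commute)
qed

text \<open>The vectors outside the current span are all among those not yet drawn, so without
  replacement the chance of hitting one is at least that of drawing with replacement, and the same
  rate holds.\<close>

lemma prob_not_spanning_distinct:
  fixes B :: real
  assumes A: "finite A" and v: "parseval_frame n A v" and B: "\<And>j. j \<in> A \<Longrightarrow> ip n (v j) (v j) \<le> B"
    and AB: "1 \<le> card A * B" and k: "k \<le> card A"
  shows "measure_pmf.prob (pmf_of_set (distinct_lists A k)) {xs. perp n (map v xs) \<noteq> (\<lambda>a b. 0)}
    \<le> n * (1 - 1 / (card A * B)) ^ k"
proof -
  have B0: "0 < B"
    using AB mult_nonneg_nonpos[of "real (card A)" B] by (cases "0 < B") auto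
  have cA: "0 < real (card A)" using AB by (cases "card A = 0") auto
  have "measure_pmf.prob (pmf_of_set (distinct_lists A k)) {xs. perp n (map v xs) \<noteq> (\<lambda>a b. 0)}
    \<le> measure_pmf.prob (pmf_of_set (distinct_lists A k)) {xs. 1 \<le> tr n (perp n (map v xs))}"
    by (intro measure_pmf.finite_measure_mono) (auto intro: tr_perp_ge_1)
  also have "\<dots> \<le> (1 - 1 / (card A * B)) ^ k * tr n (perp n (map v [])) / 1"
  proof (rule prob_distinct_lists_le[OF A k])
    fix xs assume xs: "distinct xs" "set xs \<subseteq> A" "length xs < card A"
    define P where "P = perp n (map v xs)"
    have c: "card (A - set xs) = card A - length xs"
      using xs A by (simp add: card_Diff_subset distinct_card)
    have eq: "{x\<in>A - set xs. mv n P (v x) \<noteq> (\<lambda>a. 0)} = {x\<in>A. mv n P (v x) \<noteq> (\<lambda>a. 0)}"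
      using mv_perp_kills[of _ "map v xs" n] by (auto simp: P_def)
    have t: "0 \<le> tr n P" by (simp add: P_def tr_nonneg is_proj_perp)
    have "tr n P \<le> B * card {x\<in>A. mv n P (v x) \<noteq> (\<lambda>a. 0)}"
      unfolding P_def by (rule parseval_frame_card[OF v is_proj_perp A B])
    then have "tr n P / B \<le> card {x\<in>A. mv n P (v x) \<noteq> (\<lambda>a. 0)}"
      using B0 by (simp add: pos_divide_le_eq mult.commute)
    \<comment> \<open>Shrinking the left side by the fraction of undrawn elements brings it to the
      form with the uniform rate \<open>1 / (card A * B)\<close>.\<close>
    then have "real (card A - length xs) / card A * (tr n P / B) \<le> 1 * real (card {x\<in>A. mv n P (v x) \<noteq> (\<lambda>a. 0)})"
      using B0 cA t by (intro mult_mono) (auto simp: divide_le_eq_1)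
    moreover have "real (card A - length xs) * (1 - 1 / (card A * B)) * tr n P =
        real (card A - length xs) * tr n P - real (card A - length xs) / card A * (tr n P / B)"
      by (simp add: algebra_simps)
    ultimately show "(\<Sum>x\<in>A - set xs. tr n (perp n (map v (x # xs)))) \<le>
        real (card A - length xs) * (1 - 1 / (card A * B)) * tr n (perp n (map v xs))"
      unfolding sum_tr_perp_Cons[OF finite_Diff[OF A]] P_def[symmetric] eq c by linarith
  qed (use AB in \<open>auto simp: tr_nonneg is_proj_perp field_simps\<close>)
  finally show ?thesis using tr_perp_Nil[of n] by (simp add: mult.commute)
qed

text \<open>The vector is zeroed rather than deleted, which keeps the index set and thereby the
  distribution of the draws.\<close>

definition omit :: "'i \<Rightarrow> ('i \<Rightarrow> nat \<Rightarrow> real) \<Rightarrow> 'i \<Rightarrow> nat \<Rightarrow> real" where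
  "omit i v = v(i := (\<lambda>a. 0))"

text \<open>Omitting \<open>i\<close> removes at most one of the vectors outside the span, and at
  least one remains because \<open>v i\<close> is never a coloop, that is, never outside the span of
  the other vectors. A set that loses one element and stays nonempty keeps at least half of its
  size, whence the factor 2.\<close>

lemma parseval_frame_card_omit:
  fixes B :: real
  assumes v: "parseval_frame n A v" and A: "finite A" and B: "\<And>j. j \<in> A \<Longrightarrow> ip n (v j) (v j) \<le> B"
    and B0: "0 < B"
    and coloop: "\<And>P. is_proj n P \<Longrightarrow> (\<And>j. j \<in> A \<Longrightarrow> j \<noteq> i \<Longrightarrow> mv n P (v j) = (\<lambda>a. 0)) \<Longrightarrow> mv n P (v i) = (\<lambda>a. 0)"
  shows "1 / (2 * B) * tr n (perp n us) \<le> card {j\<in>A. mv n (perp n us) (omit i v j) \<noteq> (\<lambda>a. 0)}"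
proof (cases "perp n us = (\<lambda>a b. 0)")
  case True
  then show ?thesis by (simp add: tr_def)
next
  case False
  define P where "P = perp n us"
  have P: "is_proj n P" by (simp add: P_def is_proj_perp)
  define S where "S = {j\<in>A. mv n P (v j) \<noteq> (\<lambda>a. 0)}"
  have t1: "1 \<le> tr n P" using False by (simp add: P_def tr_perp_ge_1)
  have tS: "tr n P / B \<le> card S"
    using parseval_frame_card[OF v P A B] B0 by (simp add: S_def field_simps)
  have fin: "finite S" using A by (simp add: S_def)
  have "S \<noteq> {}" using tS t1 B0 by (auto simp: field_simps)
  have Si: "{j\<in>A. mv n P (omit i v j) \<noteq> (\<lambda>a. 0)} = S - {i}"
    by (auto simp: S_def omit_def)
  have "S - {i} \<noteq> {}"
  proof
    assume "S - {i} = {}"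
    then have "\<And>j. j \<in> A \<Longrightarrow> j \<noteq> i \<Longrightarrow> mv n P (v j) = (\<lambda>a. 0)" by (auto simp: S_def)
    from coloop[OF P this] have "S - {i} = S" by (auto simp: S_def)
    with \<open>S \<noteq> {}\<close> \<open>S - {i} = {}\<close> show False by simp
  qed
  then have "1 \<le> card (S - {i})" using fin by (simp add: Suc_le_eq card_gt_0_iff)
  moreover have "card S \<le> card (S - {i}) + 1"
    using fin \<open>S \<noteq> {}\<close> card_gt_0_iff[of S] by (auto simp: card_Diff_singleton_if)
  ultimately have "tr n P / B \<le> 2 * real (card (S - {i}))" using tS by linarith
  then show ?thesis unfolding P_def[symmetric] Si using B0 by (simp add: field_simps)
qed

text \<open>If the first \<open>h\<close> draws span, they contain a spanning subfamily of size \<open>n\<close>.  Only the omission of one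
  of its members can destroy spanning, and for each of these the last \<open>k\<close> draws span by themselves.\<close>

lemma prob_leave_one_out:
  fixes B :: real
  assumes v: "parseval_frame n A v" and A: "finite A" "A \<noteq> {}" and B: "\<And>j. j \<in> A \<Longrightarrow> ip n (v j) (v j) \<le> B"
    and AB: "1 \<le> card A * B"
    and coloop: "\<And>i P. is_proj n P \<Longrightarrow> (\<And>j. j \<in> A \<Longrightarrow> j \<noteq> i \<Longrightarrow> mv n P (v j) = (\<lambda>a. 0)) \<Longrightarrow> mv n P (v i) = (\<lambda>a. 0)"
  defines "\<rho> \<equiv> 1 - 1 / (2 * B) / card A"
  shows "measure_pmf.prob (replicate_pmf (h + k) (pmf_of_set A))
      {xs. \<exists>i. perp n (map (omit i v) xs) \<noteq> (\<lambda>a b. 0)} \<le> n * \<rho> ^ h + n * (n * \<rho> ^ k)"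
proof -
  let ?p = "\<lambda>k. replicate_pmf k (pmf_of_set A)"
  let ?Z = "\<lambda>a b. 0 :: real"
  let ?bad = "{xs. \<exists>i. perp n (map (omit i v) xs) \<noteq> ?Z}"
  have B0: "0 < B"
    using AB mult_nonneg_nonpos[of "real (card A)" B] by (cases "0 < B") auto
  have cA: "0 < real (card A)" using AB by (cases "card A = 0") auto
  have \<kappa>: "1 / (2 * B) \<le> card A" using AB B0 by (simp add: field_simps)
  have \<rho>_eq: "\<rho> = 1 - 1 / (card A * B) / 2" by (simp add: \<rho>_def)
  have "1 / (card A * B) \<le> 1" using AB by (subst divide_le_eq_1) auto
  moreover have "0 \<le> 1 - y / 2" if "y \<le> 1" for y :: real using that by simp
  ultimately have \<rho>0: "0 \<le> \<rho>" unfolding \<rho>_eq by blast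
  have half_le: "y / 2 \<le> y" if "0 \<le> y" for y :: real using that by simp
  \<comment> \<open>The full family would allow the rate 1/B; the weaker 1/(2B) is taken so that
    both blocks of draws share one \<rho>.\<close>
  have first: "measure_pmf.prob (?p h) {xs. perp n (map v xs) \<noteq> ?Z} \<le> n * \<rho> ^ h"
    unfolding \<rho>_def
  proof (rule prob_not_spanning_replicate[OF A \<kappa>])
    fix us
    have "tr n (perp n us) \<le> B * card {j\<in>A. mv n (perp n us) (v j) \<noteq> (\<lambda>a. 0)}"
      by (rule parseval_frame_card[OF v is_proj_perp A(1) B])
    then have le: "tr n (perp n us) / B \<le> card {j\<in>A. mv n (perp n us) (v j) \<noteq> (\<lambda>a. 0)}"
      using B0 by (simp add: pos_divide_le_eq mult.commute)
    have "0 \<le> tr n (perp n us) / B" using B0 by (simp add: tr_nonneg is_proj_perp)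
    then have "tr n (perp n us) / B / 2 \<le> tr n (perp n us) / B" by (rule half_le)
    also note le
    also have "tr n (perp n us) / B / 2 = 1 / (2 * B) * tr n (perp n us)" by simp
    finally show "1 / (2 * B) * tr n (perp n us) \<le> card {j\<in>A. mv n (perp n us) (v j) \<noteq> (\<lambda>a. 0)}" .
  qed
  have second: "measure_pmf.prob (?p k) {ys. perp n (map (omit i v) ys) \<noteq> ?Z} \<le> n * \<rho> ^ k" for i
    unfolding \<rho>_def
    by (rule prob_not_spanning_replicate[OF A \<kappa> parseval_frame_card_omit[OF v A(1) B B0 coloop]])
  have inner: "measure_pmf.prob (?p k) {ys. xs @ ys \<in> ?bad} \<le> n * (n * \<rho> ^ k)"
    if xs: "perp n (map v xs) = ?Z" for xs
  proof -
    \<comment> \<open>The trace is zero, so there are exactly \<open>n\<close> pivots, and omitting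
      an index that is not a pivot leaves this spanning subfamily intact.\<close>
    define bs where "bs = pivots n v xs"
    have bs: "set bs \<subseteq> set xs" "perp n (map v bs) = ?Z"
      using xs by (simp_all add: bs_def set_pivots perp_pivots)
    have len: "length bs = n"
      using length_pivots[of n v xs] xs by (simp add: bs_def tr_def)
    have "{ys. xs @ ys \<in> ?bad} \<subseteq> (\<Union>i\<in>set bs. {ys. perp n (map (omit i v) ys) \<noteq> ?Z})"
    proof
      fix ys assume "ys \<in> {ys. xs @ ys \<in> ?bad}"
      then obtain i where i: "perp n (map (omit i v) (xs @ ys)) \<noteq> ?Z" by auto
      have "i \<in> set bs"
      proof (rule ccontr)
        assume "i \<notin> set bs"
        then have "map (omit i v) bs = map v bs" by (auto simp: omit_def)
        then have 0: "perp n (map (omit i v) bs) = ?Z" using bs(2) by (simp only:)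
        have "set (map (omit i v) bs) \<subseteq> set (map (omit i v) (xs @ ys))" using bs(1) by auto
        from perp_eq_0_mono[OF 0 this] have "perp n (map (omit i v) (xs @ ys)) = ?Z" .
        with i show False by simp
      qed
      moreover have "perp n (map (omit i v) ys) \<noteq> ?Z"
        using i perp_eq_0_mono[of n "map (omit i v) ys" "map (omit i v) (xs @ ys)"] by auto
      ultimately show "ys \<in> (\<Union>i\<in>set bs. {ys. perp n (map (omit i v) ys) \<noteq> ?Z})" by auto
    qed
    then have "measure_pmf.prob (?p k) {ys. xs @ ys \<in> ?bad} \<le>
        measure_pmf.prob (?p k) (\<Union>i\<in>set bs. {ys. perp n (map (omit i v) ys) \<noteq> ?Z})"
      by (intro measure_pmf.finite_measure_mono) auto
    also have "\<dots> \<le> (\<Sum>i\<in>set bs. measure_pmf.prob (?p k) {ys. perp n (map (omit i v) ys) \<noteq> ?Z})"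
      by (rule measure_pmf.finite_measure_subadditive_finite) auto
    also have "\<dots> \<le> (\<Sum>i\<in>set bs. n * \<rho> ^ k)" by (intro sum_mono second)
    also have "\<dots> = card (set bs) * (n * \<rho> ^ k)" by simp
    also have "\<dots> \<le> n * (n * \<rho> ^ k)"
      using card_length[of bs] \<rho>0 unfolding len by (intro mult_right_mono) auto
    finally show ?thesis .
  qed
  \<comment> \<open>The two blocks are independent: the second is integrated for a fixed first
    block, and a first block that does not span is charged 1.\<close>
  have "emeasure (measure_pmf (?p (h + k))) ?bad =
      (\<integral>\<^sup>+xs. emeasure (measure_pmf (?p k)) {ys. xs @ ys \<in> ?bad} \<partial>measure_pmf (?p h))"
    unfolding replicate_pmf_distrib
    by (simp add: emeasure_bind_pmf map_pmf_def[symmetric] emeasure_map_pmf vimage_def)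
  also have "\<dots> \<le> (\<integral>\<^sup>+xs. indicator {xs. perp n (map v xs) \<noteq> ?Z} xs + ennreal (real n * (real n * \<rho> ^ k)) \<partial>measure_pmf (?p h))"
  proof (rule nn_integral_mono)
    fix xs
    show "emeasure (measure_pmf (?p k)) {ys. xs @ ys \<in> ?bad} \<le>
        indicator {xs. perp n (map v xs) \<noteq> ?Z} xs + ennreal (real n * (real n * \<rho> ^ k))"
    proof (cases "perp n (map v xs) = ?Z")
      case True
      then show ?thesis using inner[OF True]
        by (simp only: measure_pmf.emeasure_eq_measure) (simp add: ennreal_leI)
    next
      case False
      have "emeasure (measure_pmf (?p k)) {ys. xs @ ys \<in> ?bad} \<le> 1" by (rule measure_pmf.emeasure_le_1)
      also have "\<dots> \<le> 1 + ennreal (real n * (real n * \<rho> ^ k))" by simp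
      finally show ?thesis using False by simp
    qed
  qed
  also have "\<dots> = emeasure (measure_pmf (?p h)) {xs. perp n (map v xs) \<noteq> ?Z} + ennreal (real n * (real n * \<rho> ^ k))"
    by (subst nn_integral_add) (simp_all add: measure_pmf.emeasure_space_1)
  also have "\<dots> \<le> ennreal (real n * \<rho> ^ h) + ennreal (real n * (real n * \<rho> ^ k))"
    using first by (intro add_right_mono) (simp add: measure_pmf.emeasure_eq_measure ennreal_leI)
  also have "\<dots> = ennreal (real n * \<rho> ^ h + real n * (real n * \<rho> ^ k))"
    using \<rho>0 by (intro ennreal_plus[symmetric]) auto
  finally have "ennreal (measure (measure_pmf (?p (h + k))) ?bad) \<le>
      ennreal (real n * \<rho> ^ h + real n * (real n * \<rho> ^ k))"
    by (simp only: measure_pmf.emeasure_eq_measure)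
  then show ?thesis using \<rho>0 by (subst (asm) ennreal_le_iff) auto
qed

section \<open>Linear spans of families of vectors\<close>

text \<open>The locale facts are restated with the dimension free, because later proofs mix spans of
  vectors before and after compression.\<close>

lemma vspan_mem: "S \<subseteq> carrier_vec n \<Longrightarrow> x \<in> S \<Longrightarrow> x \<in> vspan n S"
proof -
  interpret vec_space "TYPE(real)" n .
  show "S \<subseteq> carrier_vec n \<Longrightarrow> x \<in> S \<Longrightarrow> x \<in> vspan n S" using in_own_span by blast
qed

lemma vspan_carrier: "S \<subseteq> carrier_vec n \<Longrightarrow> x \<in> vspan n S \<Longrightarrow> x \<in> carrier_vec n"
proof -
  interpret vec_space "TYPE(real)" n .
  show "S \<subseteq> carrier_vec n \<Longrightarrow> x \<in> vspan n S \<Longrightarrow> x \<in> carrier_vec n" using span_closed by blast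
qed

lemma vspan_mono: "S \<subseteq> T \<Longrightarrow> vspan n S \<subseteq> vspan n T"
proof -
  interpret vec_space "TYPE(real)" n .
  show "S \<subseteq> T \<Longrightarrow> vspan n S \<subseteq> vspan n T" by (rule span_is_monotone)
qed

lemma vspan_subsetI: "T \<subseteq> carrier_vec n \<Longrightarrow> S \<subseteq> vspan n T \<Longrightarrow> vspan n S \<subseteq> vspan n T"
proof -
  interpret vec_space "TYPE(real)" n .
  show "T \<subseteq> carrier_vec n \<Longrightarrow> S \<subseteq> vspan n T \<Longrightarrow> vspan n S \<subseteq> vspan n T" by (rule span_subsetI)
qed

lemma vspan_0: "0\<^sub>v n \<in> vspan n S"
proof -
  interpret vec_space "TYPE(real)" n .
  show ?thesis using Missing_VectorSpace.vectorspace.span_zero[OF vectorspace_axioms, of S] by simp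
qed

lemma vspan_add:
  "S \<subseteq> carrier_vec n \<Longrightarrow> x \<in> vspan n S \<Longrightarrow> y \<in> vspan n S \<Longrightarrow> x + y \<in> vspan n S"
proof -
  interpret vec_space "TYPE(real)" n .
  show "S \<subseteq> carrier_vec n \<Longrightarrow> x \<in> vspan n S \<Longrightarrow> y \<in> vspan n S \<Longrightarrow> x + y \<in> vspan n S"
    by (rule span_add1)
qed

lemma vspan_smult: "S \<subseteq> carrier_vec n \<Longrightarrow> x \<in> vspan n S \<Longrightarrow> c \<cdot>\<^sub>v x \<in> vspan n S"
proof -
  interpret vec_space "TYPE(real)" n .
  show "S \<subseteq> carrier_vec n \<Longrightarrow> x \<in> vspan n S \<Longrightarrow> c \<cdot>\<^sub>v x \<in> vspan n S" by (rule smult_in_span)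
qed

lemma vspan_induct [consumes 2, case_names zero add smult mem]:
  assumes S: "S \<subseteq> carrier_vec n" and x: "x \<in> vspan n S"
    and zero: "W (0\<^sub>v n)"
    and add: "\<And>x y. x \<in> carrier_vec n \<Longrightarrow> y \<in> carrier_vec n \<Longrightarrow> W x \<Longrightarrow> W y \<Longrightarrow> W (x + y)"
    and smult: "\<And>c x. x \<in> carrier_vec n \<Longrightarrow> W x \<Longrightarrow> W (c \<cdot>\<^sub>v x)"
    and mem: "\<And>x. x \<in> S \<Longrightarrow> W x"
  shows "W x"
proof -
  interpret vec_space "TYPE(real)" n .
  from in_spanE[OF x] obtain a A where a: "x = lincomb a A" "finite A" "A \<subseteq> S" by blast
  from a(2,3) have "W (lincomb a A)"
  proof (induction A)
    case empty
    then show ?case by (simp add: lincomb_def zero)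
  next
    case (insert v A)
    have A: "A \<subseteq> carrier_vec n" and v: "v \<in> carrier_vec n" using insert S by auto
    have "lincomb a (insert v A) = a v \<cdot>\<^sub>v v + lincomb a A"
      using lincomb_insert2[of A a v] A v insert.hyps by simp
    moreover have "lincomb a A \<in> carrier_vec n" by (rule lincomb_closed) (use A in auto)
    moreover have "W (a v \<cdot>\<^sub>v v)" by (rule smult[OF v mem]) (use insert.prems in simp)
    moreover have "W (lincomb a A)" using insert by simp
    ultimately show ?case using add v by simp
  qed
  then show ?thesis using a by simp
qed

lemma vspan_mult_mat_vec:
  assumes M: "M \<in> carrier_mat m n" and S: "S \<subseteq> carrier_vec n"
  shows "vspan m ((\<lambda>x. M *\<^sub>v x) ` S) = (\<lambda>x. M *\<^sub>v x) ` vspan n S"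
proof -
  have MS: "(\<lambda>x. M *\<^sub>v x) ` S \<subseteq> carrier_vec m" using M S by auto
  have "y \<in> (\<lambda>x. M *\<^sub>v x) ` vspan n S" if "y \<in> vspan m ((\<lambda>x. M *\<^sub>v x) ` S)" for y
    using MS that
  proof (induction rule: vspan_induct)
    case zero
    show ?case by (rule image_eqI[OF _ vspan_0]) (use M in auto)
  next
    case (add x y)
    then obtain x' y' where "x' \<in> vspan n S" "x = M *\<^sub>v x'" "y' \<in> vspan n S" "y = M *\<^sub>v y'" by blast
    then show ?case using vspan_carrier[OF S] M
      by (intro image_eqI[of _ _ "x' + y'"] vspan_add[OF S]) (auto simp: mult_add_distrib_mat_vec)
  next
    case (smult c x)
    then obtain x' where "x' \<in> vspan n S" "x = M *\<^sub>v x'" by blast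
    then show ?case using vspan_carrier[OF S] M
      by (intro image_eqI[of _ _ "c \<cdot>\<^sub>v x'"] vspan_smult[OF S]) (auto simp: mult_mat_vec)
  next
    case (mem x)
    then show ?case using vspan_mem[OF S] by auto
  qed
  moreover have "M *\<^sub>v x \<in> vspan m ((\<lambda>x. M *\<^sub>v x) ` S)" if "x \<in> vspan n S" for x
    using S that
  proof (induction rule: vspan_induct)
    case zero
    have "M *\<^sub>v 0\<^sub>v n = 0\<^sub>v m" using M by auto
    then show ?case by (simp add: vspan_0)
  next
    case (add x y)
    then show ?case using M by (simp add: mult_add_distrib_mat_vec vspan_add[OF MS])
  next
    case (smult c x)
    then show ?case using M by (simp add: mult_mat_vec vspan_smult[OF MS])
  next
    case (mem x)
    then show ?case using vspan_mem[OF MS] by auto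
  qed
  ultimately show ?thesis by blast
qed

lemma colspace_eq_range:
  assumes A: "A \<in> carrier_mat m n" shows "colspace A = {A *\<^sub>v z | z. z \<in> carrier_vec n}"
proof -
  interpret vec_space "TYPE(real)" m .
  show ?thesis
    using col_space_eq[OF A] A unfolding col_space_def colspace_def by auto
qed

lemma vspan_empty: "vspan n {} = {0\<^sub>v n}"
proof -
  interpret vec_space "TYPE(real)" n .
  show ?thesis by (rule span_empty)
qed

text \<open>The bridge from spans to Borel functions of the entries. The kernel of the projection is
  a subspace containing the generators; conversely a killed \<open>x\<close> equals its difference
  from its projection, a combination of the generators.\<close>

lemma mem_vspan_iff_perp:
  assumes S: "set vs \<subseteq> carrier_vec n" and x: "x \<in> carrier_vec n"
  shows "x \<in> vspan n (set vs) \<longleftrightarrow> mv n (perp n (map vec_index vs)) (vec_index x) = (\<lambda>a. 0)"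
proof
  let ?P = "perp n (map vec_index vs)"
  assume "x \<in> vspan n (set vs)"
  with S show "mv n ?P (vec_index x) = (\<lambda>a. 0)"
  proof (induction rule: vspan_induct)
    case zero
    have "mv n ?P (vec_index (0\<^sub>v n)) = mv n ?P (\<lambda>a. 0)" by (rule mv_cong) simp
    then show ?case by simp
  next
    case (add x y)
    have "mv n ?P (vec_index (x + y)) = mv n ?P (\<lambda>a. x $ a + y $ a)"
      by (rule mv_cong) (use add(1,2) in simp)
    also have "\<dots> = (\<lambda>a. mv n ?P (vec_index x) a + mv n ?P (vec_index y) a)"
      by (simp add: mv_def fun_eq_iff distrib_left sum.distrib)
    finally show ?case unfolding add(3,4) by simp
  next
    case (smult c x)
    have "mv n ?P (vec_index (c \<cdot>\<^sub>v x)) = mv n ?P (\<lambda>a. c * x $ a)"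
      by (rule mv_cong) (use smult(1) in simp)
    also have "\<dots> = (\<lambda>a. c * mv n ?P (vec_index x) a)" by (rule mv_scale)
    finally show ?case unfolding smult(2) by simp
  next
    case (mem x)
    then show ?case by (intro mv_perp_kills) simp
  qed
next
  let ?P = "perp n (map vec_index vs)"
  assume 0: "mv n ?P (vec_index x) = (\<lambda>a. 0)"
  have "vec n (\<lambda>a. x $ a - mv n ?P (vec_index x) a) \<in> vspan n (set vs)"
  proof (rule mv_perp_range[of "\<lambda>f. vec n f \<in> vspan n (set vs)"])
    fix f g assume "vec n f \<in> vspan n (set vs)" "vec n g \<in> vspan n (set vs)"
    moreover have "vec n (\<lambda>a. f a + g a) = vec n f + vec n g" by auto
    ultimately show "vec n (\<lambda>a. f a + g a) \<in> vspan n (set vs)" by (simp only: vspan_add[OF S])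
  next
    fix k f assume "vec n f \<in> vspan n (set vs)"
    moreover have "vec n (\<lambda>a. k * f a) = k \<cdot>\<^sub>v vec n f" by auto
    ultimately show "vec n (\<lambda>a. k * f a) \<in> vspan n (set vs)" by (simp only: vspan_smult[OF S])
  next
    show "vec n (\<lambda>a. 0) \<in> vspan n (set vs)" using vspan_0[of n] by (simp add: zero_vec_def)
  next
    fix f g :: "nat \<Rightarrow> real" assume "vec n f \<in> vspan n (set vs)" "\<And>a. a < n \<Longrightarrow> f a = g a"
    moreover from this have "vec n g = vec n f" by auto
    ultimately show "vec n g \<in> vspan n (set vs)" by (simp only:)
  next
    fix v assume "v \<in> set (map vec_index vs)"
    then obtain u where u: "u \<in> set vs" "v = vec_index u" by auto
    then have "u \<in> carrier_vec n" using S by auto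
    then have "vec n v = u" unfolding u(2) by (intro eq_vecI) auto
    then show "vec n v \<in> vspan n (set vs)" using vspan_mem[OF S] u by simp
  qed
  moreover have "vec n (\<lambda>a. x $ a - mv n ?P (vec_index x) a) = x" unfolding 0 using x by (intro eq_vecI) auto
  ultimately show "x \<in> vspan n (set vs)" by simp
qed

text \<open>Indexing the family makes a repeated vector count as dependent, which merges
  distinctness and linear independence into finitely many conditions on spans.\<close>

definition indep_family :: "nat \<Rightarrow> ('i \<Rightarrow> real vec) \<Rightarrow> 'i set \<Rightarrow> bool" where
  "indep_family n f J \<longleftrightarrow> (\<forall>j\<in>J. f j \<notin> vspan n (f ` (J - {j})))"

lemma indep_family_iff:
  assumes fin: "finite J" and f: "f ` J \<subseteq> carrier_vec n"
  shows "indep_family n f J \<longleftrightarrow> inj_on f J \<and> vindpt n (f ` J)"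
proof -
  have finJ: "finite (f ` J)" using fin by (rule finite_imageI)
  interpret vec_space "TYPE(real)" n .
  have dep: "lin_dep (f ` J) \<longleftrightarrow> (\<exists>u\<in>f ` J. u \<in> span (f ` J - {u}))"
    by (rule lindep_span[OF f finJ])
  have img: "f ` J - {f j} = f ` (J - {j})" if "inj_on f J" "j \<in> J" for j
    using that by (auto simp: inj_on_def)
  show ?thesis
  proof
    assume I: "indep_family n f J"
    have inj: "inj_on f J"
    proof (rule inj_onI)
      fix i j assume "i \<in> J" "j \<in> J" "f i = f j"
      show "i = j"
      proof (rule ccontr)
        assume "i \<noteq> j"
        then have "f i \<in> f ` (J - {i})" using \<open>j \<in> J\<close> \<open>f i = f j\<close> by auto
        moreover have "f ` (J - {i}) \<subseteq> carrier_vec n" using f by auto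
        ultimately have "f i \<in> vspan n (f ` (J - {i}))" using vspan_mem by blast
        then show False using I \<open>i \<in> J\<close> by (auto simp: indep_family_def)
      qed
    qed
    then show "inj_on f J \<and> \<not> lin_dep (f ` J)"
      using I img unfolding dep indep_family_def by auto
  next
    assume "inj_on f J \<and> \<not> lin_dep (f ` J)"
    then show "indep_family n f J" using img unfolding dep indep_family_def by auto
  qed
qed

section \<open>Selected columns of a matrix\<close>

lemma col_carrier: "A \<in> carrier_mat m n \<Longrightarrow> col A j \<in> carrier_vec m"
  using col_dim by blast

lemma col_range_carrier: "A \<in> carrier_mat m n \<Longrightarrow> col A ` X \<subseteq> carrier_vec m"
  using col_carrier by blast

lemma select_cols_carrier:
  assumes "A \<in> carrier_mat m n" "J \<subseteq> {..<n}" shows "select_cols A J \<in> carrier_mat m (card J)"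
proof -
  have "{j. j < n \<and> j \<in> J} = J" using assms by auto
  moreover have "dim_row A = m" "dim_col A = n" using assms by auto
  ultimately show ?thesis unfolding select_cols_def by (intro carrier_matI) (simp_all add: dim_submatrix)
qed

lemma bij_betw_pick: "finite J \<Longrightarrow> bij_betw (pick J) {..<card J} J"
proof -
  assume fin: "finite J"
  have inj: "inj_on (pick J) {..<card J}"
    by (rule inj_onI) (metis card_pick_le lessThan_iff)
  moreover have "pick J ` {..<card J} \<subseteq> J" by (intro image_subsetI pick_in_set_le) simp
  ultimately show ?thesis using fin
    by (simp add: bij_betw_def card_image card_subset_eq)
qed

lemma col_select_cols:
  assumes A: "A \<in> carrier_mat m n" and J: "J \<subseteq> {..<n}" and k: "k < card J"
  shows "col (select_cols A J) k = col A (pick J k)"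
proof -
  have "{j. j < n \<and> j \<in> J} = J" using assms by auto
  moreover have "pick J k < n" using pick_in_set_le[OF k] J by auto
  moreover have "pick UNIV i = i" for i by (simp add: pick_UNIV)
  ultimately show ?thesis using A k
    by (auto simp: select_cols_def submatrix_def col_def)
qed

lemma set_cols_select_cols:
  assumes A: "A \<in> carrier_mat m n" and J: "J \<subseteq> {..<n}"
  shows "set (cols (select_cols A J)) = col A ` J"
proof -
  have "set (cols (select_cols A J)) = col (select_cols A J) ` {..<card J}"
    using select_cols_carrier[OF A J] by (auto simp: cols_def)
  also have "\<dots> = (\<lambda>k. col A (pick J k)) ` {..<card J}"
    by (rule image_cong) (simp_all add: col_select_cols[OF A J])
  also have "\<dots> = col A ` pick J ` {..<card J}" by (simp add: image_image)
  also have "pick J ` {..<card J} = J"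
    using bij_betw_pick[of J] J finite_subset by (auto simp: bij_betw_def)
  finally show ?thesis .
qed

lemma distinct_cols_select_cols:
  assumes A: "A \<in> carrier_mat m n" and J: "J \<subseteq> {..<n}"
  shows "distinct (cols (select_cols A J)) \<longleftrightarrow> inj_on (col A) J"
proof -
  have bij: "bij_betw (pick J) {..<card J} J" using bij_betw_pick J finite_subset by blast
  have "cols (select_cols A J) = map (\<lambda>k. col A (pick J k)) [0..<card J]"
    unfolding cols_def using select_cols_carrier[OF A J]
    by (auto simp: col_select_cols[OF A J])
  then have "distinct (cols (select_cols A J)) \<longleftrightarrow> inj_on (col A \<circ> pick J) {..<card J}"
    by (simp add: distinct_map comp_def atLeast0LessThan)
  also have "\<dots> \<longleftrightarrow> inj_on (col A) J"
    using bij comp_inj_on_iff[of "pick J" "{..<card J}" "col A"] by (simp add: bij_betw_def)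
  finally show ?thesis .
qed

lemma is_col_basis_select_cols:
  assumes A: "A \<in> carrier_mat m n" and J: "J \<subseteq> {..<n}"
  shows "is_col_basis (select_cols A J) W \<longleftrightarrow> indep_family m (col A) J \<and> vspan m (col A ` J) = W"
proof -
  have fin: "finite J" using J finite_subset by blast
  have "col A ` J \<subseteq> carrier_vec m" using A by auto
  from indep_family_iff[OF fin this] show ?thesis
    using select_cols_carrier[OF A J]
    by (simp add: is_col_basis_def colspace_def set_cols_select_cols[OF A J] distinct_cols_select_cols[OF A J])
qed

lemma ex_indep_subfamily:
  assumes fin: "finite J" and f: "f ` J \<subseteq> carrier_vec n"
  shows "\<exists>K\<subseteq>J. indep_family n f K \<and> vspan n (f ` K) = vspan n (f ` J)"
  using assms
proof (induction "card J" arbitrary: J rule: less_induct)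
  case less
  show ?case
  proof (cases "indep_family n f J")
    case False
    then obtain j where j: "j \<in> J" "f j \<in> vspan n (f ` (J - {j}))" by (auto simp: indep_family_def)
    have c: "f ` (J - {j}) \<subseteq> carrier_vec n" using less.prems by auto
    have "f ` J \<subseteq> vspan n (f ` (J - {j}))" using j vspan_mem[OF c] by auto
    then have eq: "vspan n (f ` (J - {j})) = vspan n (f ` J)"
      by (intro equalityI vspan_mono vspan_subsetI[OF c]) auto
    have "card (J - {j}) < card J" by (rule card_Diff1_less[OF less.prems(1) j(1)])
    from less.hyps[OF this finite_Diff[OF less.prems(1)] c] obtain K where
      K: "K \<subseteq> J - {j}" "indep_family n f K" "vspan n (f ` K) = vspan n (f ` (J - {j}))" by blast
    show ?thesis by (rule exI[of _ K]) (use K eq in auto)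
  qed auto
qed

section \<open>Algorithm 1 in terms of linear spans\<close>

lemma l2norm_eq_0: "v \<in> carrier_vec n \<Longrightarrow> l2norm v = 0 \<longleftrightarrow> v = 0\<^sub>v n"
  unfolding l2norm_def by (simp add: scalar_prod_def sum_nonneg_eq_0_iff) (auto intro!: eq_vecI)

lemma l2norm_nonneg: "0 \<le> l2norm v"
  unfolding l2norm_def scalar_prod_def by (simp add: sum_nonneg)

lemma select_cols_restrict:
  assumes "A \<in> carrier_mat m n" shows "select_cols A J = select_cols A (J \<inter> {..<n})"
proof -
  have n: "dim_col A = n" using assms by simp
  have eq: "{j. j < n \<and> j \<in> J \<inter> {..<n}} = {j. j < n \<and> j \<in> J}" "{j. j < n \<and> j \<in> J} = J \<inter> {..<n}" by auto
  have pick: "pick J k = pick (J \<inter> {..<n}) k" if "k < card {j. j < n \<and> j \<in> J}" for k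
    using pick_reduce_set[OF that] eq by simp
  show ?thesis unfolding select_cols_def submatrix_def n eq(1)
    by (rule cong_mat) (simp_all add: pick)
qed

text \<open>Norms are nonnegative, so any coefficient vector with residual zero is already a
  minimiser, and such a vector exists exactly if the column lies in the range of the remaining
  ones.\<close>

lemma declared_inlier_iff:
  assumes A: "A \<in> carrier_mat m n" and i: "i < n"
  shows "declared_inlier A i \<longleftrightarrow> col A i \<in> vspan m (col A ` ({..<n} - {i}))"
proof -
  define Q where "Q = select_cols A (- {i})"
  have Qeq: "Q = select_cols A ({..<n} - {i})"
    unfolding Q_def select_cols_restrict[OF A, of "- {i}"] by (rule arg_cong[of _ _ "select_cols A"]) auto
  have Q: "Q \<in> carrier_mat m (card ({..<n} - {i}))"
    unfolding Qeq by (rule select_cols_carrier[OF A]) auto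
  have ci: "col A i \<in> carrier_vec m" using A i by auto
  have "vspan m (col A ` ({..<n} - {i})) = colspace Q"
    using Q set_cols_select_cols[OF A, of "{..<n} - {i}"] by (auto simp: colspace_def Qeq)
  then have span: "vspan m (col A ` ({..<n} - {i})) = {Q *\<^sub>v z | z. z \<in> carrier_vec (dim_col Q)}"
    using colspace_eq_range[OF Q] Q by auto
  have res: "l2norm (col A i - Q *\<^sub>v z) = 0 \<longleftrightarrow> col A i = Q *\<^sub>v z" if "z \<in> carrier_vec (dim_col Q)" for z
  proof -
    have Qz: "Q *\<^sub>v z \<in> carrier_vec m" by (rule mult_mat_vec_carrier[OF Q]) (use that Q in simp)
    have "l2norm (col A i - Q *\<^sub>v z) = 0 \<longleftrightarrow> col A i - Q *\<^sub>v z = 0\<^sub>v m"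
      by (rule l2norm_eq_0) (use ci Qz in auto)
    also have "\<dots> \<longleftrightarrow> col A i = Q *\<^sub>v z"
    proof
      assume 0: "col A i - Q *\<^sub>v z = 0\<^sub>v m"
      show "col A i = Q *\<^sub>v z"
      proof (rule eq_vecI)
        fix k assume "k < dim_vec (Q *\<^sub>v z)"
        then have k: "k < m" using carrier_vecD[OF Qz] by simp
        have "(col A i - Q *\<^sub>v z) $ k = 0" unfolding 0 using k by simp
        moreover have "(col A i - Q *\<^sub>v z) $ k = col A i $ k - (Q *\<^sub>v z) $ k"
          by (rule index_minus_vec(1)) (use k carrier_vecD[OF Qz] in simp)
        ultimately show "col A i $ k = (Q *\<^sub>v z) $ k" by simp
      qed (use carrier_vecD[OF ci] carrier_vecD[OF Qz] in simp)
    next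
      assume "col A i = Q *\<^sub>v z"
      then show "col A i - Q *\<^sub>v z = 0\<^sub>v m" using Qz by simp
    qed
    finally show ?thesis .
  qed
  have "declared_inlier A i \<longleftrightarrow> (\<exists>z. z \<in> carrier_vec (dim_col Q) \<and> l2norm (col A i - Q *\<^sub>v z) = 0)"
  proof
    assume "declared_inlier A i"
    then show "\<exists>z. z \<in> carrier_vec (dim_col Q) \<and> l2norm (col A i - Q *\<^sub>v z) = 0"
      unfolding declared_inlier_def Let_def Q_def[symmetric] is_arg_min_def by blast
  next
    assume "\<exists>z. z \<in> carrier_vec (dim_col Q) \<and> l2norm (col A i - Q *\<^sub>v z) = 0"
    then obtain z where z: "z \<in> carrier_vec (dim_col Q)" "l2norm (col A i - Q *\<^sub>v z) = 0" by blast
    then have "is_arg_min (\<lambda>z. l2norm (col A i - Q *\<^sub>v z)) (\<lambda>z. z \<in> carrier_vec (dim_col Q)) z"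
      unfolding is_arg_min_def using l2norm_nonneg[of "col A i - Q *\<^sub>v _"] by (simp add: not_less)
    then show "declared_inlier A i"
      unfolding declared_inlier_def Let_def Q_def[symmetric] using z(2) by blast
  qed
  also have "\<dots> \<longleftrightarrow> col A i \<in> vspan m (col A ` ({..<n} - {i}))"
    unfolding span using res by blast
  finally show ?thesis .
qed

lemma complement_proj_eq_0_iff:
  assumes U: "U \<in> carrier_mat m k" and onb: "is_orthonormal_basis U W" and x: "x \<in> carrier_vec m"
  shows "complement_proj U *\<^sub>v x = 0\<^sub>v m \<longleftrightarrow> x \<in> W"
proof -
  have W: "W = {U *\<^sub>v z | z. z \<in> carrier_vec k}" and UU: "U\<^sup>T * U = 1\<^sub>m k"
    using onb colspace_eq_range[OF U] U by (auto simp: is_orthonormal_basis_def)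
  have Ut: "U\<^sup>T \<in> carrier_mat k m" using U by simp
  have dim: "dim_row U = m" using U by simp
  define y where "y = U *\<^sub>v (U\<^sup>T *\<^sub>v x)"
  have y: "y \<in> carrier_vec m" unfolding y_def
    by (rule mult_mat_vec_carrier[OF U mult_mat_vec_carrier[OF Ut x]])
  have eq: "complement_proj U *\<^sub>v x = x - y"
  proof -
    have "complement_proj U *\<^sub>v x = 1\<^sub>m m *\<^sub>v x - (U * U\<^sup>T) *\<^sub>v x"
      unfolding complement_proj_def dim
      by (rule minus_mult_distrib_mat_vec[of _ m m]) (use U x in auto)
    also have "(U * U\<^sup>T) *\<^sub>v x = y" unfolding y_def by (rule assoc_mult_mat_vec[OF U Ut x])
    finally show ?thesis using x by simp
  qed
  show ?thesis
  proof
    assume 0: "complement_proj U *\<^sub>v x = 0\<^sub>v m"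
    have "x = y"
    proof (rule eq_vecI)
      fix a assume "a < dim_vec y"
      then have a: "a < m" "a < dim_vec y" using carrier_vecD[OF y] by simp_all
      have "(x - y) $ a = 0" using 0 a(1) unfolding eq by simp
      then show "x $ a = y $ a" unfolding index_minus_vec(1)[OF a(2)] by simp
    qed (use carrier_vecD[OF x] carrier_vecD[OF y] in simp)
    then show "x \<in> W" unfolding W y_def using mult_mat_vec_carrier[OF Ut x] by blast
  next
    assume "x \<in> W"
    then obtain z where z: "z \<in> carrier_vec k" "x = U *\<^sub>v z" unfolding W by blast
    have "U\<^sup>T *\<^sub>v x = (U\<^sup>T * U) *\<^sub>v z" unfolding z(2) by (rule assoc_mult_mat_vec[OF Ut U z(1), symmetric])
    then have "y = x" unfolding y_def UU using z by simp
    then show "complement_proj U *\<^sub>v x = 0\<^sub>v m" unfolding eq using x by simp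
  qed
qed

text \<open>\<open>outliers_located\<close> quantifies over all orthonormal bases of the learned
  space. Existence of one rules out the vacuous case and makes the predicate equivalent to a
  condition on that space.\<close>

lemma ex_orthonormal_basis:
  assumes S: "S \<subseteq> carrier_vec m" and fin: "finite S"
  shows "\<exists>k. \<exists>U\<in>carrier_mat m k. is_orthonormal_basis U (vspan m S)"
proof -
  from ex_indep_subfamily[OF fin, of id m] S obtain K where
    K: "K \<subseteq> S" "indep_family m id K" "vspan m K = vspan m S" by auto
  have finK: "finite K" using K(1) fin by (rule finite_subset)
  have Kc: "K \<subseteq> carrier_vec m" using K(1) S by simp
  have ind: "vindpt m K" using indep_family_iff[OF finK, of id m] Kc K(2) by simp
  obtain ws where ws: "set ws = K" "distinct ws" using finite_distinct_list[OF finK] by blast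
  interpret cof_vec_space m "TYPE(real)" .
  define us where "us = gram_schmidt m ws"
  have us: "span (set ws) = span (set us)" "corthogonal us" "set us \<subseteq> carrier_vec m"
    using gram_schmidt_result[of ws us] ws Kc ind us_def by auto
  \<comment> \<open>Gram-Schmidt gives nonzero orthogonal vectors; normalising them preserves the
    span.\<close>
  define vs where "vs = map (\<lambda>u. (1 / l2norm u) \<cdot>\<^sub>v u) us"
  have vs_c: "set vs \<subseteq> carrier_vec m" using us(3) by (auto simp: vs_def)
  have uc: "us ! i \<in> carrier_vec m" if "i < length us" for i using us(3) that by auto
  have pos: "l2norm (us ! i) > 0" if "i < length us" for i
  proof -
    have "us ! i \<bullet> us ! i \<noteq> 0" using corthogonalD[OF us(2) that that] by simp
    then show ?thesis unfolding l2norm_def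
      using l2norm_nonneg[of "us ! i"] by (simp add: l2norm_def)
  qed
  have gram: "vs ! i \<bullet> vs ! j = (if i = j then 1 else 0)" if "i < length us" "j < length us" for i j
  proof -
    have "vs ! i \<bullet> vs ! j = (us ! i \<bullet> us ! j) / (l2norm (us ! i) * l2norm (us ! j))"
      using smult_scalar_prod_distrib[OF uc[OF that(1)], of "1 / l2norm (us ! j) \<cdot>\<^sub>v us ! j" "1 / l2norm (us ! i)"]
        scalar_prod_smult_distrib[OF uc[OF that(1)] uc[OF that(2)], of "1 / l2norm (us ! j)"] uc[OF that(2)] that
      by (simp add: vs_def)
    moreover have "us ! i \<bullet> us ! j = 0" if "i \<noteq> j"
      using corthogonalD[OF us(2) \<open>i < length us\<close> \<open>j < length us\<close>] that by simp
    moreover have "us ! i \<bullet> us ! i = l2norm (us ! i) * l2norm (us ! i)"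
      unfolding l2norm_def by (simp add: scalar_prod_def sum_nonneg)
    ultimately show ?thesis using pos[OF that(1)] by auto
  qed
  define U where "U = mat_of_cols m vs"
  have U: "U \<in> carrier_mat m (length us)"
    using mat_of_cols_carrier(1)[of m vs] unfolding U_def vs_def by simp
  have "U\<^sup>T * U = 1\<^sub>m (length us)"
  proof (rule eq_matI)
    fix i j assume "i < dim_row (1\<^sub>m (length us))" "j < dim_col (1\<^sub>m (length us))"
    then have ij: "i < length us" "j < length us" by simp_all
    have "col U i = vs ! i" if "i < length us" for i
      unfolding U_def
    proof (rule col_mat_of_cols)
      show len: "i < length vs" using that by (simp add: vs_def)
      show "vs ! i \<in> carrier_vec m" using vs_c nth_mem[OF len] by blast
    qed
    then show "(U\<^sup>T * U) $$ (i, j) = 1\<^sub>m (length us) $$ (i, j)"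
      using ij U gram by simp
  qed (use U in auto)
  moreover have "colspace U = vspan m S"
  proof -
    have "colspace U = vspan m (set vs)"
      using cols_mat_of_cols[OF vs_c] by (simp add: colspace_def U_def)
    also have "\<dots> = vspan m (set us)"
    proof (rule equalityI; rule vspan_subsetI)
      show "set vs \<subseteq> vspan m (set us)"
      proof
        fix w assume "w \<in> set vs"
        then obtain u where u: "u \<in> set us" "w = (1 / l2norm u) \<cdot>\<^sub>v u" by (auto simp: vs_def)
        show "w \<in> vspan m (set us)" unfolding u(2) by (rule vspan_smult[OF us(3) vspan_mem[OF us(3) u(1)]])
      qed
      show "set us \<subseteq> vspan m (set vs)"
      proof
        fix u assume u: "u \<in> set us"
        then obtain i where i: "i < length us" "u = us ! i" by (auto simp: in_set_conv_nth)
        have "(1 / l2norm u) \<cdot>\<^sub>v u \<in> set vs" using u by (auto simp: vs_def)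
        from vspan_smult[OF vs_c vspan_mem[OF vs_c this], of "l2norm u"]
        have "l2norm u \<cdot>\<^sub>v ((1 / l2norm u) \<cdot>\<^sub>v u) \<in> vspan m (set vs)" .
        moreover have "l2norm u \<cdot>\<^sub>v ((1 / l2norm u) \<cdot>\<^sub>v u) = u"
          unfolding i(2) smult_smult_assoc using pos[OF i(1)] by simp
        ultimately show "u \<in> vspan m (set vs)" by (simp only:)
      qed
    qed (fact us(3) vs_c)+
    also have "\<dots> = vspan m K" using us(1) ws(1) by simp
    finally show ?thesis using K(3) by simp
  qed
  ultimately have "is_orthonormal_basis U (vspan m S)" using U by (simp add: is_orthonormal_basis_def)
  then show ?thesis using U by blast
qed

section \<open>Outputs and located outliers as conditions on column indices\<close>

lemma rrd_outputs_eq: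
  assumes Ds: "Ds \<in> carrier_mat N n" and \<Phi>: "\<Phi> \<in> carrier_mat m N"
  shows "rrd_outputs \<Phi> Ds = {select_cols Ds J | J. J \<subseteq> declared_inliers (\<Phi> * Ds) \<and>
    indep_family m (col (\<Phi> * Ds)) J \<and> vspan m (col (\<Phi> * Ds) ` J) = learned_space (\<Phi> * Ds)}"
proof -
  have A: "\<Phi> * Ds \<in> carrier_mat m n" using Ds \<Phi> by simp
  have "declared_inliers (\<Phi> * Ds) \<subseteq> {..<n}" using Ds by (auto simp: declared_inliers_def)
  then have "J \<subseteq> declared_inliers (\<Phi> * Ds) \<and> is_col_basis (select_cols (\<Phi> * Ds) J) W \<longleftrightarrow>
      J \<subseteq> declared_inliers (\<Phi> * Ds) \<and> indep_family m (col (\<Phi> * Ds)) J \<and> vspan m (col (\<Phi> * Ds) ` J) = W"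
    for J W
    using is_col_basis_select_cols[OF A, of J W] by (cases "J \<subseteq> declared_inliers (\<Phi> * Ds)") simp_all
  then show ?thesis unfolding rrd_outputs_def by (simp only:)
qed

lemma rrd_outputs_nonempty:
  assumes Ds: "Ds \<in> carrier_mat N n" and \<Phi>: "\<Phi> \<in> carrier_mat m N"
  shows "rrd_outputs \<Phi> Ds \<noteq> {}"
proof -
  let ?J = "declared_inliers (\<Phi> * Ds)"
  have sub: "?J \<subseteq> {..<n}" using Ds by (auto simp: declared_inliers_def)
  then have "finite ?J" by (rule finite_subset) simp
  moreover have "col (\<Phi> * Ds) ` ?J \<subseteq> carrier_vec m"
    by (intro image_subsetI col_carrier[of _ _ n]) (use Ds \<Phi> in simp)
  ultimately obtain K where "K \<subseteq> ?J" "indep_family m (col (\<Phi> * Ds)) K"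
    "vspan m (col (\<Phi> * Ds) ` K) = vspan m (col (\<Phi> * Ds) ` ?J)"
    using ex_indep_subfamily[of ?J "col (\<Phi> * Ds)" m] by blast
  moreover have "dim_row (\<Phi> * Ds) = m" using \<Phi> by simp
  ultimately show ?thesis unfolding rrd_outputs_eq[OF Ds \<Phi>] learned_space_def by auto
qed

text \<open>Index sets of columns range over a finite set, whereas output matrices vary with the
  noise; the finite quantifier is what measurability requires.\<close>

lemma exact_subspace_iff:
  assumes Ds: "Ds \<in> carrier_mat N n" and \<Phi>: "\<Phi> \<in> carrier_mat m N" and L: "L \<in> carrier_mat N N2"
  shows "exact_subspace L \<Phi> Ds \<longleftrightarrow> (\<forall>J\<subseteq>declared_inliers (\<Phi> * Ds).
    indep_family m (col (\<Phi> * Ds)) J \<and> vspan m (col (\<Phi> * Ds) ` J) = learned_space (\<Phi> * Ds) \<longrightarrow>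
    indep_family N (col Ds) J \<and> vspan N (col Ds ` J) = colspace L)"
proof -
  have sub: "declared_inliers (\<Phi> * Ds) \<subseteq> {..<n}" using Ds by (auto simp: declared_inliers_def)
  have "is_col_basis (select_cols Ds J) (colspace L) \<longleftrightarrow>
      indep_family N (col Ds) J \<and> vspan N (col Ds ` J) = colspace L"
    if "J \<subseteq> declared_inliers (\<Phi> * Ds)" for J
    by (rule is_col_basis_select_cols[OF Ds]) (use that sub in simp)
  moreover have "(\<forall>T\<in>{h J |J. J \<subseteq> X \<and> P J}. Q T) \<longleftrightarrow> (\<forall>J\<subseteq>X. P J \<longrightarrow> Q (h J))"
    for h :: "nat set \<Rightarrow> real mat" and X P Q by blast
  ultimately show ?thesis
    unfolding exact_subspace_def using rrd_outputs_nonempty[OF Ds \<Phi>]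
    unfolding rrd_outputs_eq[OF Ds \<Phi>] by simp
qed

lemma nonzero_cols_mult_complement_proj:
  assumes U: "U \<in> carrier_mat m k" and onb: "is_orthonormal_basis U W" and M: "M \<in> carrier_mat m n"
  shows "nonzero_cols (complement_proj U * M) = {j. j < n \<and> col M j \<notin> W}"
proof -
  have P: "complement_proj U \<in> carrier_mat m m" using U unfolding complement_proj_def by auto
  have "col (complement_proj U * M) j = 0\<^sub>v m \<longleftrightarrow> col M j \<in> W" if "j < n" for j
    using complement_proj_eq_0_iff[OF U onb, of "col M j"] M that
    by (simp add: col_mult2[OF P M that])
  then show ?thesis using P M by (auto simp: nonzero_cols_def)
qed

lemma outliers_located_iff:
  assumes Ds: "Ds \<in> carrier_mat N n" and \<Phi>: "\<Phi> \<in> carrier_mat m N" and D: "D \<in> carrier_mat N N2"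
  shows "outliers_located C D \<Phi> Ds \<longleftrightarrow>
    {j. j < N2 \<and> col (\<Phi> * D) j \<notin> learned_space (\<Phi> * Ds)} = nonzero_cols C"
proof -
  let ?A = "\<Phi> * Ds"
  have "finite (declared_inliers ?A)" "dim_row ?A = m" using \<Phi> by (simp_all add: declared_inliers_def)
  moreover have "col ?A ` declared_inliers ?A \<subseteq> carrier_vec m"
    by (intro image_subsetI col_carrier[of _ _ n]) (use Ds \<Phi> in simp)
  ultimately obtain k U where U: "U \<in> carrier_mat m k" "is_orthonormal_basis U (learned_space ?A)"
    using ex_orthonormal_basis[of "col ?A ` declared_inliers ?A" m] by (auto simp: learned_space_def)
  have M: "\<Phi> * D \<in> carrier_mat m N2" and dim: "dim_row \<Phi> = m" using \<Phi> D by simp_all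
  show ?thesis
    unfolding outliers_located_def dim
  proof
    assume "\<forall>k. \<forall>U\<in>carrier_mat m k. is_orthonormal_basis U (learned_space ?A) \<longrightarrow>
      nonzero_cols (complement_proj U * (\<Phi> * D)) = nonzero_cols C"
    then have "nonzero_cols (complement_proj U * (\<Phi> * D)) = nonzero_cols C" using U by blast
    then show "{j. j < N2 \<and> col (\<Phi> * D) j \<notin> learned_space ?A} = nonzero_cols C"
      unfolding nonzero_cols_mult_complement_proj[OF U M] .
  next
    assume eq: "{j. j < N2 \<and> col (\<Phi> * D) j \<notin> learned_space ?A} = nonzero_cols C"
    show "\<forall>k. \<forall>U\<in>carrier_mat m k. is_orthonormal_basis U (learned_space ?A) \<longrightarrow>
      nonzero_cols (complement_proj U * (\<Phi> * D)) = nonzero_cols C"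
    proof (intro allI ballI impI)
      fix k U assume "U \<in> carrier_mat m k" "is_orthonormal_basis U (learned_space ?A)"
      from nonzero_cols_mult_complement_proj[OF this M]
      show "nonzero_cols (complement_proj U * (\<Phi> * D)) = nonzero_cols C" unfolding eq .
    qed
  qed
qed

section \<open>Deterministic conditions for success\<close>

lemma row_sampling_mat_carrier: "row_sampling_mat N ys \<in> carrier_mat (length ys) N"
  using mat_of_rows_carrier(1)[of N "map (unit_vec N) ys"] unfolding row_sampling_mat_def by simp

lemma mult_mat_vec_unit:
  fixes M :: "real mat"
  assumes M: "M \<in> carrier_mat m n" and j: "j < n"
  shows "M *\<^sub>v unit_vec n j = col M j"
proof (rule eq_vecI)
  fix a assume "a < dim_vec (col M j)"
  then have "a < m" using M by simp
  then show "(M *\<^sub>v unit_vec n j) $ a = col M j $ a"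
    using M j scalar_prod_right_unit[of j n "row M a"] by simp
qed (use M in simp)

lemma mult_mat_vec_diff_eq_0:
  fixes M :: "real mat"
  assumes M: "M \<in> carrier_mat m n" and x: "x \<in> carrier_vec n" and y: "y \<in> carrier_vec n"
    and eq: "M *\<^sub>v x = M *\<^sub>v y"
  shows "M *\<^sub>v (x + (- 1) \<cdot>\<^sub>v y) = 0\<^sub>v m"
proof -
  have y': "(- 1) \<cdot>\<^sub>v y \<in> carrier_vec n" using y by simp
  have "M *\<^sub>v (x + (- 1) \<cdot>\<^sub>v y) = M *\<^sub>v y + (- 1) \<cdot>\<^sub>v (M *\<^sub>v y)"
    unfolding mult_add_distrib_mat_vec[OF M x y'] mult_mat_vec[OF M y] eq ..
  also have "\<dots> = 0\<^sub>v m"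
  proof -
    have "w + (- 1) \<cdot>\<^sub>v w = 0\<^sub>v m" if "w \<in> carrier_vec m" for w :: "real vec"
      using that by (intro eq_vecI) auto
    then show ?thesis using mult_mat_vec_carrier[OF M y] .
  qed
  finally show ?thesis .
qed

lemma vec_diff_eq_0:
  assumes x: "x \<in> carrier_vec n" and y: "y \<in> carrier_vec n" and 0: "x + (- 1) \<cdot>\<^sub>v y = 0\<^sub>v n"
  shows "x = (y :: real vec)"
proof (rule eq_vecI)
  fix a assume "a < dim_vec y"
  then have a: "a < n" using carrier_vecD[OF y] by simp
  have "(x + (- 1) \<cdot>\<^sub>v y) $ a = 0" unfolding 0 using a by simp
  then show "x $ a = y $ a" using a x y by simp
qed (use carrier_vecD[OF x] carrier_vecD[OF y] in simp)

text \<open>By \<open>spanning\<close> every sampled inlier is declared an inlier, and by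
  \<open>sampled\<close> no sampled outlier is, so the learned space is exactly the compressed
  column space. Injectivity of \<Phi> there lifts each basis chosen by the algorithm, and
  \<open>outlier\<close> keeps every outlier, sampled or not, outside the learned space.\<close>

lemma rrd_success_sufficient:
  assumes L: "L \<in> carrier_mat N N2" and C: "C \<in> carrier_mat N N2" and I: "I \<subseteq> {..<N2}"
    and LI: "\<And>i. i \<in> I \<Longrightarrow> col L i = 0\<^sub>v N"
    and CI: "\<And>j. j < N2 \<Longrightarrow> j \<notin> I \<Longrightarrow> col C j = 0\<^sub>v N"
    and xs: "set xs \<subseteq> {..<N2}"
    and \<Phi>_def: "\<Phi> = row_sampling_mat N ys" and m_def: "m = length ys"
    and spanning: "\<And>i. i \<in> {..<N2} - I \<Longrightarrow> col L i \<in> vspan N (col L ` (set xs - I - {i}))"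
    and inj: "\<And>x. x \<in> colspace L \<Longrightarrow> \<Phi> *\<^sub>v x = 0\<^sub>v m \<Longrightarrow> x = 0\<^sub>v N"
    and sampled: "\<And>i. i \<in> set xs \<inter> I \<Longrightarrow> \<Phi> *\<^sub>v col C i \<notin>
      vspan m ((\<lambda>x. \<Phi> *\<^sub>v x) ` colspace L \<union> (\<lambda>j. \<Phi> *\<^sub>v col C j) ` (set xs \<inter> I - {i}))"
    and outlier: "\<And>i. i \<in> I \<Longrightarrow> \<Phi> *\<^sub>v col C i \<notin> (\<lambda>x. \<Phi> *\<^sub>v x) ` colspace L"
  shows "rrd_success L C xs ys"
proof -
  define D where "D = L + C"
  define S where "S = set xs"
  define ds where "ds = remdups xs"
  define n where "n = length ds"
  define Ds where "Ds = D * col_sampling_mat N2 xs"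
  have D: "D \<in> carrier_mat N N2" unfolding D_def using C by (rule add_carrier_mat)
  have \<Phi>: "\<Phi> \<in> carrier_mat m N"
    unfolding \<Phi>_def m_def by (rule row_sampling_mat_carrier)
  have sel: "col_sampling_mat N2 xs \<in> carrier_mat N2 n"
    using mat_of_cols_carrier(1)[of N2 "map (unit_vec N2) ds"] unfolding col_sampling_mat_def n_def ds_def by simp
  have Ds: "Ds \<in> carrier_mat N n" unfolding Ds_def by (rule mult_carrier_mat[OF D sel])
  have A: "\<Phi> * Ds \<in> carrier_mat m n" by (rule mult_carrier_mat[OF \<Phi> Ds])
  have dsS: "set ds = S" and ds_dist: "distinct ds" by (simp_all add: ds_def S_def)
  \<comment> \<open>After removal of repetitions, positions in the sample correspond bijectively to
    column indices, so leaving out a position leaves out exactly one index.\<close>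
  have e_bij: "bij_betw ((!) ds) {..<n} S"
    unfolding n_def dsS[symmetric] by (rule bij_betw_nth[OF ds_dist refl refl])
  have e_img: "(!) ds ` {..<n} = S" using e_bij by (rule bij_betw_imp_surj_on)
  have SN: "S \<subseteq> {..<N2}" using xs by (simp add: S_def)
  have e_lt: "ds ! k < N2" if "k < n" for k using e_img SN that by auto
  have colDs: "col Ds k = col D (ds ! k)" if k: "k < n" for k
  proof -
    have "col (col_sampling_mat N2 xs) k = unit_vec N2 (ds ! k)"
      unfolding col_sampling_mat_def ds_def[symmetric] using k
      by (subst col_mat_of_cols) (simp_all add: n_def)
    then have "col Ds k = D *\<^sub>v unit_vec N2 (ds ! k)"
      unfolding Ds_def col_mult2[OF D sel k] by simp
    then show ?thesis using mult_mat_vec_unit[OF D e_lt[OF k]] by simp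
  qed
  have DL: "col D j = col L j" if j: "j < N2" "j \<notin> I" for j
  proof (rule eq_vecI)
    fix a assume "a < dim_vec (col L j)"
    then have a: "a < N" using L by simp
    have "col C j $ a = 0" unfolding CI[OF j] using a by simp
    then show "col D j $ a = col L j $ a" using L C a j by (simp add: D_def)
  qed (use L C in \<open>simp add: D_def\<close>)
  have DC: "col D j = col C j" if j: "j \<in> I" for j
  proof (rule eq_vecI)
    fix a assume "a < dim_vec (col C j)"
    then have a: "a < N" using C by simp
    have "j < N2" using j I by auto
    moreover have "col L j $ a = 0" unfolding LI[OF j] using a by simp
    ultimately show "col D j $ a = col C j $ a" using L C a by (simp add: D_def)
  qed (use L C in \<open>simp add: D_def\<close>)
  define f where "f j = \<Phi> *\<^sub>v col D j" for j
  have colA: "col (\<Phi> * Ds) k = f (ds ! k)" if "k < n" for k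
    unfolding col_mult2[OF \<Phi> Ds that] colDs[OF that] f_def ..
  have fc: "f ` X \<subseteq> carrier_vec m" for X
    unfolding f_def using mult_mat_vec_carrier[OF \<Phi> col_carrier[OF D]] by blast
  have Lc: "col L ` X \<subseteq> carrier_vec N" for X by (rule col_range_carrier[OF L])
  have colL: "colspace L = vspan N (col L ` {..<N2})"
    using L unfolding colspace_def cols_def by (simp add: atLeast0LessThan)
  have LSI: "vspan N (col L ` (S - I)) = colspace L"
    unfolding colL
  proof (rule equalityI)
    show "vspan N (col L ` (S - I)) \<subseteq> vspan N (col L ` {..<N2})"
      by (rule vspan_mono) (use SN in blast)
    show "vspan N (col L ` {..<N2}) \<subseteq> vspan N (col L ` (S - I))"
    proof (rule vspan_subsetI[OF Lc], rule image_subsetI)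
      fix j assume j: "j \<in> {..<N2}"
      show "col L j \<in> vspan N (col L ` (S - I))"
      proof (cases "j \<in> I")
        case True
        then show ?thesis using LI vspan_0 by simp
      next
        case False
        then have "col L j \<in> vspan N (col L ` (S - I - {j}))" using spanning[of j] j by (simp add: S_def)
        moreover have "vspan N (col L ` (S - I - {j})) \<subseteq> vspan N (col L ` (S - I))"
          by (rule vspan_mono) blast
        ultimately show ?thesis by blast
      qed
    qed
  qed
  have fL: "f ` X = (\<lambda>x. \<Phi> *\<^sub>v x) ` col L ` X" if "X \<subseteq> {..<N2} - I" for X
    unfolding image_image by (rule image_cong) (use that DL in \<open>auto simp: f_def\<close>)
  have vfL: "vspan m (f ` X) = (\<lambda>x. \<Phi> *\<^sub>v x) ` vspan N (col L ` X)" if "X \<subseteq> {..<N2} - I" for X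
    unfolding fL[OF that] by (rule vspan_mult_mat_vec[OF \<Phi> Lc])
  have declared: "declared_inliers (\<Phi> * Ds) = {k. k < n \<and> ds ! k \<notin> I}"
  proof -
    have "declared_inlier (\<Phi> * Ds) k \<longleftrightarrow> ds ! k \<notin> I" if k: "k < n" for k
    proof -
      let ?j = "ds ! k"
      have jS: "?j \<in> S" using k e_img by auto
      have "col (\<Phi> * Ds) ` ({..<n} - {k}) = f ` (!) ds ` ({..<n} - {k})"
        unfolding image_image by (rule image_cong) (simp_all add: colA)
      also have "(!) ds ` ({..<n} - {k}) = S - {?j}"
        using inj_on_image_set_diff[of "(!) ds" "{..<n}" "{..<n}" "{k}"] e_bij e_img k
        by (simp add: bij_betw_def)
      finally have iff: "declared_inlier (\<Phi> * Ds) k \<longleftrightarrow> f ?j \<in> vspan m (f ` (S - {?j}))"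
        unfolding declared_inlier_iff[OF A k] colA[OF k] by simp
      show ?thesis
      proof (cases "?j \<in> I")
        case False
        have sub: "S - I - {?j} \<subseteq> {..<N2} - I" using SN by blast
        have "col L ?j \<in> vspan N (col L ` (S - I - {?j}))"
          using spanning[of ?j] False jS SN by (auto simp: S_def)
        then have "\<Phi> *\<^sub>v col L ?j \<in> vspan m (f ` (S - I - {?j}))" unfolding vfL[OF sub] by (rule imageI)
        moreover have "f ?j = \<Phi> *\<^sub>v col L ?j" using DL[OF e_lt[OF k] False] by (simp add: f_def)
        moreover have "vspan m (f ` (S - I - {?j})) \<subseteq> vspan m (f ` (S - {?j}))"
          by (rule vspan_mono) blast
        ultimately have "f ?j \<in> vspan m (f ` (S - {?j}))" by (simp only: subsetD)
        then show ?thesis using iff False by blast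
      next
        case True
        have "f ` (S - {?j}) \<subseteq> (\<lambda>x. \<Phi> *\<^sub>v x) ` colspace L \<union> (\<lambda>j. \<Phi> *\<^sub>v col C j) ` (S \<inter> I - {?j})"
        proof (rule image_subsetI)
          fix i assume i: "i \<in> S - {?j}"
          show "f i \<in> (\<lambda>x. \<Phi> *\<^sub>v x) ` colspace L \<union> (\<lambda>j. \<Phi> *\<^sub>v col C j) ` (S \<inter> I - {?j})"
          proof (cases "i \<in> I")
            case True
            then show ?thesis using i DC by (auto simp: f_def)
          next
            case False
            have iN: "i < N2" using i SN by blast
            have "col L i \<in> colspace L" unfolding colL by (rule vspan_mem[OF Lc]) (use iN in blast)
            then show ?thesis using DL[OF iN False] by (auto simp: f_def)
          qed
        qed
        then have "vspan m (f ` (S - {?j})) \<subseteq>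
            vspan m ((\<lambda>x. \<Phi> *\<^sub>v x) ` colspace L \<union> (\<lambda>j. \<Phi> *\<^sub>v col C j) ` (S \<inter> I - {?j}))"
          by (rule vspan_mono)
        moreover have "f ?j \<notin> vspan m ((\<lambda>x. \<Phi> *\<^sub>v x) ` colspace L \<union> (\<lambda>j. \<Phi> *\<^sub>v col C j) ` (S \<inter> I - {?j}))"
          using sampled[of ?j] True jS DC[OF True] by (simp add: f_def S_def)
        ultimately show ?thesis using iff True by blast
      qed
    qed
    moreover have "dim_col (\<Phi> * Ds) = n" using A by (rule carrier_matD(2))
    ultimately show ?thesis unfolding declared_inliers_def by auto
  qed
  have e_declared: "(!) ds ` {k. k < n \<and> ds ! k \<notin> I} = S - I" using e_img by auto
  have learned: "learned_space (\<Phi> * Ds) = (\<lambda>x. \<Phi> *\<^sub>v x) ` colspace L"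
  proof -
    have "col (\<Phi> * Ds) ` {k. k < n \<and> ds ! k \<notin> I} = f ` (!) ds ` {k. k < n \<and> ds ! k \<notin> I}"
      unfolding image_image by (rule image_cong) (simp_all add: colA)
    moreover have "dim_row (\<Phi> * Ds) = m" using A by (rule carrier_matD(1))
    moreover have "S - I \<subseteq> {..<N2} - I" using SN by blast
    ultimately show ?thesis unfolding learned_space_def declared
      by (simp only: e_declared vfL LSI)
  qed
  have colspace_carrier: "x \<in> carrier_vec N" if "x \<in> colspace L" for x
    using vspan_carrier[OF Lc] that unfolding colL by blast
  have exact: "exact_subspace L \<Phi> Ds"
    unfolding exact_subspace_iff[OF Ds \<Phi> L] learned declared
  proof (intro allI impI; elim conjE)
    fix J assume J: "J \<subseteq> {k. k < n \<and> ds ! k \<notin> I}"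
      and indep: "indep_family m (col (\<Phi> * Ds)) J"
      and span: "vspan m (col (\<Phi> * Ds) ` J) = (\<lambda>x. \<Phi> *\<^sub>v x) ` colspace L"
    have Dsc: "col Ds ` X \<subseteq> carrier_vec N" for X by (rule col_range_carrier[OF Ds])
    have colJ: "col (\<Phi> * Ds) k = \<Phi> *\<^sub>v col Ds k" if "k \<in> J" for k
      by (rule col_mult2[OF \<Phi> Ds]) (use that J in blast)
    have img: "vspan m (col (\<Phi> * Ds) ` K) = (\<lambda>x. \<Phi> *\<^sub>v x) ` vspan N (col Ds ` K)" if "K \<subseteq> J" for K
    proof -
      have "col (\<Phi> * Ds) ` K = (\<lambda>x. \<Phi> *\<^sub>v x) ` col Ds ` K"
        unfolding image_image by (rule image_cong) (use colJ that in auto)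
      then show ?thesis using vspan_mult_mat_vec[OF \<Phi> Dsc] by (simp only:)
    qed
    have "indep_family N (col Ds) J"
      unfolding indep_family_def
    proof (intro ballI notI)
      fix j assume j: "j \<in> J" "col Ds j \<in> vspan N (col Ds ` (J - {j}))"
      then have "col (\<Phi> * Ds) j \<in> vspan m (col (\<Phi> * Ds) ` (J - {j}))"
        unfolding img[OF Diff_subset] colJ[OF j(1)] by (intro imageI)
      then show False using indep j(1) unfolding indep_family_def by blast
    qed
    moreover have "vspan N (col Ds ` J) = colspace L"
    proof (rule equalityI)
      have "col Ds ` J \<subseteq> col L ` {..<N2}"
      proof (rule image_subsetI)
        fix k assume "k \<in> J"
        then have k: "k < n" "ds ! k \<notin> I" using J by blast+
        have "col Ds k = col L (ds ! k)" using colDs[OF k(1)] DL[OF e_lt[OF k(1)] k(2)] by simp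
        then show "col Ds k \<in> col L ` {..<N2}" using e_lt[OF k(1)] by blast
      qed
      then show sub: "vspan N (col Ds ` J) \<subseteq> colspace L" unfolding colL by (rule vspan_mono)
      \<comment> \<open>The chosen columns are known to span only after compression: a vector of the
        column space has the same image as some combination of them, and injectivity identifies the
        two.\<close>
      show "colspace L \<subseteq> vspan N (col Ds ` J)"
      proof
        fix x assume x: "x \<in> colspace L"
        then have "\<Phi> *\<^sub>v x \<in> (\<lambda>x. \<Phi> *\<^sub>v x) ` vspan N (col Ds ` J)"
          unfolding img[OF order_refl, symmetric] span by (rule imageI)
        then obtain y where y: "y \<in> vspan N (col Ds ` J)" "\<Phi> *\<^sub>v x = \<Phi> *\<^sub>v y" by (elim imageE)
        have yL: "y \<in> colspace L" using y(1) sub by (rule subsetD[rotated])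
        have "x + (- 1) \<cdot>\<^sub>v y \<in> colspace L"
          using x yL unfolding colL by (intro vspan_add[OF Lc] vspan_smult[OF Lc])
        from inj[OF this mult_mat_vec_diff_eq_0[OF \<Phi> colspace_carrier[OF x] colspace_carrier[OF yL] y(2)]]
        have "x = y" by (rule vec_diff_eq_0[OF colspace_carrier[OF x] colspace_carrier[OF yL]])
        then show "x \<in> vspan N (col Ds ` J)" using y(1) by (simp only:)
      qed
    qed
    ultimately show "indep_family N (col Ds) J \<and> vspan N (col Ds ` J) = colspace L" by (rule conjI)
  qed
  have located: "outliers_located C D \<Phi> Ds"
    unfolding outliers_located_iff[OF Ds \<Phi> D] learned
  proof -
    have "col (\<Phi> * D) j \<in> (\<lambda>x. \<Phi> *\<^sub>v x) ` colspace L \<longleftrightarrow> j \<notin> I" if j: "j < N2" for j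
    proof (cases "j \<in> I")
      case True
      then show ?thesis using outlier[OF True] DC[OF True] by (simp add: col_mult2[OF \<Phi> D j])
    next
      case False
      have "col L j \<in> colspace L" unfolding colL by (rule vspan_mem[OF Lc]) (use j in blast)
      then have "\<Phi> *\<^sub>v col L j \<in> (\<lambda>x. \<Phi> *\<^sub>v x) ` colspace L" by (rule imageI)
      then show ?thesis using False DL[OF j False] by (simp add: col_mult2[OF \<Phi> D j])
    qed
    then have "{j. j < N2 \<and> col (\<Phi> * D) j \<notin> (\<lambda>x. \<Phi> *\<^sub>v x) ` colspace L} = I" using I by auto
    also have "I = nonzero_cols C"
    proof -
      \<comment> \<open>A zero column would be compressed to zero, which lies in the compressed
        column space, against \<open>outlier\<close>.\<close>
      have "col C i \<noteq> 0\<^sub>v N" if i: "i \<in> I" for i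
      proof
        assume "col C i = 0\<^sub>v N"
        then have "\<Phi> *\<^sub>v col C i \<in> (\<lambda>x. \<Phi> *\<^sub>v x) ` colspace L"
          using imageI[OF vspan_0[of N "col L ` {..<N2}"], of "\<lambda>x. \<Phi> *\<^sub>v x"] unfolding colL by simp
        then show False using outlier[OF i] by blast
      qed
      then show ?thesis using I CI C unfolding nonzero_cols_def by auto
    qed
    finally show "{j. j < N2 \<and> col (\<Phi> * D) j \<notin> (\<lambda>x. \<Phi> *\<^sub>v x) ` colspace L} = nonzero_cols C" .
  qed
  have "dim_row D = N" "dim_col D = N2" using D by simp_all
  then show ?thesis
    unfolding rrd_success_def Let_def D_def[symmetric]
    using exact located by (simp only: \<Phi>_def[symmetric] Ds_def[symmetric])
qed

section \<open>Measurability of success\<close>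

lemma borel_measurable_mv:
  assumes "\<And>a b. a < n \<Longrightarrow> b < n \<Longrightarrow> (\<lambda>w. P w a b) \<in> borel_measurable W"
    and "\<And>b. b < n \<Longrightarrow> (\<lambda>w. x w b) \<in> borel_measurable W" and "a < n"
  shows "(\<lambda>w. mv n (P w) (x w) a) \<in> borel_measurable W"
  unfolding mv_def using assms by (intro borel_measurable_sum borel_measurable_times) auto

lemma borel_measurable_perp:
  assumes "\<And>f b. f \<in> set fs \<Longrightarrow> b < n \<Longrightarrow> (\<lambda>w. f w b) \<in> borel_measurable W"
    and "a < n" "b < n"
  shows "(\<lambda>w. perp n (map (\<lambda>f. f w) fs) a b) \<in> borel_measurable W"
  using assms
proof (induction fs arbitrary: a b)
  case (Cons f fs)
  have P: "(\<lambda>w. perp n (map (\<lambda>f. f w) fs) a b) \<in> borel_measurable W" if "a < n" "b < n" for a b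
    by (rule Cons.IH) (use Cons.prems that in auto)
  have v: "(\<lambda>w. mv n (perp n (map (\<lambda>f. f w) fs)) (f w) a) \<in> borel_measurable W" if "a < n" for a
    by (rule borel_measurable_mv[OF P _ that]) (use Cons.prems in auto)
  show ?case
    unfolding list.map perp.simps ip_def
    by (intro borel_measurable_diff borel_measurable_divide borel_measurable_times
        borel_measurable_sum P v Cons.prems) auto
qed simp

definition measurable_mat :: "'w measure \<Rightarrow> nat \<Rightarrow> nat \<Rightarrow> ('w \<Rightarrow> real mat) \<Rightarrow> bool" where
  "measurable_mat W m n A \<longleftrightarrow> (\<forall>w. A w \<in> carrier_mat m n) \<and>
     (\<forall>i<m. \<forall>j<n. (\<lambda>w. A w $$ (i, j)) \<in> borel_measurable W)"

lemma measurable_mat_carrier: "measurable_mat W m n A \<Longrightarrow> A w \<in> carrier_mat m n"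
  and measurable_mat_entry:
    "measurable_mat W m n A \<Longrightarrow> i < m \<Longrightarrow> j < n \<Longrightarrow> (\<lambda>w. A w $$ (i, j)) \<in> borel_measurable W"
  by (simp_all add: measurable_mat_def)

lemma measurable_mat_const: "A \<in> carrier_mat m n \<Longrightarrow> measurable_mat W m n (\<lambda>w. A)"
  by (simp add: measurable_mat_def)

lemma measurable_mat_add:
  assumes "measurable_mat W m n A" "measurable_mat W m n B"
  shows "measurable_mat W m n (\<lambda>w. A w + B w)"
proof -
  have c: "A w \<in> carrier_mat m n" "B w \<in> carrier_mat m n" for w
    using assms by (simp_all add: measurable_mat_def)
  have eq: "(\<lambda>w. (A w + B w) $$ (i, j)) = (\<lambda>w. A w $$ (i, j) + B w $$ (i, j))" if "i < m" "j < n" for i j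
    using that carrier_matD[OF c(2)] by (intro ext) (simp add: index_add_mat(1))
  show ?thesis unfolding measurable_mat_def
  proof (intro conjI allI impI)
    show "A w + B w \<in> carrier_mat m n" for w by (rule add_carrier_mat[OF c(2)])
    show "(\<lambda>w. (A w + B w) $$ (i, j)) \<in> borel_measurable W" if "i < m" "j < n" for i j
      unfolding eq[OF that] using assms that by (intro borel_measurable_add measurable_mat_entry)
  qed
qed

lemma measurable_mat_mult:
  assumes "measurable_mat W m n A" "measurable_mat W n k B"
  shows "measurable_mat W m k (\<lambda>w. A w * B w)"
proof -
  have c: "A w \<in> carrier_mat m n" "B w \<in> carrier_mat n k" for w
    using assms by (simp_all add: measurable_mat_def)
  have eq: "(\<lambda>w. (A w * B w) $$ (i, j)) = (\<lambda>w. \<Sum>l<n. A w $$ (i, l) * B w $$ (l, j))" if "i < m" "j < k" for i j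
    using that carrier_matD[OF c(1)] carrier_matD[OF c(2)]
    by (intro ext) (simp add: scalar_prod_def atLeast0LessThan)
  show ?thesis unfolding measurable_mat_def
  proof (intro conjI allI impI)
    show "A w * B w \<in> carrier_mat m k" for w by (rule mult_carrier_mat[OF c(1) c(2)])
    show "(\<lambda>w. (A w * B w) $$ (i, j)) \<in> borel_measurable W" if "i < m" "j < k" for i j
      unfolding eq[OF that] using assms that
      by (intro borel_measurable_sum borel_measurable_times measurable_mat_entry) auto
  qed
qed

text \<open>Membership becomes \<open>m\<close> equations between Borel functions of the entries;
  the coordinates of the projected vector from \<open>m\<close> on vanish by themselves.\<close>

lemma pred_mem_vspan:
  assumes A: "measurable_mat W m n A" and B: "measurable_mat W m k B" and j: "j < k" and T: "T \<subseteq> {..<n}"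
  shows "Measurable.pred W (\<lambda>w. col (B w) j \<in> vspan m (col (A w) ` T))"
proof -
  define ts where "ts = sorted_list_of_set T"
  have fin: "finite T" using T by (rule finite_subset) simp
  have ts: "set ts = T" using fin by (simp add: ts_def)
  define fs where "fs = map (\<lambda>t w. vec_index (col (A w) t)) ts"
  have entry: "(\<lambda>w. col (M w) t $ b) \<in> borel_measurable W" if "measurable_mat W m n' M" "t < n'" "b < m" for M t b n'
  proof -
    have "col (M w) t $ b = M w $$ (b, t)" for w
      using carrier_matD[OF measurable_mat_carrier[OF that(1), of w]] that(2,3) by simp
    then show ?thesis using measurable_mat_entry[OF that(1) that(3,2)] by (simp only:)
  qed
  have P: "(\<lambda>w. perp m (map (\<lambda>f. f w) fs) a b) \<in> borel_measurable W" if "a < m" "b < m" for a b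
    by (rule borel_measurable_perp[OF _ that]) (use ts T in \<open>auto simp: fs_def intro!: entry[OF A]\<close>)
  have iff: "col (B w) j \<in> vspan m (col (A w) ` T) \<longleftrightarrow>
      (\<forall>a\<in>{..<m}. mv m (perp m (map (\<lambda>f. f w) fs)) (vec_index (col (B w) j)) a = 0)" for w
  proof -
    have "map (\<lambda>f. f w) fs = map vec_index (map (col (A w)) ts)" by (simp add: fs_def)
    moreover have "set (map (col (A w)) ts) = col (A w) ` T" using ts by simp
    moreover have "col (A w) ` T \<subseteq> carrier_vec m"
      using col_carrier[OF measurable_mat_carrier[OF A]] by blast
    moreover have "col (B w) j \<in> carrier_vec m" by (rule col_carrier[OF measurable_mat_carrier[OF B]])
    ultimately have "col (B w) j \<in> vspan m (col (A w) ` T) \<longleftrightarrow>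
        mv m (perp m (map (\<lambda>f. f w) fs)) (vec_index (col (B w) j)) = (\<lambda>a. 0)"
      using mem_vspan_iff_perp[of "map (col (A w)) ts" m "col (B w) j"] by (simp only:)
    also have "\<dots> \<longleftrightarrow> (\<forall>a\<in>{..<m}. mv m (perp m (map (\<lambda>f. f w) fs)) (vec_index (col (B w) j)) a = 0)"
    proof
      assume *: "\<forall>a\<in>{..<m}. mv m (perp m (map (\<lambda>f. f w) fs)) (vec_index (col (B w) j)) a = 0"
      show "mv m (perp m (map (\<lambda>f. f w) fs)) (vec_index (col (B w) j)) = (\<lambda>a. 0)"
      proof
        fix a show "mv m (perp m (map (\<lambda>f. f w) fs)) (vec_index (col (B w) j)) a = 0"
          using * mv_outside[OF is_proj_perp] by (cases "a < m") (blast, simp)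
      qed
    qed simp
    finally show ?thesis .
  qed
  show ?thesis unfolding iff
    using borel_measurable_mv[OF P entry[OF B j]] by (intro pred_intros_finite) auto
qed

lemma vspan_eq_iff:
  assumes S: "S \<subseteq> carrier_vec n" and T: "T \<subseteq> carrier_vec n"
  shows "vspan n S = vspan n T \<longleftrightarrow> (\<forall>x\<in>S. x \<in> vspan n T) \<and> (\<forall>x\<in>T. x \<in> vspan n S)"
proof
  assume eq: "vspan n S = vspan n T"
  show "(\<forall>x\<in>S. x \<in> vspan n T) \<and> (\<forall>x\<in>T. x \<in> vspan n S)"
  proof (intro conjI ballI)
    show "x \<in> vspan n T" if "x \<in> S" for x using vspan_mem[OF S that] unfolding eq .
    show "x \<in> vspan n S" if "x \<in> T" for x using vspan_mem[OF T that] unfolding eq .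
  qed
next
  assume "(\<forall>x\<in>S. x \<in> vspan n T) \<and> (\<forall>x\<in>T. x \<in> vspan n S)"
  then show "vspan n S = vspan n T"
    by (intro equalityI vspan_subsetI[OF S] vspan_subsetI[OF T] subsetI) (elim conjE, erule (1) bspec)+
qed

lemma pred_vspan_eq:
  assumes A: "measurable_mat W m n A" and B: "measurable_mat W m k B" and T: "T \<subseteq> {..<n}" and S: "S \<subseteq> {..<k}"
  shows "Measurable.pred W (\<lambda>w. vspan m (col (A w) ` T) = vspan m (col (B w) ` S))"
proof -
  have c: "col (A w) ` X \<subseteq> carrier_vec m" "col (B w) ` X \<subseteq> carrier_vec m" for w X
    using col_carrier[OF measurable_mat_carrier[OF A]] col_carrier[OF measurable_mat_carrier[OF B]] by blast+
  have fin: "finite T" "finite S" using T S finite_subset by blast+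
  have iff: "vspan m (col (A w) ` T) = vspan m (col (B w) ` S) \<longleftrightarrow>
      (\<forall>j\<in>T. col (A w) j \<in> vspan m (col (B w) ` S)) \<and> (\<forall>j\<in>S. col (B w) j \<in> vspan m (col (A w) ` T))" for w
  proof -
    have ball: "(\<forall>x\<in>f ` X. P x) \<longleftrightarrow> (\<forall>j\<in>X. P (f j))" for f :: "nat \<Rightarrow> real vec" and X P by blast
    show ?thesis unfolding vspan_eq_iff[OF c] by (simp only: ball)
  qed
  show ?thesis
    unfolding iff
    by (intro pred_intros_logic pred_intros_finite fin pred_mem_vspan[OF A B _ T] pred_mem_vspan[OF B A _ S])
      (use T S in blast)+
qed

lemma pred_indep_family:
  assumes A: "measurable_mat W m n A" and T: "T \<subseteq> {..<n}"
  shows "Measurable.pred W (\<lambda>w. indep_family m (col (A w)) T)"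
proof -
  have fin: "finite T" using T by (rule finite_subset) simp
  show ?thesis unfolding indep_family_def
    by (intro pred_intros_logic pred_intros_finite fin pred_mem_vspan[OF A A]) (use T in blast)+
qed

text \<open>The set of declared inliers is random but takes finitely many values. For a fixed value
  \<open>X\<close>, success is a finite Boolean combination of span memberships, so the event is
  split according to \<open>X\<close>.\<close>

lemma pred_rrd_success:
  assumes L: "L \<in> carrier_mat N N2" and C: "measurable_mat W N N2 C"
  shows "Measurable.pred W (\<lambda>w. rrd_success L (C w) xs ys)"
proof -
  define m where "m = length ys"
  define n where "n = length (remdups xs)"
  define \<Phi> where "\<Phi> = row_sampling_mat N ys"
  define E where "E = col_sampling_mat N2 xs"
  have \<Phi>: "\<Phi> \<in> carrier_mat m N"
    unfolding \<Phi>_def m_def by (rule row_sampling_mat_carrier)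
  have E: "E \<in> carrier_mat N2 n"
    using mat_of_cols_carrier(1)[of N2 "map (unit_vec N2) (remdups xs)"]
    unfolding col_sampling_mat_def n_def E_def by simp
  define D where "D w = L + C w" for w
  define Ds where "Ds w = D w * E" for w
  define A where "A w = \<Phi> * Ds w" for w
  have Lm: "measurable_mat W N N2 (\<lambda>w. L)" by (rule measurable_mat_const[OF L])
  have D: "measurable_mat W N N2 D"
    unfolding D_def by (rule measurable_mat_add[OF Lm C])
  have Ds: "measurable_mat W N n Ds"
    unfolding Ds_def by (rule measurable_mat_mult[OF D measurable_mat_const[OF E]])
  have A: "measurable_mat W m n A"
    unfolding A_def by (rule measurable_mat_mult[OF measurable_mat_const[OF \<Phi>] Ds])
  have \<Phi>D: "measurable_mat W m N2 (\<lambda>w. \<Phi> * D w)"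
    by (rule measurable_mat_mult[OF measurable_mat_const[OF \<Phi>] D])
  note carr = measurable_mat_carrier[OF D] measurable_mat_carrier[OF Ds] measurable_mat_carrier[OF A]
    measurable_mat_carrier[OF C]
  have colspace: "colspace L = vspan N (col L ` {..<N2})"
    using L unfolding colspace_def cols_def by (simp add: atLeast0LessThan)
  define decl where "decl w X \<longleftrightarrow> (\<forall>k\<in>{..<n}. k \<in> X \<longleftrightarrow> col (A w) k \<in> vspan m (col (A w) ` ({..<n} - {k})))" for w X
  have decl: "declared_inliers (A w) = X \<longleftrightarrow> decl w X" if "X \<in> Pow {..<n}" for w X
  proof -
    have "declared_inliers (A w) = {k. k < n \<and> col (A w) k \<in> vspan m (col (A w) ` ({..<n} - {k}))}"
      unfolding declared_inliers_def using carrier_matD(2)[OF carr(3)] declared_inlier_iff[OF carr(3)]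
      by (intro Collect_cong) auto
    then show ?thesis using that unfolding decl_def by auto
  qed
  \<comment> \<open>A column is nonzero exactly if it is not in the span of the empty family; this
    form is covered by \<open>pred_mem_vspan\<close>.\<close>
  define good where "good w X \<longleftrightarrow>
      (\<forall>J\<in>Pow X. indep_family m (col (A w)) J \<and> vspan m (col (A w) ` J) = vspan m (col (A w) ` X) \<longrightarrow>
         indep_family N (col (Ds w)) J \<and> vspan N (col (Ds w) ` J) = vspan N (col L ` {..<N2})) \<and>
      (\<forall>j\<in>{..<N2}. col (\<Phi> * D w) j \<notin> vspan m (col (A w) ` X) \<longleftrightarrow>
         col (C w) j \<notin> vspan N (col (C w) ` {}))" for w X
  have iff: "rrd_success L (C w) xs ys \<longleftrightarrow> (\<exists>X\<in>Pow {..<n}. decl w X \<and> good w X)" for w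
  proof -
    define J where "J = declared_inliers (A w)"
    have JP: "J \<in> Pow {..<n}"
      using carrier_matD(2)[OF carr(3)[of w]] unfolding J_def declared_inliers_def by auto
    have uniq: "decl w X \<longleftrightarrow> X = J" if "X \<in> Pow {..<n}" for X
      unfolding decl[OF that, symmetric] J_def by (rule eq_commute)
    have dims: "dim_row (D w) = N" "dim_col (D w) = N2" "dim_row (A w) = m"
      using carrier_matD[OF carr(1)] carrier_matD[OF carr(3)] by simp_all
    have learned: "learned_space (A w) = vspan m (col (A w) ` J)"
      unfolding learned_space_def dims J_def ..
    have "{j. j < N2 \<and> col (\<Phi> * D w) j \<notin> vspan m (col (A w) ` J)} = nonzero_cols (C w) \<longleftrightarrow>
        (\<forall>j\<in>{..<N2}. col (\<Phi> * D w) j \<notin> vspan m (col (A w) ` J) \<longleftrightarrow> col (C w) j \<notin> vspan N (col (C w) ` {}))"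
      unfolding nonzero_cols_def carrier_matD[OF carr(4)] image_empty vspan_empty by auto
    moreover have "rrd_success L (C w) xs ys \<longleftrightarrow> exact_subspace L \<Phi> (Ds w) \<and> outliers_located (C w) (D w) \<Phi> (Ds w)"
      unfolding rrd_success_def Let_def D_def[symmetric] dims \<Phi>_def E_def[symmetric] Ds_def ..
    ultimately have "rrd_success L (C w) xs ys \<longleftrightarrow> good w J"
      unfolding exact_subspace_iff[OF carr(2) \<Phi> L] outliers_located_iff[OF carr(2) \<Phi> carr(1)]
        A_def[symmetric] J_def[symmetric] learned good_def colspace by (simp only: Ball_def Pow_iff)
    then show ?thesis using JP uniq by metis
  qed
  have pdecl: "Measurable.pred W (\<lambda>w. decl w X)" for X
    unfolding decl_def
    by (intro pred_intros_finite pred_intros_logic pred_mem_vspan[OF A A]) auto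
  have pgood: "Measurable.pred W (\<lambda>w. good w X)" if X: "X \<in> Pow {..<n}" for X
    unfolding good_def
    by (intro pred_intros_finite pred_intros_logic pred_mem_vspan[OF A \<Phi>D] pred_mem_vspan[OF C C]
        pred_vspan_eq[OF A A] pred_vspan_eq[OF Ds Lm] pred_indep_family[OF A] pred_indep_family[OF Ds])
      (use X in \<open>auto intro: finite_subset\<close>)
  show ?thesis unfolding iff
    by (intro pred_intros_finite pred_intros_logic pdecl pgood) auto
qed

section \<open>Gaussian outliers\<close>

text \<open>Fubini's theorem with coordinate \<open>p\<close> integrated first: a set that is null
  along every line in direction \<open>p\<close> is null.\<close>

lemma (in product_sigma_finite) AE_PiM_coordinate:
  assumes J: "finite J" "p \<in> J" and Q: "Measurable.pred (PiM J M) Q"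
    and AE: "\<And>g. g \<in> space (PiM (J - {p}) M) \<Longrightarrow> AE x in M p. Q (g(p := x))"
  shows "AE g in PiM J M. Q g"
proof -
  have ins: "insert p (J - {p}) = J" using J by auto
  have fin: "finite (J - {p})" and p: "p \<notin> J - {p}" using J by auto
  let ?f = "\<lambda>g. indicator {g\<in>space (PiM J M). \<not> Q g} g :: ennreal"
  have set: "{g\<in>space (PiM J M). \<not> Q g} \<in> sets (PiM J M)" using Q by measurable
  then have f: "?f \<in> borel_measurable (PiM (insert p (J - {p})) M)" unfolding ins by measurable
  have "emeasure (PiM J M) {g\<in>space (PiM J M). \<not> Q g} = integral\<^sup>N (PiM (insert p (J - {p})) M) ?f"
    unfolding ins using set by simp
  also have "\<dots> = (\<integral>\<^sup>+g. (\<integral>\<^sup>+x. ?f (g(p := x)) \<partial>M p) \<partial>PiM (J - {p}) M)"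
    by (rule product_nn_integral_insert[OF fin p f])
  also have "\<dots> = (\<integral>\<^sup>+g. 0 \<partial>PiM (J - {p}) M)"
  proof (rule nn_integral_cong)
    fix g assume "g \<in> space (PiM (J - {p}) M)"
    from AE[OF this] have "AE x in M p. ?f (g(p := x)) = 0" by eventually_elim simp
    then have "(\<integral>\<^sup>+x. ?f (g(p := x)) \<partial>M p) = (\<integral>\<^sup>+x. 0 \<partial>M p)" by (rule nn_integral_cong_AE)
    then show "(\<integral>\<^sup>+x. ?f (g(p := x)) \<partial>M p) = 0" by simp
  qed
  finally have "emeasure (PiM J M) {g\<in>space (PiM J M). \<not> Q g} = 0" by simp
  then show ?thesis using set by (intro AE_I'[of "{g\<in>space (PiM J M). \<not> Q g}"]) auto
qed

definition gaussian :: "real \<Rightarrow> real measure" where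
  "gaussian \<sigma> = density lborel (\<lambda>x. ennreal (normal_density 0 \<sigma> x))"

lemma prob_space_gaussian: "0 < \<sigma> \<Longrightarrow> prob_space (gaussian \<sigma>)"
  unfolding gaussian_def by (rule prob_space_normal_density)

text \<open>A Gaussian has no atoms. The uniqueness form spares solving for the exceptional
  value.\<close>

lemma AE_gaussian_at_most_one:
  assumes "\<And>s t. P s \<Longrightarrow> P t \<Longrightarrow> s = t"
  shows "AE x in gaussian \<sigma>. \<not> P x"
proof -
  obtain c where c: "\<And>x. P x \<Longrightarrow> x = c" using assms by metis
  have "AE x in lborel. x \<noteq> c" by (rule AE_lborel_singleton)
  then have "AE x in gaussian \<sigma>. x \<noteq> c" unfolding gaussian_def by (subst AE_density) auto
  then show ?thesis by eventually_elim (use c in blast)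
qed

lemma sets_gaussian [measurable_cong]: "sets (gaussian \<sigma>) = sets borel"
  by (simp add: gaussian_def)

text \<open>The projection depends on the fixed vectors and on the noise columns \<open>ks\<close>,
  not on column \<open>i\<close>. Where its diagonal entry at \<open>a\<close> is nonzero,
  coordinate \<open>a\<close> of the projected column is a nonconstant affine function of the single
  entry in row \<open>ys ! a\<close> of column \<open>i\<close>, and vanishes for at most one value
  of it.\<close>

lemma AE_gaussian_col_not_killed:
  fixes us :: "(nat \<Rightarrow> real) list" and ys :: "'a list" and i :: 'b
  assumes \<sigma>: "0 < \<sigma>" and J: "finite J" and i: "i \<notin> set ks"
    and ys: "distinct ys" and sub: "\<And>r k. r \<in> set ys \<Longrightarrow> k \<in> insert i (set ks) \<Longrightarrow> (r, k) \<in> J"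
    and len: "length us + length ks < length ys"
  shows "AE g in PiM J (\<lambda>_. gaussian \<sigma>).
    mv (length ys) (perp (length ys) (us @ map (\<lambda>k r. g (ys ! r, k)) ks)) (\<lambda>r. g (ys ! r, i)) \<noteq> (\<lambda>a. 0)"
proof -
  interpret product_sigma_finite "\<lambda>_ :: 'a \<times> 'b. gaussian \<sigma>"
    unfolding product_sigma_finite_def
    using prob_space_imp_sigma_finite[OF prob_space_gaussian[OF \<sigma>]] by blast
  let ?m = "length ys"
  let ?M = "PiM J (\<lambda>_. gaussian \<sigma>)"
  define P where "P g = perp ?m (us @ map (\<lambda>k r. g (ys ! r, k)) ks)" for g :: "'a \<times> 'b \<Rightarrow> real"
  have entry: "(\<lambda>g. g (ys ! r, k)) \<in> borel_measurable ?M" if "r < ?m" "k \<in> insert i (set ks)" for r k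
  proof -
    have "(ys ! r, k) \<in> J" using sub that by simp
    then have "(\<lambda>g. g (ys ! r, k)) \<in> measurable ?M (gaussian \<sigma>)" by (rule measurable_component_singleton)
    then show ?thesis by (simp add: measurable_cong_sets[OF refl sets_gaussian])
  qed
  define fs where "fs = map (\<lambda>u (g :: 'a \<times> 'b \<Rightarrow> real). u) us @ map (\<lambda>k g r. g (ys ! r, k)) ks"
  have fs: "map (\<lambda>f. f g) fs = us @ map (\<lambda>k r. g (ys ! r, k)) ks" for g
    by (simp add: fs_def comp_def)
  have Pm: "(\<lambda>g. P g a b) \<in> borel_measurable ?M" if "a < ?m" "b < ?m" for a b
    unfolding P_def fs[symmetric]
    by (rule borel_measurable_perp[OF _ that]) (auto simp: fs_def intro!: entry)
  have xm: "(\<lambda>g. mv ?m (P g) (\<lambda>r. g (ys ! r, i)) a) \<in> borel_measurable ?M" if "a < ?m" for a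
    by (rule borel_measurable_mv[OF Pm _ that]) (auto intro!: entry)
  \<comment> \<open>Which diagonal entry is nonzero depends on \<open>g\<close>, so the claim is
    made conditionally for each of the finitely many \<open>a\<close>.\<close>
  have "AE g in ?M. \<not> (P g a a \<noteq> 0 \<and> mv ?m (P g) (\<lambda>r. g (ys ! r, i)) a = 0)" if a: "a < ?m" for a
  proof (rule AE_PiM_coordinate[OF J, of "(ys ! a, i)"])
    show "(ys ! a, i) \<in> J" using sub a by simp
    show "Measurable.pred ?M (\<lambda>g. \<not> (P g a a \<noteq> 0 \<and> mv ?m (P g) (\<lambda>r. g (ys ! r, i)) a = 0))"
      using Pm[OF a a] xm[OF a] by measurable
    fix g :: "'a \<times> 'b \<Rightarrow> real"
    show "AE x in gaussian \<sigma>. \<not> (P (g((ys ! a, i) := x)) a a \<noteq> 0 \<and>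
        mv ?m (P (g((ys ! a, i) := x))) (\<lambda>r. (g((ys ! a, i) := x)) (ys ! r, i)) a = 0)"
    proof (rule AE_gaussian_at_most_one)
      fix s t :: real
      have Pg: "P (g((ys ! a, i) := x)) = P g" for x
        unfolding P_def by (intro arg_cong[of _ _ "perp ?m"]) (use i in auto)
      have mv: "mv ?m (P g) (\<lambda>r. (g((ys ! a, i) := x)) (ys ! r, i)) a =
          P g a a * x + (\<Sum>r\<in>{..<?m} - {a}. P g a r * g (ys ! r, i))" for x
      proof -
        have "mv ?m (P g) (\<lambda>r. (g((ys ! a, i) := x)) (ys ! r, i)) a =
            P g a a * x + (\<Sum>r\<in>{..<?m} - {a}. P g a r * (g((ys ! a, i) := x)) (ys ! r, i))"
          unfolding mv_def using a by (subst sum.remove[of _ a]) simp_all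
        also have "(\<Sum>r\<in>{..<?m} - {a}. P g a r * (g((ys ! a, i) := x)) (ys ! r, i)) =
            (\<Sum>r\<in>{..<?m} - {a}. P g a r * g (ys ! r, i))"
          by (rule sum.cong) (use ys a in \<open>auto simp: nth_eq_iff_index_eq\<close>)
        finally show ?thesis .
      qed
      assume "P (g((ys ! a, i) := s)) a a \<noteq> 0 \<and> mv ?m (P (g((ys ! a, i) := s))) (\<lambda>r. (g((ys ! a, i) := s)) (ys ! r, i)) a = 0"
        and "P (g((ys ! a, i) := t)) a a \<noteq> 0 \<and> mv ?m (P (g((ys ! a, i) := t))) (\<lambda>r. (g((ys ! a, i) := t)) (ys ! r, i)) a = 0"
      then have "P g a a \<noteq> 0" "P g a a * s = P g a a * t" unfolding Pg mv by linarith+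
      then show "s = t" by simp
    qed
  qed
  then have "AE g in ?M. \<forall>a\<in>{..<?m}. \<not> (P g a a \<noteq> 0 \<and> mv ?m (P g) (\<lambda>r. g (ys ! r, i)) a = 0)"
    by (intro AE_finite_allI) auto
  then show ?thesis
  proof eventually_elim
    case (elim g)
    have "tr ?m (P g) \<ge> real ?m - real (length (us @ map (\<lambda>k r. g (ys ! r, k)) ks))"
      unfolding P_def by (rule tr_perp_ge)
    then have "tr ?m (P g) \<noteq> 0" using len by simp
    \<comment> \<open>There are fewer vectors than dimensions, so the trace is positive and some
      diagonal entry is nonzero.\<close>
    then obtain a where "a < ?m" "P g a a \<noteq> 0" unfolding tr_def by (meson lessThan_iff sum.neutral)
    with elim have "mv ?m (P g) (\<lambda>r. g (ys ! r, i)) a \<noteq> 0" by blast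
    then show ?case unfolding P_def[symmetric] by auto
  qed
qed

lemma row_sampling_mat_mult:
  assumes v: "v \<in> carrier_vec N" and r: "r < length ys" and ys: "set ys \<subseteq> {..<N}"
  shows "(row_sampling_mat N ys *\<^sub>v v) $ r = v $ (ys ! r)"
proof -
  have "ys ! r \<in> set ys" using r by simp
  then have "ys ! r < N" using ys by blast
  moreover have "row (row_sampling_mat N ys) r = unit_vec N (ys ! r)"
    unfolding row_sampling_mat_def using r by (subst mat_of_rows_row) simp_all
  ultimately show ?thesis
    using r v carrier_matD[OF row_sampling_mat_carrier[of N ys]] scalar_prod_left_unit[of v N "ys ! r"] by simp
qed

lemma outlier_mat_carrier: "outlier_mat N N2 I g \<in> carrier_mat N N2"
  by (simp add: outlier_mat_def)

text \<open>The compressed column space has the \<open>r\<close> compressed columns of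
  \<open>U\<close> as generators and \<open>T\<close> adds \<open>card T\<close> more, so
  \<open>len\<close> leaves a direction that these vectors miss.\<close>

lemma AE_outlier_not_in_span:
  assumes \<sigma>: "0 < \<sigma>" and I: "I \<subseteq> {..<N2}" and T: "T \<subseteq> I" and i: "i \<in> I - T"
    and ys: "distinct ys" "set ys \<subseteq> {..<N}" and U: "U \<in> carrier_mat N r"
    and len: "r + card T < length ys"
  shows "AE g in noise_law N I \<sigma>. row_sampling_mat N ys *\<^sub>v col (outlier_mat N N2 I g) i \<notin>
    vspan (length ys) ((\<lambda>x. row_sampling_mat N ys *\<^sub>v x) ` colspace U \<union>
      (\<lambda>j. row_sampling_mat N ys *\<^sub>v col (outlier_mat N N2 I g) j) ` T)"
proof -
  let ?m = "length ys"
  define \<Phi> where "\<Phi> = row_sampling_mat N ys"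
  have \<Phi>: "\<Phi> \<in> carrier_mat ?m N" unfolding \<Phi>_def by (rule row_sampling_mat_carrier)
  have finI: "finite I" using I by (rule finite_subset) simp
  have finT: "finite T" using T finI by (rule finite_subset)
  define ks where "ks = sorted_list_of_set T"
  have ks: "set ks = T" "length ks = card T" using finT by (simp_all add: ks_def)
  define us where "us = map (\<lambda>k. \<Phi> *\<^sub>v col U k) [0..<r]"
  have usc: "set us \<subseteq> carrier_vec ?m"
    unfolding us_def using mult_mat_vec_carrier[OF \<Phi> col_carrier[OF U]] by auto
  have "AE g in PiM ({..<N} \<times> I) (\<lambda>_. gaussian \<sigma>).
    mv ?m (perp ?m (map vec_index us @ map (\<lambda>k r. g (ys ! r, k)) ks)) (\<lambda>r. g (ys ! r, i)) \<noteq> (\<lambda>a. 0)"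
    by (rule AE_gaussian_col_not_killed[OF \<sigma>])
      (use finI i T ks ys len in \<open>auto simp: us_def\<close>)
  then show ?thesis
    unfolding noise_law_def gaussian_def[symmetric] \<Phi>_def[symmetric]
  proof eventually_elim
    case (elim g)
    define h where "h j = \<Phi> *\<^sub>v col (outlier_mat N N2 I g) j" for j
    have hc: "h j \<in> carrier_vec ?m" for j
      unfolding h_def by (rule mult_mat_vec_carrier[OF \<Phi> col_carrier[OF outlier_mat_carrier]])
    have h: "h j $ a = g (ys ! a, j)" if "j \<in> I" "a < ?m" for j a
    proof -
      have "ys ! a < N" "j < N2" using that ys(2) I by (auto dest: nth_mem)
      then have "col (outlier_mat N N2 I g) j $ (ys ! a) = g (ys ! a, j)"
        using that(1) by (simp add: outlier_mat_def)
      then show ?thesis unfolding h_def \<Phi>_def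
        row_sampling_mat_mult[OF col_carrier[OF outlier_mat_carrier] that(2) ys(2)] .
    qed
    define vs where "vs = us @ map h ks"
    have vsc: "set vs \<subseteq> carrier_vec ?m" using usc hc by (auto simp: vs_def)
    have perp_eq: "perp ?m (map vec_index vs) = perp ?m (map vec_index us @ map (\<lambda>k r. g (ys ! r, k)) ks)"
    proof -
      have "list_all2 (\<lambda>u v. \<forall>b<?m. u b = v b) (map vec_index us @ map vec_index (map h ks))
          (map vec_index us @ map (\<lambda>k r. g (ys ! r, k)) ks)"
        using h ks(1) T by (intro list_all2_appendI) (auto simp: list_all2_conv_all_nth subset_iff)
      from perp_cong[OF this] show ?thesis by (simp add: vs_def)
    qed
    have "mv ?m (perp ?m (map vec_index vs)) (vec_index (h i)) \<noteq> (\<lambda>a. 0)"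
    proof -
      have "mv ?m (perp ?m (map vec_index vs)) (vec_index (h i)) = mv ?m (perp ?m (map vec_index vs)) (\<lambda>r. g (ys ! r, i))"
        by (rule mv_cong) (use h i in simp)
      then show ?thesis using elim unfolding perp_eq by simp
    qed
    then have notin: "h i \<notin> vspan ?m (set vs)" unfolding mem_vspan_iff_perp[OF vsc hc] .
    have "(\<lambda>x. \<Phi> *\<^sub>v x) ` colspace U \<union> h ` T \<subseteq> vspan ?m (set vs)"
    proof (rule Un_least)
      have "colspace U = vspan N (col U ` {0..<r})"
        using carrier_matD[OF U] unfolding colspace_def cols_def by simp
      then have "(\<lambda>x. \<Phi> *\<^sub>v x) ` colspace U = vspan ?m (set us)"
        using vspan_mult_mat_vec[OF \<Phi>, of "col U ` {0..<r}"] col_carrier[OF U]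
        by (simp add: us_def image_image image_subset_iff)
      then show "(\<lambda>x. \<Phi> *\<^sub>v x) ` colspace U \<subseteq> vspan ?m (set vs)"
        using vspan_mono[of "set us" "set vs" ?m] by (simp add: vs_def)
      show "h ` T \<subseteq> vspan ?m (set vs)"
        using vspan_mem[OF vsc] ks(1) by (auto simp: vs_def)
    qed
    then have "vspan ?m ((\<lambda>x. \<Phi> *\<^sub>v x) ` colspace U \<union> h ` T) \<subseteq> vspan ?m (set vs)"
      by (rule vspan_subsetI[OF vsc])
    then show ?case using notin unfolding h_def by blast
  qed
qed

section \<open>Incoherence and sample sizes\<close>

text \<open>The trace of the frame identity equates \<open>n\<close> with the sum of the squared
  lengths. It yields \<open>1 \<le> card A * B\<close>, which keeps the contraction factors
  nonnegative.\<close>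

lemma parseval_frame_le_card:
  fixes B :: real
  assumes v: "parseval_frame n A v" and A: "finite A" and B: "\<And>j. j \<in> A \<Longrightarrow> ip n (v j) (v j) \<le> B"
  shows "real n \<le> card A * B"
proof -
  have "(\<Sum>j\<in>A. ip n (v j) (v j)) = (\<Sum>a<n. \<Sum>j\<in>A. v j a * v j a)"
    unfolding ip_def by (rule sum.swap)
  also have "\<dots> = (\<Sum>a<n. 1)" using v by (intro sum.cong) (simp_all add: parseval_frame_def)
  finally have "real n = (\<Sum>j\<in>A. ip n (v j) (v j))" by simp
  also have "\<dots> \<le> (\<Sum>j\<in>A. B)" by (rule sum_mono) (rule B)
  finally show ?thesis by simp
qed

lemma orthonormal_entries:
  fixes U :: "real mat"
  assumes U: "U \<in> carrier_mat N r" and onb: "is_orthonormal_basis U W" and ab: "a < r" "b < r"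
  shows "(\<Sum>k<N. U $$ (k, a) * U $$ (k, b)) = (if a = b then 1 else 0)"
proof -
  have d: "dim_row U = N" "dim_col U = r" using U by simp_all
  have "(U\<^sup>T * U) $$ (a, b) = (\<Sum>k<N. U $$ (k, a) * U $$ (k, b))"
    using ab d by (simp add: scalar_prod_def atLeast0LessThan)
  moreover have "U\<^sup>T * U = 1\<^sub>m r" using onb d by (simp add: is_orthonormal_basis_def)
  ultimately show ?thesis using ab by simp
qed

text \<open>The rows of \<open>V\<close> are extended by zero to all column indices, so the frame is
  indexed like the draws and an outlier draw contributes nothing. \<open>X\<close> exists because
  the rows of the inlier matrix lie in the range of \<open>V\<close>, and \<open>Y\<close> because
  the columns of \<open>V\<close> lie in its row space; they carry linear relations between
  coordinate vectors and columns of \<open>L\<close> in both directions.\<close>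

lemma inlier_coordinates:
  assumes L: "L \<in> carrier_mat N1 N2" and J: "nonzero_cols L = J" and N2': "N2' = card J"
    and V: "V \<in> carrier_mat N2' r" and onb: "is_orthonormal_basis V (rowspace (inlier_mat L))"
    and \<mu>: "row_incoherent V \<mu>" and r: "1 \<le> r"
  obtains v X Y where "parseval_frame r {..<N2} v" "\<And>j. j \<notin> J \<Longrightarrow> v j = (\<lambda>a. 0)"
    "\<And>j. ip r (v j) (v j) \<le> r * \<mu> / N2'" "0 < N2'"
    "X \<in> carrier_mat N1 r" "Y \<in> carrier_mat r N1"
    "\<And>j. j \<in> J \<Longrightarrow> col L j = X *\<^sub>v vec r (v j)" "\<And>j. j \<in> J \<Longrightarrow> vec r (v j) = Y *\<^sub>v col L j"
proof -
  have JN: "J \<subseteq> {..<N2}" using carrier_matD[OF L] by (auto simp: J[symmetric] nonzero_cols_def)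
  then have fin: "finite J" by (rule finite_subset) simp
  define L' where "L' = inlier_mat L"
  have L': "L' \<in> carrier_mat N1 N2'"
    unfolding L'_def inlier_mat_def J N2' by (rule select_cols_carrier[OF L JN])
  have L't: "L'\<^sup>T \<in> carrier_mat N2' N1" using L' by simp
  define e where "e = pick J"
  have e: "bij_betw e {..<N2'} J" unfolding e_def N2' by (rule bij_betw_pick[OF fin])
  have colL': "col L' k = col L (e k)" if "k < N2'" for k
    unfolding L'_def inlier_mat_def J e_def by (rule col_select_cols[OF L JN]) (use that N2' in simp)
  define v where "v j = (\<lambda>a. if j \<in> J then V $$ (inv_into {..<N2'} e j, a) else 0)" for j
  have ve: "v (e k) = (\<lambda>a. V $$ (k, a))" if "k < N2'" for k
    using bij_betw_inv_into_left[OF e, of k] bij_betwE[OF e] that by (simp add: v_def)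
  have ex_e: "\<exists>k<N2'. j = e k" if "j \<in> J" for j using e that by (auto simp: bij_betw_def)
  have frame: "parseval_frame r {..<N2} v"
    unfolding parseval_frame_def
  proof (intro allI impI)
    fix a b assume ab: "a < r" "b < r"
    have "(\<Sum>j<N2. v j a * v j b) = (\<Sum>j\<in>J. v j a * v j b)"
      using JN by (intro sum.mono_neutral_right) (auto simp: v_def)
    also have "\<dots> = (\<Sum>k<N2'. v (e k) a * v (e k) b)"
      by (rule sum.reindex_bij_betw[OF e, symmetric])
    also have "\<dots> = (\<Sum>k<N2'. V $$ (k, a) * V $$ (k, b))" by (intro sum.cong) (simp_all add: ve)
    finally show "(\<Sum>j<N2. v j a * v j b) = (if a = b then 1 else 0)"
      unfolding orthonormal_entries[OF V onb ab] .
  qed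
  have pos: "0 < N2'"
    using orthonormal_entries[OF V onb, of 0 0] r by (cases "N2' = 0") simp_all
  have norm: "ip r (v (e k)) (v (e k)) \<le> r * \<mu> / N2'" if k: "k < N2'" for k
  proof -
    have d: "dim_row V = N2'" "dim_col V = r" using V by simp_all
    have "ip r (v (e k)) (v (e k)) = row V k \<bullet> row V k"
      using d k by (simp add: ve ip_def scalar_prod_def atLeast0LessThan)
    also have "\<dots> = (l2norm (row V k))\<^sup>2" by (simp add: l2norm_def scalar_prod_def sum_nonneg)
    also have "\<dots> \<le> Max ((\<lambda>i. (l2norm (row V i))\<^sup>2) ` {..<dim_row V})"
      using k d by (intro Max_ge) auto
    also have "\<dots> \<le> r * \<mu> / N2'" using \<mu> unfolding row_incoherent_def d .
    finally show ?thesis .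
  qed
  have norm_le: "ip r (v j) (v j) \<le> r * \<mu> / N2'" for j
  proof (cases "j \<in> J")
    case True
    then show ?thesis using ex_e norm by blast
  next
    \<comment> \<open>The bound is nonnegative because it already holds for an actual row of
      \<open>V\<close>.\<close>
    case False
    then have "ip r (v j) (v j) = 0" by (simp add: v_def ip_def)
    also have "\<dots> \<le> ip r (v (e 0)) (v (e 0))" by (rule ip_nonneg)
    also have "\<dots> \<le> r * \<mu> / N2'" by (rule norm[OF pos])
    finally show ?thesis .
  qed
  have rowspace: "rowspace L' = colspace V" using onb by (simp add: is_orthonormal_basis_def L'_def)
  have rowspace_t: "rowspace L' = colspace L'\<^sup>T" by (simp add: rowspace_def colspace_def)
  have "\<exists>x. x \<in> carrier_vec r \<and> row L' i = V *\<^sub>v x" if i: "i < N1" for i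
  proof -
    have "row L' i \<in> vspan N2' (set (rows L'))"
      by (rule vspan_mem) (use L' i rows_carrier[of L'] in \<open>auto simp: rows_def\<close>)
    then have "row L' i \<in> colspace V" using rowspace L' by (simp add: rowspace_def)
    then show ?thesis unfolding colspace_eq_range[OF V] by blast
  qed
  then obtain x where x: "\<And>i. i < N1 \<Longrightarrow> x i \<in> carrier_vec r" "\<And>i. i < N1 \<Longrightarrow> row L' i = V *\<^sub>v x i"
    by metis
  define X where "X = mat N1 r (\<lambda>(i, a). x i $ a)"
  have X: "X \<in> carrier_mat N1 r" by (simp add: X_def)
  have "\<exists>y. y \<in> carrier_vec N1 \<and> col V a = L'\<^sup>T *\<^sub>v y" if a: "a < r" for a
  proof -
    have "col V a \<in> colspace V"
      unfolding colspace_def by (rule vspan_mem) (use V a cols_dim[of V] in \<open>auto simp: cols_def\<close>)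
    then show ?thesis unfolding rowspace[symmetric] rowspace_t colspace_eq_range[OF L't] by blast
  qed
  then obtain y where y: "\<And>a. a < r \<Longrightarrow> y a \<in> carrier_vec N1" "\<And>a. a < r \<Longrightarrow> col V a = L'\<^sup>T *\<^sub>v y a"
    by metis
  define Y where "Y = mat r N1 (\<lambda>(a, i). y a $ i)"
  have Y: "Y \<in> carrier_mat r N1" by (simp add: Y_def)
  note dims = carrier_matD[OF V] carrier_matD[OF L'] carrier_matD[OF X] carrier_matD[OF Y]
  have colX: "col L j = X *\<^sub>v vec r (v j)" if "j \<in> J" for j
  proof -
    obtain k where k: "k < N2'" "j = e k" using ex_e \<open>j \<in> J\<close> by blast
    have "col L' k = X *\<^sub>v vec r (v (e k))"
    proof (rule eq_vecI)
      fix i assume "i < dim_vec (X *\<^sub>v vec r (v (e k)))"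
      then have i: "i < N1" using dims by simp
      have "col L' k $ i = row L' i $ k" using dims i k by simp
      also have "\<dots> = (\<Sum>a<r. V $$ (k, a) * x i $ a)"
        unfolding x(2)[OF i] using dims k x(1)[OF i] by (simp add: scalar_prod_def atLeast0LessThan)
      also have "\<dots> = (X *\<^sub>v vec r (v (e k))) $ i"
        using dims i k by (simp add: scalar_prod_def atLeast0LessThan X_def ve mult.commute)
      finally show "col L' k $ i = (X *\<^sub>v vec r (v (e k))) $ i" .
    qed (use dims in simp)
    then show ?thesis using colL'[OF k(1)] k(2) by simp
  qed
  have colY: "vec r (v j) = Y *\<^sub>v col L j" if "j \<in> J" for j
  proof -
    obtain k where k: "k < N2'" "j = e k" using ex_e \<open>j \<in> J\<close> by blast
    have "vec r (v (e k)) = Y *\<^sub>v col L' k"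
    proof (rule eq_vecI)
      fix a assume "a < dim_vec (Y *\<^sub>v col L' k)"
      then have a: "a < r" using dims by simp
      have "vec r (v (e k)) $ a = col V a $ k" using dims a k by (simp add: ve)
      also have "\<dots> = (\<Sum>i<N1. L' $$ (i, k) * y a $ i)"
        unfolding y(2)[OF a] using dims k y(1)[OF a] by (simp add: scalar_prod_def atLeast0LessThan)
      also have "\<dots> = (Y *\<^sub>v col L' k) $ a"
        using dims a k by (simp add: scalar_prod_def atLeast0LessThan Y_def mult.commute)
      finally show "vec r (v (e k)) $ a = (Y *\<^sub>v col L' k) $ a" .
    qed (use dims in simp)
    then show ?thesis using colL'[OF k(1)] k(2) by simp
  qed
  show thesis
    by (rule that[OF frame _ norm_le pos X Y colX colY]) (simp add: v_def)
qed

text \<open>With the complement equal to zero, \<open>v i\<close> is a combination of the sampled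
  coordinate vectors other than its own, and \<open>X\<close> maps this combination to the columns
  of \<open>L\<close>. The zeroed vector and the outliers contribute zero.\<close>

lemma spanning_of_perp_eq_0:
  assumes L: "L \<in> carrier_mat N1 N2" and X: "X \<in> carrier_mat N1 r"
    and v0: "\<And>j. j \<notin> J \<Longrightarrow> v j = (\<lambda>a. 0)" and colX: "\<And>j. j \<in> J \<Longrightarrow> col L j = X *\<^sub>v vec r (v j)"
    and 0: "perp r (map (omit i v) xs) = (\<lambda>a b. 0)" and i: "i \<in> J"
  shows "col L i \<in> vspan N1 (col L ` (set xs \<inter> J - {i}))"
proof -
  let ?S = "col L ` (set xs \<inter> J - {i})"
  have S: "?S \<subseteq> carrier_vec N1" by (rule col_range_carrier[OF L])
  let ?W = "\<lambda>f. X *\<^sub>v vec r f \<in> vspan N1 ?S"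
  have W0: "?W (\<lambda>a. 0)"
  proof -
    have "X *\<^sub>v vec r (\<lambda>a. 0) = 0\<^sub>v N1"
      using carrier_matD[OF X] by (intro eq_vecI) (simp_all add: scalar_prod_def)
    then show ?thesis using vspan_0[of N1 ?S] by (simp only:)
  qed
  have "?W (\<lambda>a. v i a - mv r (perp r (map (omit i v) xs)) (v i) a)"
  proof (rule mv_perp_range[of ?W])
    fix f g assume W: "?W f" "?W g"
    have "vec r (\<lambda>a. f a + g a) = vec r f + vec r g" by auto
    then have "X *\<^sub>v vec r (\<lambda>a. f a + g a) = X *\<^sub>v vec r f + X *\<^sub>v vec r g"
      using mult_add_distrib_mat_vec[OF X, of "vec r f" "vec r g"] by simp
    then show "?W (\<lambda>a. f a + g a)" using vspan_add[OF S W] by (simp only:)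
  next
    fix k f assume W: "?W f"
    have "vec r (\<lambda>a. k * f a) = k \<cdot>\<^sub>v vec r f" by auto
    then have "X *\<^sub>v vec r (\<lambda>a. k * f a) = k \<cdot>\<^sub>v (X *\<^sub>v vec r f)"
      using mult_mat_vec[OF X, of "vec r f" k] by simp
    then show "?W (\<lambda>a. k * f a)" using vspan_smult[OF S W] by (simp only:)
  next
    fix f g :: "nat \<Rightarrow> real" assume W: "?W f" and eq: "\<And>a. a < r \<Longrightarrow> f a = g a"
    have "vec r g = vec r f" using eq by auto
    then show "?W g" using W by (simp only:)
  next
    fix f assume "f \<in> set (map (omit i v) xs)"
    then obtain j where j: "j \<in> set xs" "f = omit i v j" by auto
    show "?W f"
    proof (cases "j = i \<or> j \<notin> J")
      case True
      then have "f = (\<lambda>a. 0)" unfolding j(2) omit_def using v0[of j] by (simp only: fun_upd_apply) auto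
      then show ?thesis using W0 by (simp only:)
    next
      case False
      then have "X *\<^sub>v vec r f = col L j" unfolding j(2) omit_def using colX[of j] by simp
      moreover have "col L j \<in> vspan N1 ?S" by (rule vspan_mem[OF S]) (use j(1) False in blast)
      ultimately show ?thesis by (simp only:)
    qed
  qed (rule W0)
  then show ?thesis unfolding 0 using colX[OF i] by (simp add: mv_def)
qed

text \<open>\<open>Y\<close> carries the relation expressing an inlier column by the other inlier
  columns over to the coordinate vectors; this is the coloop hypothesis of the leave-one-out
  bound.\<close>

lemma coloop_free_transfer:
  assumes L: "L \<in> carrier_mat N1 N2" and Y: "Y \<in> carrier_mat r N1"
    and v0: "\<And>j. j \<notin> J \<Longrightarrow> v j = (\<lambda>a. 0)" and colY: "\<And>j. j \<in> J \<Longrightarrow> vec r (v j) = Y *\<^sub>v col L j"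
    and span: "\<And>j. j \<in> J \<Longrightarrow> col L j \<in> vspan N1 (col L ` (J - {j}))"
    and P: "\<And>j. j \<in> J \<Longrightarrow> j \<noteq> i \<Longrightarrow> mv r P (v j) = (\<lambda>a. 0)"
  shows "mv r P (v i) = (\<lambda>a. 0)"
proof (cases "i \<in> J")
  case False
  then show ?thesis using v0 by simp
next
  case True
  have eq: "mv r P (vec_index (Y *\<^sub>v col L j)) = mv r P (v j)" if "j \<in> J" for j
    by (rule mv_cong) (simp add: colY[OF that, symmetric])
  have "mv r P (vec_index (Y *\<^sub>v col L i)) = (\<lambda>a. 0)"
    using col_range_carrier[OF L] span[OF True]
  proof (induction rule: vspan_induct)
    case zero
    have "mv r P (vec_index (Y *\<^sub>v 0\<^sub>v N1)) = mv r P (\<lambda>a. 0)"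
      by (rule mv_cong) (use carrier_matD[OF Y] in \<open>simp add: scalar_prod_def\<close>)
    then show ?case by simp
  next
    case (add x y)
    have "mv r P (vec_index (Y *\<^sub>v (x + y))) = mv r P (\<lambda>a. (Y *\<^sub>v x) $ a + (Y *\<^sub>v y) $ a)"
      unfolding mult_add_distrib_mat_vec[OF Y add(1,2)]
      by (rule mv_cong) (use carrier_matD[OF Y] in simp)
    also have "\<dots> = (\<lambda>a. mv r P (vec_index (Y *\<^sub>v x)) a + mv r P (vec_index (Y *\<^sub>v y)) a)"
      by (simp add: mv_def fun_eq_iff distrib_left sum.distrib)
    finally show ?case unfolding add(3,4) by simp
  next
    case (smult c x)
    have "mv r P (vec_index (Y *\<^sub>v (c \<cdot>\<^sub>v x))) = mv r P (\<lambda>a. c * (Y *\<^sub>v x) $ a)"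
      unfolding mult_mat_vec[OF Y smult(1)]
      by (rule mv_cong) (use carrier_matD[OF Y] in simp)
    also have "\<dots> = (\<lambda>a. c * mv r P (vec_index (Y *\<^sub>v x)) a)" by (rule mv_scale)
    finally show ?case unfolding smult(2) by simp
  next
    case (mem x)
    then obtain j where j: "j \<in> J" "j \<noteq> i" "x = col L j" by blast
    show ?case unfolding j(3) eq[OF j(1)] by (rule P[OF j(1,2)])
  qed
  then show ?thesis unfolding eq[OF True] .
qed

text \<open>The coefficient vector \<open>z\<close> is orthogonal to all sampled rows of
  \<open>U\<close>. These rows span, so \<open>z\<close> is a combination of them and orthogonal to
  itself.\<close>

lemma row_sampling_injective:
  assumes U: "U \<in> carrier_mat N r" and ys: "set ys \<subseteq> {..<N}"
    and 0: "perp r (map (\<lambda>j a. U $$ (j, a)) ys) = (\<lambda>a b. 0)"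
    and x: "x \<in> colspace U" and \<Phi>x: "row_sampling_mat N ys *\<^sub>v x = 0\<^sub>v (length ys)"
  shows "x = 0\<^sub>v N"
proof -
  note dims = carrier_matD[OF U]
  obtain z where z: "z \<in> carrier_vec r" "x = U *\<^sub>v z" using x unfolding colspace_eq_range[OF U] by blast
  have xc: "x \<in> carrier_vec N" unfolding z(2) by (rule mult_mat_vec_carrier[OF U z(1)])
  have orth: "ip r f (vec_index z) = 0" if f: "f \<in> set (map (\<lambda>j a. U $$ (j, a)) ys)" for f
  proof -
    obtain k where k: "k < length ys" "f = (\<lambda>a. U $$ (ys ! k, a))" using f by (auto simp: in_set_conv_nth)
    have "ys ! k < N" using k(1) ys by (auto dest: nth_mem)
    then have "ip r f (vec_index z) = x $ (ys ! k)"
      unfolding k(2) z(2) using dims z(1) by (simp add: ip_def scalar_prod_def atLeast0LessThan)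
    also have "\<dots> = (row_sampling_mat N ys *\<^sub>v x) $ k"
      by (rule row_sampling_mat_mult[OF xc k(1) ys, symmetric])
    also have "\<dots> = 0" unfolding \<Phi>x using k(1) by simp
    finally show ?thesis .
  qed
  have "ip r (\<lambda>a. z $ a - mv r (perp r (map (\<lambda>j a. U $$ (j, a)) ys)) (vec_index z) a) (vec_index z) = 0"
  proof (rule mv_perp_range[of "\<lambda>f. ip r f (vec_index z) = 0"])
    show "ip r (\<lambda>a. k * f a) (vec_index z) = 0" if "ip r f (vec_index z) = 0" for k f
      using that by (simp add: ip_def mult.assoc sum_distrib_left[symmetric])
  qed (simp_all add: ip_def distrib_right sum.distrib orth[unfolded ip_def])
  then have "\<forall>a<r. z $ a = 0" unfolding 0 using ip_self_eq_0[of r "vec_index z"] by (simp add: mv_def)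
  then have "z = 0\<^sub>v r" using z(1) by (intro eq_vecI) auto
  then show ?thesis unfolding z(2) using dims by (intro eq_vecI) (simp_all add: scalar_prod_def)
qed

section \<open>Numerical estimates for the sample sizes\<close>

lemma power_le_exp_minus:
  fixes x :: real
  assumes "0 \<le> 1 - x" shows "(1 - x) ^ k \<le> exp (- (k * x))"
proof -
  have "1 - x \<le> exp (- x)" using exp_ge_add_one_self[of "- x"] by simp
  then have "(1 - x) ^ k \<le> exp (- x) ^ k" using assms by (rule power_mono)
  then show ?thesis by (simp add: exp_of_nat_mult[symmetric])
qed

text \<open>Each block has at least m1/4 draws, enough for
  \<open>\<rho> ^ h \<le> \<epsilon> ^ 3\<close>. Two of the three factors \<epsilon> absorb the
  square of \<open>r\<close> from the union bound, since
  \<open>r * \<epsilon> = \<delta> / 4\<close>, and the third supplies \<delta>.\<close>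

lemma leave_one_out_bound:
  fixes r :: nat and S \<delta> \<rho> :: real
  assumes r: "1 \<le> r" and \<delta>: "0 < \<delta>" "\<delta> < 1 / 6" and S: "1 \<le> S"
    and m1: "real m1 \<ge> 40 * S * ln (4 * r / \<delta>)"
  defines "\<rho> \<equiv> 1 - 1 / (2 * S)"
  shows "r * \<rho> ^ (m1 div 2) + r * (r * \<rho> ^ (m1 - m1 div 2)) \<le> \<delta>"
proof -
  define l where "l = ln (4 * r / \<delta>)"
  define \<epsilon> where "\<epsilon> = \<delta> / (4 * r)"
  have r1: "1 \<le> real r" using r by simp
  have \<epsilon>: "0 < \<epsilon>" "\<epsilon> \<le> \<delta>" using \<delta> r1 by (simp_all add: \<epsilon>_def field_simps)
  have expl: "exp (- l) = \<epsilon>" using \<delta> r1 by (simp add: l_def \<epsilon>_def exp_minus)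
  have "exp 1 \<le> (4 * r / \<delta> :: real)"
  proof -
    have "exp 1 \<le> (3::real)" using exp_le by simp
    also have "3 \<le> 4 * r / \<delta>" using \<delta> r1 by (simp add: field_simps)
    finally show ?thesis .
  qed
  then have l1: "1 \<le> l" unfolding l_def using \<delta> r1 by (subst ln_ge_iff) auto
  have "40 * 1 * 1 \<le> 40 * S * l" using S l1 by (intro mult_mono) auto
  \<comment> \<open>A lower bound on m1 is needed for the integer half to be at least a
    quarter.\<close>
  then have m40: "40 \<le> real m1" using m1 unfolding l_def by linarith
  define h where "h = m1 div 2"
  have h: "real m1 / 4 \<le> real h" and hk: "h \<le> m1 - h" using m40 unfolding h_def by linarith+
  have \<rho>: "0 \<le> \<rho>" "\<rho> \<le> 1" using S by (simp_all add: \<rho>_def field_simps)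
  have "3 * l \<le> real h * (1 / (2 * S))"
  proof -
    have "10 * S * l \<le> real h" using h m1 unfolding l_def by linarith
    moreover have "0 \<le> S * l" using S l1 by simp
    ultimately have "6 * (S * l) \<le> real h" by linarith
    then show ?thesis using S by (simp add: field_simps)
  qed
  then have "\<rho> ^ h \<le> exp (- (3 * l))"
    using power_le_exp_minus[of "1 / (2 * S)" h] \<rho> unfolding \<rho>_def by (intro order_trans[OF power_le_exp_minus]) auto
  also have "exp (- (3 * l)) = exp (- l) ^ 3" by (simp add: exp_of_nat_mult[symmetric])
  finally have \<rho>h: "\<rho> ^ h \<le> \<epsilon> ^ 3" unfolding expl .
  have "\<rho> ^ (m1 - h) \<le> \<rho> ^ h" using \<rho> hk by (intro power_decreasing) auto
  then have "r * \<rho> ^ h + r * (r * \<rho> ^ (m1 - h)) \<le> r * \<epsilon> ^ 3 + r * (r * \<epsilon> ^ 3)"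
    using \<rho>h by (intro add_mono mult_left_mono) auto
  also have "\<dots> \<le> r * (r * \<epsilon> ^ 3) + r * (r * \<epsilon> ^ 3)"
    using r1 \<epsilon>(1) by (intro add_mono mult_left_mono) (auto simp: mult_le_cancel_right1)
  also have "\<dots> = 2 * (r * \<epsilon>)\<^sup>2 * \<epsilon>" by (simp add: power2_eq_square power3_eq_cube)
  also have "r * \<epsilon> = \<delta> / 4" using r1 by (simp add: \<epsilon>_def)
  also have "2 * (\<delta> / 4)\<^sup>2 * \<epsilon> \<le> 1 * \<delta>"
  proof (rule mult_mono)
    have "(\<delta> / 4)\<^sup>2 \<le> (1 / 2)\<^sup>2" using \<delta> by (intro power_mono) auto
    then show "2 * (\<delta> / 4)\<^sup>2 \<le> 1" by (simp add: power2_eq_square)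
  qed (use \<epsilon> in auto)
  finally show ?thesis unfolding h_def by simp
qed

text \<open>The Chernoff exponent is bounded through
  \<open>exp \<theta> - 1 \<le> \<theta> + \<theta>\<^sup>2\<close> on the unit interval. For
  \<open>a \<le> q\<close> the choice \<open>sqrt (a / q)\<close> makes the quadratic term equal to
  \<open>a\<close>, while the square root in the threshold gains at least 2a. For
  \<open>q < a\<close> the choice 1 suffices, as 2a outweighs \<open>q + a\<close>.\<close>

lemma many_outliers_bound:
  fixes q a M :: real
  assumes q: "M \<le> q" "0 \<le> M" and a: "0 < a"
  obtains \<theta> where "0 \<le> \<theta>" "exp (M * (exp \<theta> - 1) - \<theta> * (q + 2 * a + sqrt (8 * q * a))) \<le> exp (- a)"
proof -
  define s where "s = sqrt (8 * q * a)"
  have s0: "0 \<le> s" using q a by (simp add: s_def)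
  have *: "M * (exp \<theta> - 1) - \<theta> * (q + 2 * a + s) \<le> q * \<theta>\<^sup>2 - 2 * a * \<theta> - \<theta> * s"
    if \<theta>: "0 \<le> \<theta>" "\<theta> \<le> 1" for \<theta>
  proof -
    have "exp \<theta> - 1 \<le> \<theta> + \<theta>\<^sup>2" using exp_bound[OF \<theta>] by simp
    then have "M * (exp \<theta> - 1) \<le> q * (\<theta> + \<theta>\<^sup>2)" using q \<theta> by (intro mult_mono) auto
    then show ?thesis by (simp add: algebra_simps)
  qed
  show thesis
  proof (cases "a \<le> q")
    case True
    define \<theta> where "\<theta> = sqrt (a / q)"
    have q0: "0 < q" using a True by simp
    have \<theta>: "0 \<le> \<theta>" "\<theta> \<le> 1" using True q0 a by (simp_all add: \<theta>_def)
    have "\<theta>\<^sup>2 = a / q" using a q0 by (simp add: \<theta>_def)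
    then have "q * \<theta>\<^sup>2 = a" using q0 by simp
    moreover have "2 * a \<le> \<theta> * s"
    proof -
      have "\<theta> * s = sqrt (a / q * (8 * q * a))" unfolding \<theta>_def s_def by (rule real_sqrt_mult[symmetric])
      also have "a / q * (8 * q * a) = 8 * a\<^sup>2" using q0 by (simp add: power2_eq_square)
      finally have eq: "\<theta> * s = sqrt (8 * a\<^sup>2)" .
      show ?thesis unfolding eq using a by (intro real_le_rsqrt) (simp add: power_mult_distrib)
    qed
    moreover have "0 \<le> 2 * a * \<theta>" using a \<theta> by simp
    ultimately have "M * (exp \<theta> - 1) - \<theta> * (q + 2 * a + s) \<le> - a" using *[OF \<theta>] by linarith
    then show thesis using that[OF \<theta>(1)] by (simp add: s_def)
  next
    case False
    then have "M * (exp 1 - 1) - 1 * (q + 2 * a + s) \<le> - a" using *[of 1] s0 by simp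
    then show thesis using that[of 1] by (simp add: s_def)
  qed
qed

text \<open>The constants 2 let the maximum dominate the sum of the two logarithms: one cancels the
  initial trace \<open>r\<close>, the other brings the product down to \<delta>/3.\<close>

lemma row_sampling_bound:
  fixes r :: nat and \<delta> S :: real
  assumes r: "1 \<le> r" and \<delta>: "0 < \<delta>" "\<delta> < 1 / 6" and S: "1 \<le> S"
    and m2: "real m2 \<ge> S * max (2 * ln r) (2 * ln (3 / \<delta>))"
  shows "r * (1 - 1 / S) ^ m2 \<le> \<delta>"
proof -
  have r1: "1 \<le> real r" using r by simp
  have "S * (ln r + ln (3 / \<delta>)) \<le> S * max (2 * ln r) (2 * ln (3 / \<delta>))"
    using S by (intro mult_left_mono) auto
  then have "ln r + ln (3 / \<delta>) \<le> real m2 * (1 / S)"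
    using m2 S by (simp add: field_simps)
  moreover have "(1 - 1 / S) ^ m2 \<le> exp (- (m2 * (1 / S)))"
    using S by (intro power_le_exp_minus) (simp add: field_simps)
  ultimately have "(1 - 1 / S) ^ m2 \<le> exp (- (ln r + ln (3 / \<delta>)))"
    by (smt (verit) exp_le_cancel_iff)
  also have "\<dots> = 1 / r * (\<delta> / 3)" using r1 \<delta> by (simp add: exp_minus exp_add exp_diff field_simps)
  finally have "r * (1 - 1 / S) ^ m2 \<le> r * (1 / r * (\<delta> / 3))" by (intro mult_left_mono) auto
  also have "\<dots> \<le> \<delta>" using r1 \<delta> by simp
  finally show ?thesis .
qed

section \<open>The recovery guarantee\<close>

lemma pred_count_space: "Measurable.pred (count_space UNIV) P"
  unfolding pred_def by simp

text \<open>The rectangle over \<open>A\<close> and \<open>B\<close> has the product probability,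
  and \<open>Q\<close> holds almost everywhere on it. The list components are countable, so joint
  measurability follows from measurability in the noise for each fixed pair.\<close>

lemma prob_triple_product_ge:
  fixes p :: "'a::countable pmf" and q :: "'b::countable pmf" and G :: "'c measure"
  assumes G: "prob_space G"
    and Q: "\<And>x y. Measurable.pred G (Q x y)"
    and AE: "\<And>x y. x \<in> A \<Longrightarrow> y \<in> B \<Longrightarrow> AE g in G. Q x y g"
  shows "measure_pmf.prob p A * measure_pmf.prob q B \<le>
    \<P>((x, y, g) in measure_pmf p \<Otimes>\<^sub>M (measure_pmf q \<Otimes>\<^sub>M G). Q x y g)"
proof -
  let ?M = "measure_pmf p \<Otimes>\<^sub>M (measure_pmf q \<Otimes>\<^sub>M G)"
  interpret G: prob_space G by (rule G)
  interpret qG: pair_prob_space "measure_pmf q" G by standard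
  interpret pqG: pair_prob_space "measure_pmf p" "measure_pmf q \<Otimes>\<^sub>M G" by standard
  have sets1: "sets (measure_pmf q \<Otimes>\<^sub>M G) = sets (count_space UNIV \<Otimes>\<^sub>M G)"
    by (rule sets_pair_measure_cong) simp_all
  have sets2: "sets ?M = sets (count_space UNIV \<Otimes>\<^sub>M (count_space UNIV \<Otimes>\<^sub>M G))"
    by (rule sets_pair_measure_cong[OF _ sets1]) simp
  have Q1: "Measurable.pred (count_space UNIV \<Otimes>\<^sub>M G) (\<lambda>z. Q x (fst z) (snd z))" for x
    by (rule measurable_pair_measure_countable1) (use Q in simp_all)
  have Q2: "Measurable.pred (count_space UNIV \<Otimes>\<^sub>M (count_space UNIV \<Otimes>\<^sub>M G)) (\<lambda>z. Q (fst z) (fst (snd z)) (snd (snd z)))"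
    by (rule measurable_pair_measure_countable1) (use Q1 in simp_all)
  have R1: "Measurable.pred (measure_pmf q \<Otimes>\<^sub>M G) (\<lambda>z. x \<in> A \<and> fst z \<in> B \<longrightarrow> Q x (fst z) (snd z))" for x
    unfolding measurable_cong_sets[OF sets1 refl]
    by (intro pred_intros_logic Q1 measurable_compose[OF measurable_fst pred_count_space])
  have R2: "Measurable.pred ?M (\<lambda>z. fst z \<in> A \<and> fst (snd z) \<in> B \<longrightarrow> Q (fst z) (fst (snd z)) (snd (snd z)))"
    unfolding measurable_cong_sets[OF sets2 refl]
    by (intro pred_intros_logic Q2 measurable_compose[OF measurable_fst pred_count_space]
        measurable_compose[OF measurable_compose[OF measurable_snd measurable_fst] pred_count_space])
  have "AE z in ?M. fst z \<in> A \<and> fst (snd z) \<in> B \<longrightarrow> Q (fst z) (fst (snd z)) (snd (snd z))"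
  proof (rule pqG.AE_pair_measure)
    show "{z \<in> space ?M. fst z \<in> A \<and> fst (snd z) \<in> B \<longrightarrow> Q (fst z) (fst (snd z)) (snd (snd z))} \<in> sets ?M"
      using R2 by (rule predE)
    have "AE z in measure_pmf q \<Otimes>\<^sub>M G. x \<in> A \<and> fst z \<in> B \<longrightarrow> Q x (fst z) (snd z)" for x
    proof (rule qG.AE_pair_measure)
      show "{z \<in> space (measure_pmf q \<Otimes>\<^sub>M G). x \<in> A \<and> fst z \<in> B \<longrightarrow> Q x (fst z) (snd z)} \<in> sets (measure_pmf q \<Otimes>\<^sub>M G)"
        using R1 by (rule predE)
      have "AE g in G. x \<in> A \<and> y \<in> B \<longrightarrow> Q x y g" for y
        using AE[of x y] by (cases "x \<in> A \<and> y \<in> B") auto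
      then show "AE y in measure_pmf q. AE g in G. x \<in> A \<and> fst (y, g) \<in> B \<longrightarrow> Q x (fst (y, g)) (snd (y, g))"
        by simp
    qed
    then show "AE x in measure_pmf p. AE y in measure_pmf q \<Otimes>\<^sub>M G.
        fst (x, y) \<in> A \<and> fst (snd (x, y)) \<in> B \<longrightarrow> Q (fst (x, y)) (fst (snd (x, y))) (snd (snd (x, y)))"
      by simp
  qed
  then have ae: "AE z in ?M. z \<in> A \<times> (B \<times> space G) \<longrightarrow> z \<in> {z \<in> space ?M. Q (fst z) (fst (snd z)) (snd (snd z))}"
    by eventually_elim (auto simp: space_pair_measure)
  have BG: "B \<times> space G \<in> sets (measure_pmf q \<Otimes>\<^sub>M G)" by (rule pair_measureI) simp_all
  have "emeasure ?M (A \<times> (B \<times> space G)) = emeasure (measure_pmf p) A * (emeasure (measure_pmf q) B * emeasure G (space G))"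
    by (subst qG.P.emeasure_pair_measure_Times[OF _ BG], simp, subst G.emeasure_pair_measure_Times) simp_all
  then have eq: "measure ?M (A \<times> (B \<times> space G)) = measure_pmf.prob p A * measure_pmf.prob q B"
    by (simp add: G.emeasure_space_1 measure_def enn2real_mult)
  have "measure ?M (A \<times> (B \<times> space G)) \<le> measure ?M {z \<in> space ?M. Q (fst z) (fst (snd z)) (snd (snd z))}"
  proof (rule pqG.P.finite_measure_mono_AE[OF ae])
    have "Measurable.pred ?M (\<lambda>z. Q (fst z) (fst (snd z)) (snd (snd z)))"
      unfolding measurable_cong_sets[OF sets2 refl] by (rule Q2)
    then show "{z \<in> space ?M. Q (fst z) (fst (snd z)) (snd (snd z))} \<in> sets ?M" by (rule predE)
  qed
  then show ?thesis unfolding eq by (simp add: case_prod_unfold)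
qed

lemma prob_compl_ge:
  assumes "measure_pmf.prob p (- A) \<le> \<epsilon>" shows "1 - \<epsilon> \<le> measure_pmf.prob p A"
  using assms measure_pmf.prob_compl[of A p] by (simp add: Compl_eq_Diff_UNIV)

lemma measurable_mat_outlier_mat:
  assumes \<sigma>: "0 < \<sigma>"
  shows "measurable_mat (noise_law N1 I \<sigma>) N1 N2 (outlier_mat N1 N2 I)"
  unfolding measurable_mat_def
proof (intro conjI allI impI)
  fix i j assume ij: "i < N1" "j < N2"
  show "(\<lambda>g. outlier_mat N1 N2 I g $$ (i, j)) \<in> borel_measurable (noise_law N1 I \<sigma>)"
  proof (cases "j \<in> I")
    case True
    then have "(\<lambda>g. g (i, j)) \<in> measurable (noise_law N1 I \<sigma>) (gaussian \<sigma>)"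
      unfolding noise_law_def gaussian_def[symmetric] using ij by (intro measurable_component_singleton) simp
    then show ?thesis using ij True by (simp add: outlier_mat_def measurable_cong_sets[OF refl sets_gaussian])
  qed (use ij in \<open>simp add: outlier_mat_def\<close>)
qed (rule outlier_mat_carrier)

lemma AE_rrd_success:
  assumes \<sigma>: "0 < \<sigma>" and I: "I \<subseteq> {..<N2}" and L: "L \<in> carrier_mat N1 N2"
    and LI: "\<And>i. i \<in> I \<Longrightarrow> col L i = 0\<^sub>v N1"
    and U: "U \<in> carrier_mat N1 r" and UL: "colspace U = colspace L"
    and xs: "set xs \<subseteq> {..<N2}"
    and spanning: "\<And>i. i \<in> {..<N2} - I \<Longrightarrow> col L i \<in> vspan N1 (col L ` (set xs - I - {i}))"
    and ys: "distinct ys" "set ys \<subseteq> {..<N1}" "perp r (map (\<lambda>j a. U $$ (j, a)) ys) = (\<lambda>a b. 0)"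
    and len: "r + card (set xs \<inter> I) \<le> length ys" "r < length ys"
  shows "AE g in noise_law N1 I \<sigma>. rrd_success L (outlier_mat N1 N2 I g) xs ys"
proof -
  define \<Phi> where "\<Phi> = row_sampling_mat N1 ys"
  have finI: "finite I" using I by (rule finite_subset) simp
  have "AE g in noise_law N1 I \<sigma>. \<forall>i\<in>set xs \<inter> I. \<Phi> *\<^sub>v col (outlier_mat N1 N2 I g) i \<notin>
      vspan (length ys) ((\<lambda>x. \<Phi> *\<^sub>v x) ` colspace U \<union> (\<lambda>j. \<Phi> *\<^sub>v col (outlier_mat N1 N2 I g) j) ` (set xs \<inter> I - {i}))"
  proof (rule AE_finite_allI)
    fix i assume i: "i \<in> set xs \<inter> I"
    \<comment> \<open>Leaving out \<open>i\<close> itself turns the weak inequality in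
      \<open>len\<close> into the strict one that the span lemma demands.\<close>
    have "card (set xs \<inter> I - {i}) < card (set xs \<inter> I)" using i by (intro card_Diff1_less) simp_all
    then have "r + card (set xs \<inter> I - {i}) < length ys" using len by simp
    then show "AE g in noise_law N1 I \<sigma>. \<Phi> *\<^sub>v col (outlier_mat N1 N2 I g) i \<notin>
      vspan (length ys) ((\<lambda>x. \<Phi> *\<^sub>v x) ` colspace U \<union> (\<lambda>j. \<Phi> *\<^sub>v col (outlier_mat N1 N2 I g) j) ` (set xs \<inter> I - {i}))"
      unfolding \<Phi>_def by (intro AE_outlier_not_in_span[OF \<sigma> I _ _ ys(1,2) U]) (use i in auto)
  qed simp
  \<comment> \<open>The empty family handles all outliers, including those never sampled; locating
    the nonzero columns of H requires this.\<close>
  moreover have "AE g in noise_law N1 I \<sigma>. \<forall>i\<in>I. \<Phi> *\<^sub>v col (outlier_mat N1 N2 I g) i \<notin>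
      vspan (length ys) ((\<lambda>x. \<Phi> *\<^sub>v x) ` colspace U \<union> (\<lambda>j. \<Phi> *\<^sub>v col (outlier_mat N1 N2 I g) j) ` {})"
    unfolding \<Phi>_def
    by (intro AE_finite_allI[OF finI] AE_outlier_not_in_span[OF \<sigma> I _ _ ys(1,2) U]) (use len in auto)
  ultimately show ?thesis
  proof eventually_elim
    case (elim g)
    let ?C = "outlier_mat N1 N2 I g"
    have Lc: "x \<in> carrier_vec N1" if "x \<in> colspace L" for x
      using that vspan_carrier[of "set (cols L)" N1 x] cols_dim[of L] carrier_matD[OF L]
      unfolding colspace_def by simp
    have \<Phi>c: "(\<lambda>x. \<Phi> *\<^sub>v x) ` colspace L \<subseteq> carrier_vec (length ys)"
      using mult_mat_vec_carrier[OF row_sampling_mat_carrier Lc] unfolding \<Phi>_def by blast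
    show ?case
    proof (rule rrd_success_sufficient[OF L outlier_mat_carrier I LI _ xs \<Phi>_def refl spanning])
      show "col ?C j = 0\<^sub>v N1" if "j < N2" "j \<notin> I" for j
        using that by (intro eq_vecI) (simp_all add: outlier_mat_def)
      show "x = 0\<^sub>v N1" if "x \<in> colspace L" "\<Phi> *\<^sub>v x = 0\<^sub>v (length ys)" for x
        by (rule row_sampling_injective[OF U ys(2,3)]) (use that in \<open>simp_all add: UL \<Phi>_def\<close>)
      show "\<Phi> *\<^sub>v col ?C i \<notin> vspan (length ys) ((\<lambda>x. \<Phi> *\<^sub>v x) ` colspace L \<union> (\<lambda>j. \<Phi> *\<^sub>v col ?C j) ` (set xs \<inter> I - {i}))"
        if "i \<in> set xs \<inter> I" for i
        using elim(1) that unfolding UL by blast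
      show "\<Phi> *\<^sub>v col ?C i \<notin> (\<lambda>x. \<Phi> *\<^sub>v x) ` colspace L" if "i \<in> I" for i
      proof
        assume "\<Phi> *\<^sub>v col ?C i \<in> (\<lambda>x. \<Phi> *\<^sub>v x) ` colspace L"
        then have "\<Phi> *\<^sub>v col ?C i \<in> vspan (length ys) ((\<lambda>x. \<Phi> *\<^sub>v x) ` colspace L)"
          by (rule vspan_mem[OF \<Phi>c])
        moreover have "\<Phi> *\<^sub>v col ?C i \<notin> vspan (length ys) ((\<lambda>x. \<Phi> *\<^sub>v x) ` colspace L)"
          using elim(2) that unfolding UL image_empty Un_empty_right by blast
        ultimately show False by (rule notE[rotated])
      qed
    qed
  qed
qed

text \<open>Chernoff's method: each draw multiplies the exponential moment by \<open>\<rho>\<close>,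
  which is at most \<open>exp (card I / card A * (exp \<theta> - 1))\<close>.\<close>

lemma prob_many_hits:
  fixes \<theta> t :: real
  assumes A: "finite A" "A \<noteq> {}" and I: "I \<subseteq> A" and \<theta>: "0 \<le> \<theta>"
  shows "measure_pmf.prob (replicate_pmf k (pmf_of_set A)) {xs. t \<le> length (filter (\<lambda>x. x \<in> I) xs)}
    \<le> exp (k * card I / card A * (exp \<theta> - 1) - \<theta> * t)"
proof -
  define \<rho> where "\<rho> = 1 + card I / card A * (exp \<theta> - 1)"
  have cA: "0 < real (card A)" using A by (simp add: card_gt_0_iff)
  have \<rho>0: "0 \<le> \<rho>" using \<theta> by (simp add: \<rho>_def)
  let ?f = "\<lambda>xs. exp (\<theta> * length (filter (\<lambda>x. x \<in> I) xs))"
  have "measure_pmf.prob (replicate_pmf k (pmf_of_set A)) {xs. t \<le> length (filter (\<lambda>x. x \<in> I) xs)} \<le>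
     measure_pmf.prob (replicate_pmf k (pmf_of_set A)) {xs. exp (\<theta> * t) \<le> ?f xs}"
    using \<theta> by (intro measure_pmf.finite_measure_mono) (auto intro: mult_left_mono)
  also have "\<dots> \<le> \<rho> ^ k * ?f [] / exp (\<theta> * t)"
  proof (rule prob_replicate_pmf_le[OF A _ \<rho>0])
    fix xs
    have "(\<Sum>x\<in>A. ?f (x # xs)) = (\<Sum>x\<in>A. ?f xs * (1 + (if x \<in> I then exp \<theta> - 1 else 0)))"
      by (intro sum.cong) (auto simp: exp_add[symmetric] algebra_simps)
    also have "\<dots> = ?f xs * (card A + card (A \<inter> I) * (exp \<theta> - 1))"
      using A by (simp add: sum_distrib_left[symmetric] sum.distrib sum.If_cases)
    also have "A \<inter> I = I" using I by auto
    finally have eq: "(\<Sum>x\<in>A. ?f (x # xs)) = ?f xs * (card A + card I * (exp \<theta> - 1))" .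
    show "(\<Sum>x\<in>A. ?f (x # xs)) \<le> card A * \<rho> * ?f xs"
      unfolding eq \<rho>_def using cA by (simp add: field_simps)
  qed auto
  also have "\<dots> \<le> exp (card I / card A * (exp \<theta> - 1)) ^ k / exp (\<theta> * t)"
    using exp_ge_add_one_self[of "card I / card A * (exp \<theta> - 1)"] \<rho>0
    by (intro divide_right_mono) (auto simp: \<rho>_def intro!: power_mono)
  also have "\<dots> = exp (k * card I / card A * (exp \<theta> - 1) - \<theta> * t)"
    by (simp add: exp_of_nat_mult[symmetric] exp_diff algebra_simps)
  finally show ?thesis .
qed

text \<open>The bound splits into \<delta> for an omission that destroys spanning and \<delta> for
  more distinct outliers than the rows can separate.\<close>

lemma prob_bad_columns:
  fixes B :: real
  assumes r: "1 \<le> r" and K: "1 \<le> K" and N2: "N2 = K + N2'" and N2': "0 < N2'"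
    and I: "I \<subseteq> {..<N2}" "card I = K"
    and v: "parseval_frame r {..<N2} v" and B: "\<And>j. ip r (v j) (v j) \<le> B"
    and coloop: "\<And>i P. is_proj r P \<Longrightarrow> (\<And>j. j \<in> {..<N2} \<Longrightarrow> j \<noteq> i \<Longrightarrow> mv r P (v j) = (\<lambda>a. 0)) \<Longrightarrow> mv r P (v i) = (\<lambda>a. 0)"
    and \<delta>: "0 < \<delta>" "\<delta> < 1 / 6" and m1: "real m1 \<ge> 40 * (N2 * B) * ln (4 * real r / \<delta>)"
    and q: "min (real m1 * real K / real N2) (real K) \<le> q"
    and m2: "real m2 \<ge> r + q + 2 * ln (2 / \<delta>) + sqrt (8 * q * ln (2 / \<delta>))"
  shows "measure_pmf.prob (col_draws N2 m1) (- {xs. set xs \<subseteq> {..<N2} \<and>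
    (\<forall>i. perp r (map (omit i v) xs) = (\<lambda>a b. 0)) \<and> r + card (set xs \<inter> I) \<le> m2}) \<le> 2 * \<delta>"
proof -
  define S where "S = N2 * B"
  define a where "a = ln (2 / \<delta>)"
  let ?A = "{..<N2}"
  let ?p = "replicate_pmf m1 (pmf_of_set ?A)"
  have A: "finite ?A" "?A \<noteq> {}" using N2 K by auto
  have N20: "0 < real N2" using N2 K by simp
  have "real r \<le> S" using parseval_frame_le_card[OF v A(1) B] by (simp add: S_def)
  then have S: "1 \<le> S" using r by simp
  define X1 where "X1 = {xs. \<exists>i. perp r (map (omit i v) xs) \<noteq> (\<lambda>a b. 0)}"
  have "measure_pmf.prob (replicate_pmf (m1 div 2 + (m1 - m1 div 2)) (pmf_of_set ?A)) X1 \<le>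
      r * (1 - 1 / (2 * B) / card ?A) ^ (m1 div 2) + r * (r * (1 - 1 / (2 * B) / card ?A) ^ (m1 - m1 div 2))"
    unfolding X1_def by (rule prob_leave_one_out[OF v A B _ coloop]) (use S in \<open>simp_all add: S_def\<close>)
  also have "1 - 1 / (2 * B) / card ?A = 1 - 1 / (2 * S)" by (simp add: S_def)
  also have "r * (1 - 1 / (2 * S)) ^ (m1 div 2) + r * (r * (1 - 1 / (2 * S)) ^ (m1 - m1 div 2)) \<le> \<delta>"
    by (rule leave_one_out_bound[OF r \<delta> S]) (use m1 in \<open>simp add: S_def\<close>)
  finally have X1: "measure_pmf.prob ?p X1 \<le> \<delta>" by simp
  define X2 where "X2 = {xs. \<not> r + card (set xs \<inter> I) \<le> m2}"
  have a0: "0 < a" using \<delta> by (simp add: a_def)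
  have "0 \<le> min (real m1 * real K / real N2) (real K)" by simp
  then have q0: "0 \<le> q" using q by (rule order_trans)
  have sq: "0 \<le> sqrt (8 * q * a)" using q0 a0 by simp
  have X2: "measure_pmf.prob ?p X2 \<le> \<delta>"
  \<comment> \<open>The minimum in \<open>q\<close> decides the argument: either all outliers
    together fit below the threshold, or \<open>q\<close> bounds the expected number of outlier
    draws and Chernoff's bound applies.\<close>
  proof (cases "real K \<le> q")
    case True
    have "finite I" using I(1) by (rule finite_subset) simp
    then have "card (set xs \<inter> I) \<le> K" for xs
      unfolding I(2)[symmetric] by (rule card_mono) simp
    moreover have "real r + real K \<le> real m2"
      using True m2 a0 sq unfolding a_def by linarith
    then have "r + K \<le> m2" by linarith
    ultimately have "r + card (set xs \<inter> I) \<le> m2" for xs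
      by (rule order_trans[OF add_left_mono])
    then have "X2 = {}" by (simp add: X2_def)
    then show ?thesis using \<delta> by simp
  next
    case False
    define M where "M = real m1 * card I / card ?A"
    have M: "M \<le> q" "0 \<le> M" using q False I by (auto simp: M_def min_def split: if_splits)
    from many_outliers_bound[OF M a0] obtain \<theta> where
      \<theta>: "0 \<le> \<theta>" "exp (M * (exp \<theta> - 1) - \<theta> * (q + 2 * a + sqrt (8 * q * a))) \<le> exp (- a)" by blast
    have "X2 \<subseteq> {xs. q + 2 * a + sqrt (8 * q * a) \<le> length (filter (\<lambda>x. x \<in> I) xs)}"
    proof
      fix xs assume "xs \<in> X2"
      then have "m2 < r + card (set xs \<inter> I)" by (simp add: X2_def)
      moreover have "set xs \<inter> I = set (filter (\<lambda>x. x \<in> I) xs)" by auto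
      \<comment> \<open>Repeated draws of an outlier count once in the sample, so the number of
        draws dominates.\<close>
      then have "card (set xs \<inter> I) \<le> length (filter (\<lambda>x. x \<in> I) xs)" by (metis card_length)
      ultimately have "real m2 \<le> real r + real (length (filter (\<lambda>x. x \<in> I) xs))" by linarith
      then show "xs \<in> {xs. q + 2 * a + sqrt (8 * q * a) \<le> length (filter (\<lambda>x. x \<in> I) xs)}"
        using m2 unfolding a_def by simp
    qed
    then have "measure_pmf.prob ?p X2 \<le>
        measure_pmf.prob ?p {xs. q + 2 * a + sqrt (8 * q * a) \<le> length (filter (\<lambda>x. x \<in> I) xs)}"
      by (intro measure_pmf.finite_measure_mono) auto
    also have "\<dots> \<le> exp (- a)"
      using prob_many_hits[OF A I(1) \<theta>(1), of m1 "q + 2 * a + sqrt (8 * q * a)"] \<theta>(2)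
      unfolding M_def of_nat_mult by (rule order_trans)
    also have "exp (- a) = \<delta> / 2" using \<delta> by (simp add: a_def exp_minus)
    finally show ?thesis using \<delta> by simp
  qed
  have "measure_pmf.prob ?p (- {xs. set xs \<subseteq> ?A \<and> (\<forall>i. perp r (map (omit i v) xs) = (\<lambda>a b. 0)) \<and>
      r + card (set xs \<inter> I) \<le> m2}) \<le> measure_pmf.prob ?p (X1 \<union> X2)"
  proof (rule measure_pmf.finite_measure_mono_AE)
    have supp: "set_pmf ?p = {xs \<in> lists ?A. length xs = m1}"
      unfolding set_replicate_pmf set_pmf_of_set[OF A(2,1)] ..
    show "AE xs in measure_pmf ?p. xs \<in> - {xs. set xs \<subseteq> ?A \<and> (\<forall>i. perp r (map (omit i v) xs) = (\<lambda>a b. 0)) \<and>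
      r + card (set xs \<inter> I) \<le> m2} \<longrightarrow> xs \<in> X1 \<union> X2"
      unfolding AE_measure_pmf_iff supp X1_def X2_def lists_eq_set by blast
  qed simp
  also have "\<dots> \<le> measure_pmf.prob ?p X1 + measure_pmf.prob ?p X2"
    by (rule measure_Un_le) simp_all
  finally show ?thesis using X1 X2 unfolding col_draws_def by linarith
qed

text \<open>If x is the largest absolute entry of \<open>U\<close>, each row has squared length at
  most \<open>B = r * x\<^sup>2\<close>. As \<open>(eta_param U)\<^sup>2 = N1 * x\<^sup>2\<close>,
  the quantity governing the contraction, \<open>N1 * B\<close>, is exactly
  \<open>r * (eta_param U)\<^sup>2\<close>.\<close>

lemma prob_bad_rows:
  assumes r: "1 \<le> r" and U: "U \<in> carrier_mat N1 r" and onb: "is_orthonormal_basis U W"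
    and \<delta>: "0 < \<delta>" "\<delta> < 1 / 6" and m2N: "m2 \<le> N1"
    and m2: "real m2 \<ge> r * (eta_param U)\<^sup>2 * max (2 * ln r) (2 * ln (3 / \<delta>))"
  shows "measure_pmf.prob (row_draws N1 m2) (- {ys. length ys = m2 \<and> distinct ys \<and> set ys \<subseteq> {..<N1} \<and>
    perp r (map (\<lambda>j a. U $$ (j, a)) ys) = (\<lambda>a b. 0)}) \<le> \<delta>"
proof -
  let ?u = "\<lambda>j a. U $$ (j, a)"
  let ?A = "{..<N1}"
  let ?D = "distinct_lists ?A m2"
  have d: "dim_row U = N1" "dim_col U = r" using U by simp_all
  have N1: "0 < N1" using orthonormal_entries[OF U onb, of 0 0] r by (cases "N1 = 0") simp_all
  define x where "x = Max ((\<lambda>(i, j). \<bar>U $$ (i, j)\<bar>) ` ({..<N1} \<times> {..<r}))"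
  define B where "B = r * x\<^sup>2"
  have eta: "(eta_param U)\<^sup>2 = N1 * x\<^sup>2" unfolding eta_param_def d x_def[symmetric] by (simp add: power_mult_distrib)
  have u: "parseval_frame r ?A ?u"
    unfolding parseval_frame_def using orthonormal_entries[OF U onb] by blast
  have B: "ip r (?u j) (?u j) \<le> B" if "j \<in> ?A" for j
  proof -
    have "\<bar>U $$ (j, a)\<bar> \<le> x" if "a < r" for a
      unfolding x_def using \<open>j \<in> ?A\<close> that by (intro Max_ge) (auto intro!: image_eqI[of _ _ "(j, a)"])
    then have "ip r (?u j) (?u j) \<le> (\<Sum>a<r. x\<^sup>2)"
      unfolding ip_def by (intro sum_mono) (metis abs_ge_zero lessThan_iff power2_abs power2_eq_square power_mono)
    then show ?thesis by (simp add: B_def)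
  qed
  have S_eq: "r * (eta_param U)\<^sup>2 = N1 * B" unfolding eta B_def by simp
  have "real r \<le> card ?A * B" by (rule parseval_frame_le_card[OF u _ B]) simp_all
  then have S: "1 \<le> card ?A * B" using r by simp
  have "measure_pmf.prob (pmf_of_set ?D) {ys. perp r (map ?u ys) \<noteq> (\<lambda>a b. 0)} \<le> r * (1 - 1 / (card ?A * B)) ^ m2"
    by (rule prob_not_spanning_distinct[OF _ u B S]) (use m2N in simp_all)
  also have "\<dots> \<le> \<delta>" by (rule row_sampling_bound[OF r \<delta> S]) (use m2 in \<open>simp add: S_eq\<close>)
  finally have bad: "measure_pmf.prob (pmf_of_set ?D) {ys. perp r (map ?u ys) \<noteq> (\<lambda>a b. 0)} \<le> \<delta>" .
  have D: "finite ?D" "?D \<noteq> {}" by (rule finite_distinct_lists, simp, rule distinct_lists_nonempty) (use m2N in simp_all)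
  have supp: "set_pmf (pmf_of_set ?D) = ?D" by (rule set_pmf_of_set[OF D(2,1)])
  have "measure_pmf.prob (pmf_of_set ?D) (- {ys. length ys = m2 \<and> distinct ys \<and> set ys \<subseteq> ?A \<and>
      perp r (map ?u ys) = (\<lambda>a b. 0)}) \<le> measure_pmf.prob (pmf_of_set ?D) {ys. perp r (map ?u ys) \<noteq> (\<lambda>a b. 0)}"
  proof (rule measure_pmf.finite_measure_mono_AE)
    show "AE ys in measure_pmf (pmf_of_set ?D). ys \<in> - {ys. length ys = m2 \<and> distinct ys \<and> set ys \<subseteq> ?A \<and>
      perp r (map ?u ys) = (\<lambda>a b. 0)} \<longrightarrow> ys \<in> {ys. perp r (map ?u ys) \<noteq> (\<lambda>a b. 0)}"
      unfolding AE_measure_pmf_iff supp by (auto simp: distinct_lists_def)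
  qed simp
  then show ?thesis using bad unfolding row_draws_def distinct_lists_def[symmetric] by linarith
qed

lemma rrd_recovery:
  fixes \<mu> \<alpha> \<beta> \<delta> q :: real
  assumes r: "1 \<le> r" and K: "1 \<le> K" and N2: "N2 = K + N2'" and \<sigma>: "0 < \<sigma>" and I: "I \<subseteq> {..<N2}"
    and model: "AE g in noise_law N1 I \<sigma>. data_model1 N1 N2 r K L (outlier_mat N1 N2 I g) I"
    and others: "\<forall>j \<in> {..<N2} - I. col L j \<in> vspan N1 (col L ` ({..<N2} - I - {j}))"
    and V: "V \<in> carrier_mat N2' r" and onbV: "is_orthonormal_basis V (rowspace (inlier_mat L))"
    and \<mu>: "row_incoherent V \<mu>"
    and U: "U \<in> carrier_mat N1 r" and onbU: "is_orthonormal_basis U (colspace L)"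
    and \<delta>: "0 < \<delta>" "\<delta> < 1 / 6"
    and \<alpha>: "\<alpha> \<ge> 20 * \<mu> * real r * ln (4 * real r / \<delta>)"
    and m1: "real m1 \<ge> \<beta> * \<alpha> * (real N2 / real N2')"
    and \<beta>: "\<beta> \<ge> 2 + 3 / \<alpha> * ln (2 / \<delta>)"
    and q: "min (real m1 * real K / real N2) (real K) \<le> q"
    and m2a: "real m2 \<ge> r * (eta_param U)\<^sup>2 * max (2 * ln r) (2 * ln (3 / \<delta>))"
    and m2b: "real m2 \<ge> r + q + 2 * ln (2 / \<delta>) + sqrt (8 * q * ln (2 / \<delta>))"
    and m2c: "real m2 \<ge> r + 1 + 2 * ln (2 * real K / \<delta>) + sqrt (8 * ln (2 * real K / \<delta>))"
    and m2N: "m2 \<le> N1"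
  shows "\<P>((xs, ys, g) in rrd_law N1 N2 m1 m2 I \<sigma>. rrd_success L (outlier_mat N1 N2 I g) xs ys) \<ge> 1 - 6 * \<delta>"
proof -
  have W: "prob_space (noise_law N1 I \<sigma>)"
    unfolding noise_law_def gaussian_def[symmetric] by (intro prob_space_PiM prob_space_gaussian \<sigma>)
  \<comment> \<open>The model holds almost surely, hence for some outcome; the facts extracted
    concern only \<open>L\<close> and \<open>I\<close> and so do not depend on it.\<close>
  obtain g where "data_model1 N1 N2 r K L (outlier_mat N1 N2 I g) I"
    using eventually_happens'[OF _ model] prob_space.emeasure_space_1[OF W] by (auto simp: ae_filter_eq_bot_iff)
  then have L: "L \<in> carrier_mat N1 N2" and cardI: "card I = K"
    and LI: "\<And>i. i \<in> I \<Longrightarrow> col L i = 0\<^sub>v N1" and nz: "nonzero_cols L = {..<N2} - I"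
    by (auto simp: data_model1_def)
  define J where "J = {..<N2} - I"
  have cardJ: "N2' = card J"
    unfolding J_def using I finite_subset[OF I] cardI N2 by (simp add: card_Diff_subset)
  obtain v X Y where v: "parseval_frame r {..<N2} v" "\<And>j. j \<notin> J \<Longrightarrow> v j = (\<lambda>a. 0)"
      "\<And>j. ip r (v j) (v j) \<le> r * \<mu> / N2'" and N2': "0 < N2'"
    and X: "X \<in> carrier_mat N1 r" and Y: "Y \<in> carrier_mat r N1"
    and colX: "\<And>j. j \<in> J \<Longrightarrow> col L j = X *\<^sub>v vec r (v j)" and colY: "\<And>j. j \<in> J \<Longrightarrow> vec r (v j) = Y *\<^sub>v col L j"
    using inlier_coordinates[OF L nz[folded J_def] cardJ V onbV \<mu> r] by metis
  define B where "B = r * \<mu> / N2'"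
  define l where "l = ln (4 * real r / \<delta>)"
  have r1: "1 \<le> real r" using r by simp
  have "real r \<le> N2 * B" using parseval_frame_le_card[OF v(1) _ v(3)] by (simp add: B_def)
  then have S: "1 \<le> N2 * B" using r by simp
  have B0: "0 < B" using S mult_nonneg_nonpos[of "real N2" B] by (cases "0 < B") auto
  have l0: "0 < l" unfolding l_def using \<delta> r1 by (intro ln_gt_zero) (simp add: field_simps)
  have eqB: "20 * \<mu> * real r * l = 20 * B * N2' * l" using N2' by (simp add: B_def)
  have \<alpha>l: "20 * B * N2' * l \<le> \<alpha>" using \<alpha> unfolding l_def[symmetric] eqB .
  have "0 < 20 * B * N2' * l" using B0 l0 N2' by simp
  then have \<alpha>0: "0 < \<alpha>" using \<alpha>l by (rule less_le_trans)
  have "0 \<le> 3 / \<alpha> * ln (2 / \<delta>)" using \<alpha>0 \<delta> by simp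
  \<comment> \<open>The lower bound 2 on \<beta> turns the 20 of \<alpha> into the 40 of the column
    estimate; the factor N2/N2' then replaces N2' by N2, the number of columns that the draws range
    over.\<close>
  then have "2 * (20 * B * N2' * l) \<le> \<beta> * \<alpha>"
    using \<beta> \<alpha>l \<alpha>0 B0 l0 by (intro mult_mono) auto
  then have "2 * (20 * B * N2' * l) * (real N2 / real N2') \<le> \<beta> * \<alpha> * (real N2 / real N2')"
    by (rule mult_right_mono) simp
  then have m1': "real m1 \<ge> 40 * (N2 * B) * ln (4 * real r / \<delta>)"
    using m1 N2' unfolding l_def[symmetric] by (simp add: algebra_simps)
  define GX where "GX = {xs. set xs \<subseteq> {..<N2} \<and>
    (\<forall>i. perp r (map (omit i v) xs) = (\<lambda>a b. 0)) \<and> r + card (set xs \<inter> I) \<le> m2}"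
  have "measure_pmf.prob (col_draws N2 m1) (- GX) \<le> 2 * \<delta>"
    unfolding GX_def
  proof (rule prob_bad_columns[OF r K N2 N2' I cardI v(1) v(3)[folded B_def] _ \<delta> m1' q m2b])
    fix i P assume "is_proj r P" and *: "\<And>j. j \<in> {..<N2} \<Longrightarrow> j \<noteq> i \<Longrightarrow> mv r P (v j) = (\<lambda>a. 0)"
    show "mv r P (v i) = (\<lambda>a. 0)"
      by (rule coloop_free_transfer[where J = J, OF L Y v(2) colY]) (use others * in \<open>auto simp: J_def\<close>)
  qed
  then have PX: "1 - 2 * \<delta> \<le> measure_pmf.prob (col_draws N2 m1) GX" by (rule prob_compl_ge)
  define GY where "GY = {ys. length ys = m2 \<and> distinct ys \<and> set ys \<subseteq> {..<N1} \<and>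
    perp r (map (\<lambda>j a. U $$ (j, a)) ys) = (\<lambda>a b. 0)}"
  have "measure_pmf.prob (row_draws N1 m2) (- GY) \<le> \<delta>"
    unfolding GY_def by (rule prob_bad_rows[OF r U onbU \<delta> m2N m2a])
  then have PY: "1 - \<delta> \<le> measure_pmf.prob (row_draws N1 m2) GY" by (rule prob_compl_ge)
  have "1 \<le> 2 * real K / \<delta>" using K \<delta> by (simp add: field_simps)
  then have "0 \<le> ln (2 * real K / \<delta>)" by (rule ln_ge_zero)
  then have "r < m2" using m2c real_sqrt_ge_zero[of "8 * ln (2 * real K / \<delta>)"] by linarith
  have ae: "AE g in noise_law N1 I \<sigma>. rrd_success L (outlier_mat N1 N2 I g) xs ys"
    if xs: "xs \<in> GX" and ys: "ys \<in> GY" for xs ys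
  proof (rule AE_rrd_success[OF \<sigma> I L LI U])
    show "colspace U = colspace L" using onbU by (simp add: is_orthonormal_basis_def)
    show "col L i \<in> vspan N1 (col L ` (set xs - I - {i}))" if i: "i \<in> {..<N2} - I" for i
    proof -
      have "set xs \<inter> J = set xs - I" using xs by (auto simp: GX_def J_def)
      moreover have "perp r (map (omit i v) xs) = (\<lambda>a b. 0)" using xs by (simp add: GX_def)
      ultimately show ?thesis
        using spanning_of_perp_eq_0[where J = J, OF L X v(2) colX, of i xs] i unfolding J_def by simp
    qed
  qed (use xs ys \<open>r < m2\<close> in \<open>auto simp: GX_def GY_def\<close>)
  \<comment> \<open>Columns and rows are independent, so their success probabilities multiply; the
    product is at least \<open>1 - 3 * \<delta>\<close>, well within the claim.\<close>
  have "1 - 6 * \<delta> \<le> (1 - 2 * \<delta>) * (1 - \<delta>)" using \<delta> by (simp add: algebra_simps)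
  also have "\<dots> \<le> measure_pmf.prob (col_draws N2 m1) GX * measure_pmf.prob (row_draws N1 m2) GY"
    using PX PY \<delta> by (intro mult_mono) auto
  also have "\<dots> \<le> \<P>((xs, ys, g) in rrd_law N1 N2 m1 m2 I \<sigma>. rrd_success L (outlier_mat N1 N2 I g) xs ys)"
    unfolding rrd_law_def
    by (rule prob_triple_product_ge[OF W pred_rrd_success[OF L measurable_mat_outlier_mat[OF \<sigma>]] ae])
  finally show ?thesis .
qed

theorem theorem2:
  shows "\<exists>c1 c2 :: real. c1 > 0 \<and> c2 > 0 \<and>
    (\<forall>(N1::nat) (N2::nat) (N2'::nat) (r::nat) (K::nat) (m1::nat) (m2::nat)
       (L::real mat) (I::nat set) (U::real mat) (V'::real mat)
       (\<sigma>::real) (\<mu>\<^sub>v::real) (\<eta>\<^sub>u::real) (c::real) (\<delta>::real) (\<alpha>::real) (\<beta>::real) (q::real).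
      1 \<le> r \<longrightarrow> 1 \<le> K \<longrightarrow> N2 = K + N2' \<longrightarrow> 0 < \<sigma> \<longrightarrow>
      I \<subseteq> {..<N2} \<longrightarrow>
      (AE g in noise_law N1 I \<sigma>. data_model1 N1 N2 r K L (outlier_mat N1 N2 I g) I) \<longrightarrow>
      (\<forall>j \<in> {..<N2} - I. col L j \<in> vspan N1 (col L ` ({..<N2} - I - {j}))) \<longrightarrow>
      V' \<in> carrier_mat N2' r \<longrightarrow> is_orthonormal_basis V' (rowspace (inlier_mat L)) \<longrightarrow>
      row_incoherent V' \<mu>\<^sub>v \<longrightarrow>
      U \<in> carrier_mat N1 r \<longrightarrow> is_orthonormal_basis U (colspace L) \<longrightarrow>
      \<eta>\<^sub>u = eta_param U \<longrightarrow>
      1 < c \<longrightarrow> 0 < \<delta> \<longrightarrow> \<delta> < 1 / 6 \<longrightarrow>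
      \<alpha> = max (20 * \<mu>\<^sub>v * real r * ln (4 * real r / \<delta>))
              (3 * c\<^sup>2 * (real K / real N2') * ln (2 / \<delta>)) \<longrightarrow>
      real m1 \<ge> \<beta> * \<alpha> * (real N2 / real N2') \<longrightarrow>
      \<beta> \<ge> 2 + 3 / \<alpha> * ln (2 / \<delta>) \<longrightarrow>
      q = \<alpha> * (\<beta> * real K / real N2' + 1 / c) \<longrightarrow>
      min (real m1 * real K / real N2) (real K) \<le> q \<longrightarrow>
      real m2 \<ge> Max {real r * \<eta>\<^sub>u\<^sup>2 * max (c1 * ln (real r)) (c2 * ln (3 / \<delta>)),
                    real r + q + 2 * ln (2 / \<delta>) + sqrt (8 * q * ln (2 / \<delta>)),
                    real r + 1 + 2 * ln (2 * real K / \<delta>) + sqrt (8 * ln (2 * real K / \<delta>))} \<longrightarrow>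
      m2 \<le> N1 \<longrightarrow>
      \<P>((xs, ys, g) in rrd_law N1 N2 m1 m2 I \<sigma>.
          rrd_success L (outlier_mat N1 N2 I g) xs ys) \<ge> 1 - 6 * \<delta>)"
\<comment> \<open>Both constants are 2, as required by \<open>row_sampling_bound\<close>; goals 1
  and 2 are their positivity.\<close>
proof (rule exI[of _ 2], rule exI[of _ 2], intro conjI allI impI, goal_cases)
  case (3 N1 N2 N2' r K m1 m2 L I U V' \<sigma> \<mu> \<eta> c \<delta> \<alpha> \<beta> q)
  let ?M = "{real r * \<eta>\<^sup>2 * max (2 * ln (real r)) (2 * ln (3 / \<delta>)),
    real r + q + 2 * ln (2 / \<delta>) + sqrt (8 * q * ln (2 / \<delta>)),
    real r + 1 + 2 * ln (2 * real K / \<delta>) + sqrt (8 * ln (2 * real K / \<delta>))}"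
  have m2: "x \<le> real m2" if "x \<in> ?M" for x
    using Max_ge[of ?M x] that 3(22) by (meson finite.emptyI finite.insertI order_trans)
  show ?case
    by (rule rrd_recovery[OF 3(1-8) 3(9-12) 3(15,16) _ 3(18,19,21)])
      (use 3 m2 in simp_all)
qed simp_all

end
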